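(* Let $Z$ be the current iterate of the BPSD-id and $Z'$ the next iterate, where $Z$ has full rank and all its $\widetilde k$ columns belong to $\mathrm{span}\{V\}$, and let the preconditioner $K$ be effectively positive definite. Let $\nu<\lambda_i$, and let $\varepsilon=(\beta-\alpha)/(\beta+\alpha)$ be the quality parameter of $K$ with respect to $\nu$. Let $\theta_1\le\cdots\le\theta_{\widetilde k}$ and $\theta'_1\le\cdots\le\theta'_{\widetilde k}$ be the Ritz values of $(H,S)$ in $\mathrm{span}\{Z\}$ and $\mathrm{span}\{Z'\}$, respectively. If $\theta_t\in(\lambda_j,\lambda_{j+1})$ for some $t\in\{1,\ldots,\widetilde k\}$ and a certain $j\ge i-1+t$, then $$\frac{\theta'_t-\lambda_j}{\lambda_{j+1}-\theta'_t}\le\left(\frac{\kappa+\varepsilon(2-\kappa)}{(2-\kappa)+\varepsilon\kappa}\right)^2\frac{\theta_t-\lambda_j}{\lambda_{j+1}-\theta_t}\quad\text{with}\quad \kappa=\left(\frac{\lambda_j-\nu}{\lambda_{j+1}-\nu}\right)\left(\frac{\lambda_n-\lambda_{j+1}}{\lambda_n-\lambda_j}\right).$$ Moreover, equality in this bound is attainable in the limit case $\theta_t\to\lambda_j$ in an invariant subspace of $(H,S)$ associated with the eigenvalues $\lambda_j$, $\lambda_{j+1}$ and $\lambda_n$.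
   Context: Setting. $H,S\in\mathbb{C}^{n\times n}$ are Hermitian, $S$ is positive definite, and $\lambda_1\le\cdots\le\lambda_n$ are the (real) eigenvalues of the pair $(H,S)$, i.e. of $Hu=\lambda Su$. Fix $i\in\{1,\ldots,n\}$. Let $u_1,\ldots,u_n$ be an $S$-orthonormal basis of $\mathbb{C}^n$ with $Hu_l=\lambda_lSu_l$, and set $U=[u_1,\ldots,u_{i-1}]$ (the already computed eigenvectors, assumed exact) and $V=[u_i,\ldots,u_n]$. Thus $HV=SV\Lambda$ with $\Lambda=\mathrm{diag}(\lambda_i,\ldots,\lambda_n)$, and $\mathrm{span}\{V\}$ is the $S$-orthogonal complement of $\mathrm{span}\{U\}$. Here $\mathrm{span}\{\cdot\}$ denotes the span of all columns of the listed matrices. Ritz pairs. For a subspace with basis matrix $W$, the Ritz values of $(H,S)$ in it are the eigenvalues of the pair $(W^*HW,W^*SW)$ (counted with multiplicity), and the vectors $Wg$ with $g$ a corresponding eigenvector are the associated Ritz vectors. BPSD-id (block preconditioned steepest descent with implicit deflation), block size $\widetilde k$. Each iterate $Z\in\mathbb{C}^{n\times\widetilde k}$ consists of $S$-orthonormal Ritz vectors of $(H,S)$ in $\mathrm{span}\{Z\}$ (so $Z^*SZ=I$ and $Z^*HZ$ is diagonal). With a Hermitian preconditioner $K\in\mathbb{C}^{n\times n}$, let $R=HZ-SZ(Z^*HZ)$ and $P=KR$. The next iterate $Z'$ consists of $S$-orthonormal Ritz vectors associated with the $i$th to the $(i-1+\widetilde k)$th smallest Ritz values of $(H,S)$ in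 $\mathrm{span}\{U,Z,P\}$, where the columns of $U$ serve as Ritz vectors for the $i-1$ smallest Ritz values and the columns of $Z'$ are $S$-orthogonal to them. Preconditioner. $K$ is called effectively positive definite if $\widetilde K=V^*SKSV$ is positive definite. For $\nu<\lambda_i$ put $\Lambda_\nu=\Lambda-\nu I_{n-i+1}$, let $\alpha$ and $\beta$ be the smallest and largest eigenvalues of $\widetilde K\Lambda_\nu$ (they satisfy $\beta\ge\alpha>0$), and define the quality parameter $\varepsilon=(\beta-\alpha)/(\beta+\alpha)\in[0,1)$. With $\omega=2/(\beta+\alpha)$ one has $\|I_{n-i+1}-\omega\widetilde K\Lambda_\nu\|_{\Lambda_\nu}\le\varepsilon<1$, where $\|\cdot\|_{\Lambda_\nu}$ is the operator norm induced by the vector norm $(x^*\Lambda_\nu x)^{1/2}$. The last sentence of the claim is a sharpness statement: for suitable iterates and suitable preconditioners with the given $\varepsilon$, with the relevant Ritz vector in such an invariant subspace, the bound is attained in the limit as $\theta_t\to\lambda_j$.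
   Formalization: The attainability claim is stated for j+2+(k̃−t) ≤ n; when n−j = k̃−t+1 the enlarged subspace forces θ'_t ≤ λ_j, so equality cannot be approached unless the factor is zero (ε = 0 and λ_{j+1} = λ_n). *)

theory Defs
  imports
    "HOL-Analysis.Analysis"
    "HOL-Computational_Algebra.Fundamental_Theorem_Algebra"
    "Jordan_Normal_Form.Spectral_Radius"
    "Jordan_Normal_Form.Schur_Decomposition"
    "Jordan_Normal_Form.DL_Rank"
begin

definition hermitian_mat :: "nat \<Rightarrow> complex mat \<Rightarrow> bool" where
  "hermitian_mat n A \<longleftrightarrow> A \<in> carrier_mat n n \<and> mat_adjoint A = A"

text \<open>\<open>v \<bullet>c w\<close> conjugates its second argument, so \<open>(A *\<^sub>v x) \<bullet>c x\<close> is \<open>x\<^sup>* A x\<close>,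
  which is real for Hermitian \<open>A\<close>.\<close>

definition pos_def_mat :: "nat \<Rightarrow> complex mat \<Rightarrow> bool" where
  "pos_def_mat n A \<longleftrightarrow> hermitian_mat n A \<and>
     (\<forall>x \<in> carrier_vec n. x \<noteq> 0\<^sub>v n \<longrightarrow> 0 < Re ((A *\<^sub>v x) \<bullet>c x))"

text \<open>The eigenvalues of a pair \<open>(A, B)\<close>, i.e. of \<open>A u = \<mu> B u\<close>, are the roots of
  \<open>det (\<mu> B - A)\<close>, counted with multiplicity. They are real when \<open>A\<close> is Hermitian and \<open>B\<close> is
  positive definite, the only case in which the notions below are used; \<open>Re\<close> merely changes
  the type.\<close>

definition pair_char_poly :: "complex mat \<Rightarrow> complex mat \<Rightarrow> complex poly" where
  "pair_char_poly A B =
     Determinant.det ([:0, 1:] \<cdot>\<^sub>m map_mat (\<lambda>b. [:b:]) B - map_mat (\<lambda>a. [:a:]) A)"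

definition pair_eigenvalues :: "complex mat \<Rightarrow> complex mat \<Rightarrow> real list" where
  "pair_eigenvalues A B = sorted_list_of_multiset (image_mset Re (proots (pair_char_poly A B)))"

text \<open>The \<open>l\<close>-th smallest eigenvalue of \<open>(A, B)\<close>, with \<open>l\<close> counted from 1.\<close>

definition pair_eig :: "complex mat \<Rightarrow> complex mat \<Rightarrow> nat \<Rightarrow> real" where
  "pair_eig A B l = pair_eigenvalues A B ! (l - 1)"

definition full_col_rank :: "nat \<Rightarrow> complex mat \<Rightarrow> bool" where
  "full_col_rank n W \<longleftrightarrow> dim_row W = n \<and> vec_space.rank n W = dim_col W"

definition span_of :: "nat \<Rightarrow> complex vec set \<Rightarrow> complex vec set" where
  "span_of n X = LinearCombinations.module.span class_ring (module_vec TYPE(complex) n) X"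

definition compress :: "complex mat \<Rightarrow> complex mat \<Rightarrow> complex mat" where
  "compress A W = mat_adjoint W * A * W"

text \<open>The \<open>l\<close>-th smallest Ritz value (\<open>l\<close> counted from 1) of \<open>(H, S)\<close> in the subspace with
  basis matrix \<open>W\<close>.\<close>

definition ritz_value :: "complex mat \<Rightarrow> complex mat \<Rightarrow> complex mat \<Rightarrow> nat \<Rightarrow> real" where
  "ritz_value H S W l = pair_eig (compress H W) (compress S W) l"

definition ritz_vector ::
    "complex mat \<Rightarrow> complex mat \<Rightarrow> complex mat \<Rightarrow> real \<Rightarrow> complex vec \<Rightarrow> bool" where
  "ritz_vector H S W \<theta> z \<longleftrightarrow>
     (\<exists>g \<in> carrier_vec (dim_col W). g \<noteq> 0\<^sub>v (dim_col W) \<and>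
        compress H W *\<^sub>v g = complex_of_real \<theta> \<cdot>\<^sub>v (compress S W *\<^sub>v g) \<and> z = W *\<^sub>v g)"

definition bpsd_iterate ::
    "nat \<Rightarrow> complex mat \<Rightarrow> complex mat \<Rightarrow> nat \<Rightarrow> complex mat \<Rightarrow> bool" where
  "bpsd_iterate n H S k Z \<longleftrightarrow> Z \<in> carrier_mat n k \<and>
     compress S Z = 1\<^sub>m k \<and> diagonal_mat (compress H Z)"

definition residual :: "complex mat \<Rightarrow> complex mat \<Rightarrow> complex mat \<Rightarrow> complex mat" where
  "residual H S Z = H * Z - S * Z * compress H Z"

text \<open>One step \<open>Z \<mapsto> Z'\<close> of BPSD-id. The columns of \<open>U\<close>, \<open>Z\<close> and \<open>P\<close> together may be linearly
  dependent, so a basis matrix \<open>W\<close> of their span is introduced. With \<open>dim_col U = i - 1\<close>, the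
  columns of \<open>Z'\<close> belong to the Ritz values number \<open>i, \<dots>, i - 1 + k\<close>.\<close>

definition bpsd_id_step ::
    "nat \<Rightarrow> complex mat \<Rightarrow> complex mat \<Rightarrow> complex mat \<Rightarrow> nat \<Rightarrow> complex mat \<Rightarrow>
     complex mat \<Rightarrow> complex mat \<Rightarrow> bool" where
  "bpsd_id_step n H S U k K Z Z' \<longleftrightarrow>
     (let P = K * residual H S Z in
      \<exists>W. full_col_rank n W \<and>
          span_of n (set (cols W)) = span_of n (set (cols U) \<union> set (cols Z) \<union> set (cols P)) \<and>
          (\<forall>l \<in> {1..dim_col U}. ritz_vector H S W (ritz_value H S W l) (col U (l - 1))) \<and>
          Z' \<in> carrier_mat n k \<and>
          (\<forall>l \<in> {1..k}. ritz_vector H S W (ritz_value H S W (dim_col U + l)) (col Z' (l - 1))) \<and>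
          compress S Z' = 1\<^sub>m k \<and>
          mat_adjoint U * S * Z' = 0\<^sub>m (dim_col U) k)"

definition effective_prec :: "complex mat \<Rightarrow> complex mat \<Rightarrow> complex mat \<Rightarrow> complex mat" where
  "effective_prec S V K = mat_adjoint V * S * K * S * V"

definition effectively_pos_def :: "complex mat \<Rightarrow> complex mat \<Rightarrow> complex mat \<Rightarrow> bool" where
  "effectively_pos_def S V K \<longleftrightarrow> pos_def_mat (dim_col V) (effective_prec S V K)"

text \<open>\<open>Lnu\<close> is the diagonal matrix \<open>\<Lambda> - \<nu> I\<close>. If \<open>K\<close> is effectively positive definite and \<open>Lnu\<close>
  is positive definite, then all eigenvalues of the product are real and positive.\<close>

definition quality_param :: "complex mat \<Rightarrow> complex mat \<Rightarrow> complex mat \<Rightarrow> complex mat \<Rightarrow> real" where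
  "quality_param S V K Lnu =
     (let \<sigma> = Re ` spectrum (effective_prec S V K * Lnu); \<alpha> = Min \<sigma>; \<beta> = Max \<sigma>
      in (\<beta> - \<alpha>) / (\<beta> + \<alpha>))"

end

(*
  In S-orthonormal eigenvector coordinates and after the shift by nu, the step acts on the positive
  diagonal matrix A = Lambda - nu, and the preconditioner T satisfies |I - omega T A| <= eps in the
  A-norm.  For Y = first t Ritz vectors and f = Y (Theta - nu) g, the vector
  Y g - s f - omega T (A Y g - f) of the new search space equals (1/A - s) f + d, where
  |d|_A <= eps |Y g - f/A|_A <= eps |z f - f/A|_A for every real z, since the residual A Y g - f is
  orthogonal to the columns of Y.  With z = 1/(theta_t - nu) and one fixed s, bounding d coordinatewise
  reduces "Rayleigh quotient <= claimed bound" to the sign of a cubic polynomial in u = 1/mu, which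
  only has to be checked outside the gap ]1/mu_{j+1}, 1/mu_j[.  These vectors together with the columns
  of U form a space of dimension i - 1 + t, so the min-max principle gives the bound.

  For sharpness, a diagonal preconditioner with T A = 1 - eps and 1 + eps on u_{j+1} and u_n makes the
  step a steepest descent whose error near u_j lives in span {u_{j+1}, u_n}; the Kantorovich
  worst case for this two-dimensional problem attains the factor in the limit.
*)
theory Submission
  imports Defs
begin

unbundle no vec_syntax
unbundle no inner_syntax

section \<open>Hermitian pencils\<close>

text \<open>Min-max needs a whole trial space, so one \<open>s\<close> has to serve all its vectors;
  this is why a fixed filter replaces a line search. The comparison vector is f, not Y g: being
  itself a combination of the first t Ritz vectors, it has a Rayleigh quotient at most theta_t, and
  exact inversion of A multiplies its coordinates by u. Unwanted components have u in [b, a] =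
  [1/mu_n, 1/mu_{j+1}], harmless ones u >= d = 1/mu_j. With midpoint m and half-width h of [b, a],
  kappa = (a - b) / (d - b) = 2 h / (d - b). For eps = 0 the filter |u - m| is at most h on [b, a]
  and at least d - m beyond d, whence the factor h / (d - m) = kappa / (2 - kappa); a disturbance
  turns it into (h + eps (d - m)) / ((d - m) + eps h). The coordinatewise bounds recombine because
  they are governed by an affine function L of slope eps: eps (z - u) + L(u) = L(z), which leaves a
  multiple of the Rayleigh quotient inequality of f. In the extremal example the error operator has
  the two eigenvalues m1 : m2 = (1 - eps) (1 - kappa) : (1 + eps), and (m2 - m1) / (m2 + m1) is the
  same factor.\<close>

lemma dim_mat_adjoint [simp]: "dim_row (mat_adjoint A) = dim_col A" "dim_col (mat_adjoint A) = dim_row A"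
  by (auto simp: mat_adjoint_def)

lemma mat_adjoint_carrier [simp, intro]: "A \<in> carrier_mat m n \<Longrightarrow> mat_adjoint A \<in> carrier_mat n m"
  by (metis carrier_matD carrier_matI dim_mat_adjoint)

lemma mat_adjoint_index [simp]:
  fixes A :: "complex mat"
  shows "r < dim_col A \<Longrightarrow> c < dim_row A \<Longrightarrow> mat_adjoint A $$ (r, c) = cnj (A $$ (c, r))"
  by (auto simp: mat_adjoint_def mat_of_rows_def)

lemma mat_adjoint_adjoint [simp]: "mat_adjoint (mat_adjoint (A :: complex mat)) = A"
  by (rule eq_matI) auto

lemma mat_adjoint_mult:
  fixes A B :: "complex mat"
  assumes "A \<in> carrier_mat m n" "B \<in> carrier_mat n p"
  shows "mat_adjoint (A * B) = mat_adjoint B * mat_adjoint A"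
  by (rule eq_matI) (use assms in \<open>auto simp: scalar_prod_def mult.commute intro!: sum.cong\<close>)

lemma cprod_sum:
  fixes x y :: "complex vec"
  assumes "dim_vec y = n"
  shows "x \<bullet>c y = (\<Sum>r<n. x $ r * cnj (y $ r))"
  using assms by (auto simp: scalar_prod_def lessThan_atLeast0)

lemma mult_mat_vec_index:
  assumes "A \<in> carrier_mat m n" "x \<in> carrier_vec n" "r < m"
  shows "(A *\<^sub>v x) $ r = (\<Sum>s<n. A $$ (r, s) * x $ s)"
  using assms by (auto simp: scalar_prod_def lessThan_atLeast0)

lemma cprod_adjoint:
  fixes A :: "complex mat"
  assumes A: "A \<in> carrier_mat m n" and x: "x \<in> carrier_vec n" and y: "y \<in> carrier_vec m"
  shows "(A *\<^sub>v x) \<bullet>c y = x \<bullet>c (mat_adjoint A *\<^sub>v y)"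
proof -
  have "(A *\<^sub>v x) \<bullet>c y = (\<Sum>r<m. \<Sum>s<n. A $$ (r, s) * x $ s * cnj (y $ r))"
    using y by (subst cprod_sum[of _ m])
      (auto simp: mult_mat_vec_index[OF A x] sum_distrib_right intro!: sum.cong)
  also have "\<dots> = (\<Sum>s<n. \<Sum>r<m. A $$ (r, s) * x $ s * cnj (y $ r))"
    by (rule sum.swap)
  also have "\<dots> = x \<bullet>c (mat_adjoint A *\<^sub>v y)"
    using A by (subst cprod_sum[of _ n])
      (auto simp: mult_mat_vec_index[OF mat_adjoint_carrier[OF A] y] sum_distrib_left
         simp del: index_mult_mat_vec intro!: sum.cong)
  finally show ?thesis .
qed

lemma cprod_cnj:
  fixes x y :: "complex vec"
  assumes "x \<in> carrier_vec n" "y \<in> carrier_vec n"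
  shows "cnj (x \<bullet>c y) = y \<bullet>c x"
  using assms by (simp add: cprod_sum[of _ n] mult.commute)

lemma cprod_add_left:
  fixes x y z :: "complex vec"
  assumes "x \<in> carrier_vec n" "y \<in> carrier_vec n" "z \<in> carrier_vec n"
  shows "(x + y) \<bullet>c z = x \<bullet>c z + y \<bullet>c z"
  using assms by (simp add: cprod_sum[of _ n] distrib_right sum.distrib)

lemma cprod_smult_left:
  fixes x z :: "complex vec"
  assumes "x \<in> carrier_vec n" "z \<in> carrier_vec n"
  shows "(c \<cdot>\<^sub>v x) \<bullet>c z = c * (x \<bullet>c z)"
  using assms by (simp add: cprod_sum[of _ n] sum_distrib_left mult.assoc)

lemma cprod_add_right:
  fixes x y z :: "complex vec"
  assumes "x \<in> carrier_vec n" "y \<in> carrier_vec n" "z \<in> carrier_vec n"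
  shows "z \<bullet>c (x + y) = z \<bullet>c x + z \<bullet>c y"
  using assms by (simp add: cprod_sum[of _ n] distrib_left sum.distrib)

lemma cprod_smult_right:
  fixes x z :: "complex vec"
  assumes "x \<in> carrier_vec n" "z \<in> carrier_vec n"
  shows "z \<bullet>c (c \<cdot>\<^sub>v x) = cnj c * (z \<bullet>c x)"
  using assms by (simp add: cprod_sum[of _ n] sum_distrib_left mult_ac)

lemma compress_carrier [simp, intro]:
  "A \<in> carrier_mat n n \<Longrightarrow> W \<in> carrier_mat n k \<Longrightarrow> compress A W \<in> carrier_mat k k"
  by (auto simp: compress_def)

lemma cprod_compress:
  assumes A: "A \<in> carrier_mat n n" and W: "W \<in> carrier_mat n k"
    and a: "a \<in> carrier_vec k" and b: "b \<in> carrier_vec k"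
  shows "(compress A W *\<^sub>v a) \<bullet>c b = (A *\<^sub>v (W *\<^sub>v a)) \<bullet>c (W *\<^sub>v b)"
proof -
  have "compress A W *\<^sub>v a = mat_adjoint W *\<^sub>v (A *\<^sub>v (W *\<^sub>v a))"
    using A W a unfolding compress_def
    by (subst assoc_mult_mat_vec[of _ k n _ k], auto intro: mult_carrier_mat[of _ k n _ n],
        subst assoc_mult_mat_vec[of _ k n _ n], auto)
  then show ?thesis
    using cprod_adjoint[of "mat_adjoint W" k n "A *\<^sub>v (W *\<^sub>v a)" b] A W a b by auto
qed

lemma adjoint_form_index:
  fixes A W Z :: "complex mat"
  assumes A: "A \<in> carrier_mat n n" and W: "W \<in> carrier_mat n k" and Z: "Z \<in> carrier_mat n l" and r: "r < k" "s < l"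
  shows "(mat_adjoint W * A * Z) $$ (r, s) = (A *\<^sub>v col Z s) \<bullet>c col W r"
proof -
  have "(mat_adjoint W * A * Z) $$ (r, s) = row (mat_adjoint W) r \<bullet> col (A * Z) s"
    using A W Z r by (subst assoc_mult_mat[of _ k n _ n _ l]) auto
  also have "col (A * Z) s = A *\<^sub>v col Z s"
    using A Z r by auto
  also have "row (mat_adjoint W) r = conjugate (col W r)"
    using W r by (intro eq_vecI) auto
  also have "conjugate (col W r) \<bullet> (A *\<^sub>v col Z s) = (A *\<^sub>v col Z s) \<bullet>c col W r"
    using A W Z r by (intro comm_scalar_prod[of _ n]) auto
  finally show ?thesis .
qed

lemma compress_index:
  assumes A: "A \<in> carrier_mat n n" and W: "W \<in> carrier_mat n k" and r: "r < k" "s < k"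
  shows "compress A W $$ (r, s) = (A *\<^sub>v col W s) \<bullet>c col W r"
  unfolding compress_def by (rule adjoint_form_index[OF A W W r])

lemma compress_compress:
  assumes "A \<in> carrier_mat n n" "W \<in> carrier_mat n k" "X \<in> carrier_mat k m"
  shows "compress (compress A W) X = compress A (W * X)"
proof -
  have "mat_adjoint X * (mat_adjoint W * A * W) * X = mat_adjoint X * ((mat_adjoint W * A * W) * X)"
    using assms by (intro assoc_mult_mat[of _ m k _ k _ m]) auto
  also have "(mat_adjoint W * A * W) * X = (mat_adjoint W * A) * (W * X)"
    using assms by (intro assoc_mult_mat[of _ k n _ k _ m]) auto
  also have "\<dots> = mat_adjoint W * (A * (W * X))"
    using assms by (intro assoc_mult_mat[of _ k n _ n _ m]) auto
  also have "mat_adjoint X * \<dots> = (mat_adjoint X * mat_adjoint W) * (A * (W * X))"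
    using assms by (intro assoc_mult_mat[symmetric, of _ m k _ n _ m]) auto
  also have "\<dots> = (mat_adjoint X * mat_adjoint W) * A * (W * X)"
    using assms by (intro assoc_mult_mat[symmetric, of _ m n _ n _ m]) auto
  finally show ?thesis
    using assms by (simp add: compress_def mat_adjoint_mult[of _ n k])
qed

lemma hermitian_cprod:
  assumes "hermitian_mat n A" "x \<in> carrier_vec n" "y \<in> carrier_vec n"
  shows "(A *\<^sub>v x) \<bullet>c y = cnj ((A *\<^sub>v y) \<bullet>c x)"
  using assms cprod_adjoint[of A n n x y] cprod_cnj[of "A *\<^sub>v y" n x]
  by (auto simp: hermitian_mat_def)

lemma hermitian_compress:
  assumes "hermitian_mat n A" "W \<in> carrier_mat n k"
  shows "hermitian_mat k (compress A W)"
proof -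
  have A: "A \<in> carrier_mat n n" "mat_adjoint A = A" using assms by (auto simp: hermitian_mat_def)
  have "mat_adjoint (mat_adjoint W * A * W) = mat_adjoint W * mat_adjoint (mat_adjoint W * A)"
    using A assms(2) by (intro mat_adjoint_mult[of _ k n _ k]) auto
  also have "mat_adjoint (mat_adjoint W * A) = A * W"
    using A assms(2) by (subst mat_adjoint_mult[of _ k n _ n]) auto
  also have "mat_adjoint W * (A * W) = mat_adjoint W * A * W"
    using A assms(2) by (intro assoc_mult_mat[symmetric, of _ k n _ n _ k]) auto
  finally show ?thesis using A assms(2) by (auto simp: hermitian_mat_def compress_def)
qed

lemma pos_def_compress:
  assumes B: "pos_def_mat n B" and W: "W \<in> carrier_mat n k"
    and inj: "\<And>a. a \<in> carrier_vec k \<Longrightarrow> W *\<^sub>v a = 0\<^sub>v n \<Longrightarrow> a = 0\<^sub>v k"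
  shows "pos_def_mat k (compress B W)"
  unfolding pos_def_mat_def
proof (intro conjI ballI impI)
  have B': "B \<in> carrier_mat n n" using B by (auto simp: pos_def_mat_def hermitian_mat_def)
  show "hermitian_mat k (compress B W)"
    using B W by (auto simp: pos_def_mat_def intro: hermitian_compress)
  fix x :: "complex vec" assume x: "x \<in> carrier_vec k" "x \<noteq> 0\<^sub>v k"
  then have "W *\<^sub>v x \<noteq> 0\<^sub>v n" using inj by auto
  moreover have "W *\<^sub>v x \<in> carrier_vec n" using W x by auto
  ultimately show "0 < Re ((compress B W *\<^sub>v x) \<bullet>c x)"
    using B by (simp add: cprod_compress[OF B' W x(1) x(1)] pos_def_mat_def)
qed

lemma mat_diag_mult_vec:
  assumes "x \<in> carrier_vec n"
  shows "mat_diag n f *\<^sub>v x = Matrix.vec n (\<lambda>r. f r * x $ r)"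
proof (rule eq_vecI)
  fix r assume "r < dim_vec (Matrix.vec n (\<lambda>r. f r * x $ r))"
  then have r: "r < n" by simp
  have "(mat_diag n f *\<^sub>v x) $ r = (\<Sum>s<n. if r = s then f s * x $ s else 0)"
    unfolding mult_mat_vec_index[OF mat_diag_dim assms r]
    by (rule sum.cong) (use r in \<open>auto simp: mat_diag_def\<close>)
  then show "(mat_diag n f *\<^sub>v x) $ r = Matrix.vec n (\<lambda>r. f r * x $ r) $ r"
    using r by simp
qed (simp add: mat_diag_def)

section \<open>Simultaneous diagonalization of a Hermitian pencil\<close>

lemma pos_def_right_inverse:
  assumes B: "pos_def_mat n B"
  obtains C where "C \<in> carrier_mat n n" "B * C = 1\<^sub>m n"
proof -
  have B': "B \<in> carrier_mat n n" using B by (auto simp: pos_def_mat_def hermitian_mat_def)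
  have "Determinant.det B \<noteq> 0"
  proof
    assume "Determinant.det B = 0"
    then obtain v where v: "v \<in> carrier_vec n" "v \<noteq> 0\<^sub>v n" "B *\<^sub>v v = 0\<^sub>v n"
      using det_0_iff_vec_prod_zero_field[OF B'] by auto
    then show False using B by (fastforce simp: pos_def_mat_def)
  qed
  from det_non_zero_imp_unit[OF B' this, of "()"] that show ?thesis
    unfolding Units_def ring_mat_def by auto
qed

text \<open>With \<open>C\<close> the inverse of \<open>B\<close>, eigenvectors of the pair are
  eigenvectors of \<open>C * A\<close>, and a complex matrix of positive size has an eigenvalue. It
  is real because it is the quotient of two real quadratic forms, the denominator being
  positive.\<close>

lemma pencil_eigenvector_exists:
  assumes A: "hermitian_mat n A" and B: "pos_def_mat n B" and n: "0 < n"
  obtains x e where "x \<in> carrier_vec n" "(B *\<^sub>v x) \<bullet>c x = 1" "A *\<^sub>v x = complex_of_real e \<cdot>\<^sub>v (B *\<^sub>v x)"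
proof -
  have A': "A \<in> carrier_mat n n" using A by (auto simp: hermitian_mat_def)
  have BH: "hermitian_mat n B" using B by (auto simp: pos_def_mat_def)
  then have B': "B \<in> carrier_mat n n" by (auto simp: hermitian_mat_def)
  obtain C where C: "C \<in> carrier_mat n n" "B * C = 1\<^sub>m n" using pos_def_right_inverse[OF B] .
  have "C * A \<in> carrier_mat n n" using A' C by simp
  from spectrum_non_empty[OF this n] obtain c where "c \<in> spectrum (C * A)" by auto
  then obtain y where y: "y \<in> carrier_vec n" "y \<noteq> 0\<^sub>v n" "(C * A) *\<^sub>v y = c \<cdot>\<^sub>v y"
    using A' C by (auto simp: spectrum_def eigenvalue_def eigenvector_def)
  have "A *\<^sub>v y = (B * C) *\<^sub>v (A *\<^sub>v y)" using A' y C by simp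
  also have "\<dots> = B *\<^sub>v (C *\<^sub>v (A *\<^sub>v y))"
    using A' B' C y by (intro assoc_mult_mat_vec[of _ n n _ n]) auto
  also have "C *\<^sub>v (A *\<^sub>v y) = c \<cdot>\<^sub>v y"
    using A' C y(1) y(3) assoc_mult_mat_vec[of C n n A n y] by simp
  also have "B *\<^sub>v (c \<cdot>\<^sub>v y) = c \<cdot>\<^sub>v (B *\<^sub>v y)"
    by (rule mult_mat_vec[OF B' y(1)])
  finally have Ay: "A *\<^sub>v y = c \<cdot>\<^sub>v (B *\<^sub>v y)" .
  define b where "b = Re ((B *\<^sub>v y) \<bullet>c y)"
  have "0 < b" using B y by (auto simp: b_def pos_def_mat_def)
  have Bre: "(B *\<^sub>v y) \<bullet>c y = of_real b"
    using hermitian_cprod[OF BH y(1) y(1)] by (auto simp: b_def complex_eq_iff)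
  have "(A *\<^sub>v y) \<bullet>c y = c * of_real b"
    unfolding Ay using B' y by (simp add: cprod_smult_left[of _ n] Bre)
  moreover have "Im ((A *\<^sub>v y) \<bullet>c y) = 0"
    using arg_cong[OF hermitian_cprod[OF A y(1) y(1)], of Im] by simp
  ultimately have "c = of_real (Re c)" using \<open>0 < b\<close> by (auto simp: complex_eq_iff)
  define x where "x = of_real (1 / sqrt b) \<cdot>\<^sub>v y"
  show ?thesis
  proof
    show "x \<in> carrier_vec n" using y by (simp add: x_def)
    have "(B *\<^sub>v x) \<bullet>c x = of_real (1 / sqrt b) * (of_real (1 / sqrt b) * of_real b)"
      using y B' by (simp add: x_def mult_mat_vec[of _ n n] cprod_smult_left[of _ n] cprod_smult_right[of _ n] Bre)
    also have "\<dots> = of_real ((1 / sqrt b) * (1 / sqrt b) * b)"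
      by (simp only: of_real_mult mult.assoc)
    also have "(1 / sqrt b) * (1 / sqrt b) * b = 1" using \<open>0 < b\<close> by (simp add: field_simps)
    finally show "(B *\<^sub>v x) \<bullet>c x = 1" by simp
    show "A *\<^sub>v x = complex_of_real (Re c) \<cdot>\<^sub>v (B *\<^sub>v x)"
      using y A' B' Ay \<open>c = of_real (Re c)\<close>
      by (simp add: x_def mult_mat_vec[of _ n n] smult_smult_assoc mult.commute)
  qed
qed

text \<open>The single orthogonality equation is solved for the entry at a pivot \<open>p\<close>
  with \<open>w $ p \<noteq> 0\<close>; the other \<open>m\<close> entries stay free.
  \<open>ix\<close> enumerates the positions different from \<open>p\<close>.\<close>

lemma orthogonal_complement_matrix:
  fixes w :: "complex vec"
  assumes w: "w \<in> carrier_vec (Suc m)" "w \<noteq> 0\<^sub>v (Suc m)"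
  obtains N where "N \<in> carrier_mat (Suc m) m"
    "\<And>a. a \<in> carrier_vec m \<Longrightarrow> N *\<^sub>v a = 0\<^sub>v (Suc m) \<Longrightarrow> a = 0\<^sub>v m"
    "\<And>a. a \<in> carrier_vec m \<Longrightarrow> w \<bullet>c (N *\<^sub>v a) = 0"
proof -
  obtain p where p: "p < Suc m" "w $ p \<noteq> 0"
    using w by (metis carrier_vecD eq_vecI index_zero_vec)
  define ix where "ix l = (if l < p then l else Suc l)" for l
  have ix: "ix l \<noteq> p" "l < m \<Longrightarrow> ix l < Suc m" "ix l = ix l' \<longleftrightarrow> l = l'" for l l'
    by (auto simp: ix_def)
  define N where "N = Matrix.mat (Suc m) m
    (\<lambda>(r, l). (if r = ix l then 1 else 0) + (if r = p then - cnj (w $ ix l / w $ p) else 0))"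
  have N: "N \<in> carrier_mat (Suc m) m" by (simp add: N_def)
  have Nv: "(N *\<^sub>v a) $ r = (\<Sum>l<m. ((if r = ix l then 1 else 0)
      + (if r = p then - cnj (w $ ix l / w $ p) else 0)) * a $ l)"
    if "a \<in> carrier_vec m" "r < Suc m" for a r
    unfolding mult_mat_vec_index[OF N that] by (rule sum.cong) (use that in \<open>auto simp: N_def\<close>)
  show ?thesis
  proof
    show "N \<in> carrier_mat (Suc m) m" by fact
    fix a :: "complex vec" assume a: "a \<in> carrier_vec m"
    {
      assume 0: "N *\<^sub>v a = 0\<^sub>v (Suc m)"
      show "a = 0\<^sub>v m"
      proof (rule eq_vecI)
        fix l assume "l < dim_vec (0\<^sub>v m :: complex vec)"
        then have l: "l < m" by simp
        have "(N *\<^sub>v a) $ ix l = (\<Sum>l'<m. if l' = l then a $ l' else 0)"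
          unfolding Nv[OF a ix(2)[OF l]] by (rule sum.cong) (auto simp: ix(1) ix(3))
        then show "a $ l = 0\<^sub>v m $ l" using 0 l ix(2)[OF l] by simp
      qed (use a in auto)
    }
    have "w \<bullet>c (N *\<^sub>v a) = (\<Sum>r<Suc m. \<Sum>l<m. w $ r * cnj (((if r = ix l then 1 else 0)
      + (if r = p then - cnj (w $ ix l / w $ p) else 0)) * a $ l))"
      using N a by (subst cprod_sum[of _ "Suc m"])
        (auto simp: Nv sum_distrib_left simp del: index_mult_mat_vec sum.lessThan_Suc intro!: sum.cong)
    also have "\<dots> = (\<Sum>l<m. \<Sum>r<Suc m. w $ r * cnj (((if r = ix l then 1 else 0)
      + (if r = p then - cnj (w $ ix l / w $ p) else 0)) * a $ l))"
      by (rule sum.swap)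
    also have "\<dots> = (\<Sum>l<m. \<Sum>r<Suc m. (if r = ix l then w $ r * cnj (a $ l) else 0)
        + (if r = p then - (w $ r) * (w $ ix l / w $ p) * cnj (a $ l) else 0))"
      by (intro sum.cong) (auto simp: ix(1))
    also have "\<dots> = (\<Sum>l<m. w $ ix l * cnj (a $ l) - w $ p * (w $ ix l / w $ p) * cnj (a $ l))"
      by (rule sum.cong) (auto simp: sum.distrib ix(2) p(1) simp del: sum.lessThan_Suc)
    also have "\<dots> = 0" using p(2) by simp
    finally show "w \<bullet>c (N *\<^sub>v a) = 0" .
  qed
qed

text \<open>Induction by deflation: one normalized eigenvector \<open>x\<close> is split off and
  both matrices are compressed to the hyperplane orthogonal to \<open>B *\<^sub>v x\<close>. Since
  \<open>A *\<^sub>v x\<close> is a multiple of \<open>B *\<^sub>v x\<close>, the mixed entries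
  vanish for both forms.\<close>

lemma pencil_diagonalization:
  "hermitian_mat n A \<Longrightarrow> pos_def_mat n B \<Longrightarrow>
    \<exists>X e. X \<in> carrier_mat n n \<and> compress B X = 1\<^sub>m n \<and>
      compress A X = mat_diag n (\<lambda>r. complex_of_real (e r))"
proof (induction n arbitrary: A B)
  case 0
  then show ?case
    by (intro exI[of _ "1\<^sub>m 0"] exI[of _ "\<lambda>_. 0"])
      (auto simp: hermitian_mat_def pos_def_mat_def compress_def mat_diag_def intro!: eq_matI)
next
  case (Suc m)
  note A = \<open>hermitian_mat (Suc m) A\<close> and B = \<open>pos_def_mat (Suc m) B\<close>
  have A': "A \<in> carrier_mat (Suc m) (Suc m)" using A by (auto simp: hermitian_mat_def)
  have BH: "hermitian_mat (Suc m) B" using B by (auto simp: pos_def_mat_def)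
  then have B': "B \<in> carrier_mat (Suc m) (Suc m)" by (auto simp: hermitian_mat_def)
  obtain x e0 where x: "x \<in> carrier_vec (Suc m)" "(B *\<^sub>v x) \<bullet>c x = 1"
    "A *\<^sub>v x = complex_of_real e0 \<cdot>\<^sub>v (B *\<^sub>v x)"
    using pencil_eigenvector_exists[OF A B] by auto
  have Bx: "B *\<^sub>v x \<in> carrier_vec (Suc m)" using B' x by auto
  have "B *\<^sub>v x \<noteq> 0\<^sub>v (Suc m)" using x by auto
  from orthogonal_complement_matrix[OF Bx this]
  obtain N where N: "N \<in> carrier_mat (Suc m) m"
    and Ninj: "\<And>a. a \<in> carrier_vec m \<Longrightarrow> N *\<^sub>v a = 0\<^sub>v (Suc m) \<Longrightarrow> a = 0\<^sub>v m"
    and Northo: "\<And>a. a \<in> carrier_vec m \<Longrightarrow> (B *\<^sub>v x) \<bullet>c (N *\<^sub>v a) = 0"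
    by metis
  obtain Y e1 where Y: "Y \<in> carrier_mat m m" and YB: "compress (compress B N) Y = 1\<^sub>m m"
    and YA: "compress (compress A N) Y = mat_diag m (\<lambda>r. complex_of_real (e1 r))"
    using Suc.IH[OF hermitian_compress[OF A N] pos_def_compress[OF B N Ninj]] by blast
  define X where "X = mat_of_cols (Suc m) (x # map (\<lambda>l. N *\<^sub>v col Y l) [0..<m])"
  have X: "X \<in> carrier_mat (Suc m) (Suc m)" by (rule carrier_matI) (simp_all add: X_def)
  have c0: "col X 0 = x" using x by (simp add: X_def)
  have cS: "col X (Suc l) = N *\<^sub>v col Y l" if "l < m" for l
    unfolding X_def by (subst col_mat_of_cols) (use that Y N in auto)
  have colY: "col Y l \<in> carrier_vec m" for l using Y by auto
  have NY: "N *\<^sub>v col Y l \<in> carrier_vec (Suc m)" for l using N Y by auto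
  have sub: "(M *\<^sub>v (N *\<^sub>v col Y s)) \<bullet>c (N *\<^sub>v col Y r) = compress (compress M N) Y $$ (r, s)"
    if "M \<in> carrier_mat (Suc m) (Suc m)" "r < m" "s < m" for M r s
    using compress_index[OF _ Y, of "compress M N" r s] cprod_compress[OF that(1) N colY colY] that N
    by auto
  have A0: "(A *\<^sub>v x) \<bullet>c (N *\<^sub>v col Y l) = 0" for l
    using Northo[OF colY] cprod_smult_left[OF Bx NY] x(3) by simp
  have A00: "(A *\<^sub>v x) \<bullet>c x = of_real e0"
    using cprod_smult_left[OF Bx x(1)] x by simp
  have "compress B X $$ (r, s) = 1\<^sub>m (Suc m) $$ (r, s)" if rs: "r < Suc m" "s < Suc m" for r s
    unfolding compress_index[OF B' X rs]
    by (cases r; cases s) (use rs in \<open>auto simp: c0 cS x sub[OF B'] YB Northo colY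
        hermitian_cprod[OF BH NY x(1)]\<close>)
  moreover have "compress A X $$ (r, s) = mat_diag (Suc m) (\<lambda>r. complex_of_real (case r of 0 \<Rightarrow> e0 | Suc r \<Rightarrow> e1 r)) $$ (r, s)"
    if rs: "r < Suc m" "s < Suc m" for r s
    unfolding compress_index[OF A' X rs]
    by (cases r; cases s) (use rs in \<open>auto simp: c0 cS A00 sub[OF A'] YA A0 colY mat_diag_def
        hermitian_cprod[OF A NY x(1)]\<close>)
  ultimately have "compress B X = 1\<^sub>m (Suc m)"
    "compress A X = mat_diag (Suc m) (\<lambda>r. complex_of_real (case r of 0 \<Rightarrow> e0 | Suc r \<Rightarrow> e1 r))"
    using A' B' X by (auto intro!: eq_matI simp: mat_diag_def compress_def)
  with X show ?case by blast
qed

text \<open>Congruence by \<open>X\<close> multiplies the characteristic polynomial by the constant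
  \<open>c\<close>, which is non-zero because the resulting product of linear factors is. Hence the
  roots agree with multiplicity, and any diagonalization determines the eigenvalue list; Ritz values
  are computed in this way below.\<close>

lemma pair_eigenvalues_diagonalized:
  assumes A: "A \<in> carrier_mat n n" and B: "B \<in> carrier_mat n n" and X: "X \<in> carrier_mat n n"
    and XB: "compress B X = 1\<^sub>m n"
    and XA: "compress A X = mat_diag n (\<lambda>r. complex_of_real (e r))"
  shows "pair_eigenvalues A B = sort (map e [0..<n])"
proof -
  define c where "c = Determinant.det (mat_adjoint X) * Determinant.det X"
  define P where "P = (\<Prod>r<n. [:- complex_of_real (e r), 1:])"
  have aX: "mat_adjoint X \<in> carrier_mat n n" using X by auto
  have ev: "poly (pair_char_poly A B) x = Determinant.det (x \<cdot>\<^sub>m B - A)" for x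
  proof -
    have hom: "comm_ring_hom (\<lambda>p :: complex poly. poly p x)"
      by unfold_locales auto
    have "map_mat (\<lambda>p. poly p x) ([:0, 1:] \<cdot>\<^sub>m map_mat (\<lambda>b. [:b:]) B - map_mat (\<lambda>a. [:a:]) A) = x \<cdot>\<^sub>m B - A"
      using A B by (intro eq_matI) auto
    then show ?thesis
      using comm_ring_hom.hom_det[OF hom] unfolding pair_char_poly_def by metis
  qed
  have cdet: "c * Determinant.det (x \<cdot>\<^sub>m B - A) = (\<Prod>r<n. x - of_real (e r))" for x
  proof -
    have M: "x \<cdot>\<^sub>m B - A \<in> carrier_mat n n" using A B by auto
    have "mat_adjoint X * (x \<cdot>\<^sub>m B - A) = x \<cdot>\<^sub>m (mat_adjoint X * B) - mat_adjoint X * A"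
      using aX A B by (subst mult_minus_distrib_mat[of _ n n _ n]) (auto simp: mult_smult_distrib[of _ n n _ n])
    then have "compress (x \<cdot>\<^sub>m B - A) X = (x \<cdot>\<^sub>m (mat_adjoint X * B) - mat_adjoint X * A) * X"
      by (simp add: compress_def)
    also have "\<dots> = (x \<cdot>\<^sub>m (mat_adjoint X * B)) * X - (mat_adjoint X * A) * X"
      using aX A B X by (intro minus_mult_distrib_mat[of _ n n _ _ n]) auto
    also have "(x \<cdot>\<^sub>m (mat_adjoint X * B)) * X = x \<cdot>\<^sub>m (mat_adjoint X * B * X)"
      using aX A B X by (intro mult_smult_assoc_mat[of _ n n _ n]) auto
    also have "x \<cdot>\<^sub>m (mat_adjoint X * B * X) - mat_adjoint X * A * X = x \<cdot>\<^sub>m compress B X - compress A X"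
      by (simp add: compress_def)
    also have "\<dots> = Matrix.mat n n (\<lambda>(r, s). if r = s then x - of_real (e r) else 0)"
      unfolding XA XB by (intro eq_matI) (auto simp: mat_diag_def)
    also have "Determinant.det \<dots> = (\<Prod>r<n. x - of_real (e r))"
      by (subst det_upper_triangular[of _ n]) (auto simp: diag_mat_def prod.list_conv_set_nth lessThan_atLeast0)
    finally have "(\<Prod>r<n. x - of_real (e r)) = Determinant.det (compress (x \<cdot>\<^sub>m B - A) X)" by simp
    also have "\<dots> = c * Determinant.det (x \<cdot>\<^sub>m B - A)"
      unfolding compress_def c_def using M X aX
      by (simp add: det_mult[of _ n] mult_carrier_mat[of _ n n _ n])
    finally show ?thesis by simp
  qed
  have P: "Polynomial.smult c (pair_char_poly A B) = P"
    by (subst poly_eq_poly_eq_iff[symmetric], rule ext) (simp add: ev cdet P_def poly_prod)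
  have "P \<noteq> 0" by (simp add: P_def)
  then have "c \<noteq> 0" using P by auto
  then have "proots (pair_char_poly A B) = proots P" by (simp flip: P)
  also have "\<dots> = (\<Sum>r<n. proots [:- complex_of_real (e r), 1:])"
    unfolding P_def by (rule proots_prod) auto
  also have "\<dots> = mset (map (\<lambda>r. complex_of_real (e r)) [0..<n])"
    by (simp add: lessThan_atLeast0 sum_unfold_sum_mset multiset.map_comp)
  finally have "image_mset Re (proots (pair_char_poly A B)) = mset (map e [0..<n])"
    by (simp add: multiset.map_comp comp_def)
  then show ?thesis unfolding pair_eigenvalues_def by (simp only: sorted_list_of_multiset_mset)
qed

text \<open>The columns of a diagonalizing matrix may be permuted. In sorted order, column
  \<open>r\<close> (counted from 0) belongs to eigenvalue number \<open>Suc r\<close> (counted from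
  1).\<close>

lemma pencil_diagonalization_sorted:
  assumes A: "hermitian_mat n A" and B: "pos_def_mat n B"
  obtains X where "X \<in> carrier_mat n n" "compress B X = 1\<^sub>m n"
    "compress A X = mat_diag n (\<lambda>r. complex_of_real (pair_eig A B (Suc r)))"
    "sorted (pair_eigenvalues A B)" "length (pair_eigenvalues A B) = n"
proof -
  have A': "A \<in> carrier_mat n n" "B \<in> carrier_mat n n"
    using A B by (auto simp: hermitian_mat_def pos_def_mat_def)
  obtain X e where X: "X \<in> carrier_mat n n" "compress B X = 1\<^sub>m n"
      "compress A X = mat_diag n (\<lambda>r. complex_of_real (e r))"
    using pencil_diagonalization[OF A B] by auto
  have pe: "pair_eigenvalues A B = sort (map e [0..<n])"
    by (rule pair_eigenvalues_diagonalized[OF A' X])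
  define p where "p = sort_key e [0..<n]"
  have p: "length p = n" "distinct p" "set p = {0..<n}" by (auto simp: p_def)
  have mp: "map e p = pair_eigenvalues A B"
    unfolding pe by (rule properties_for_sort[symmetric]) (auto simp: p_def)
  have pn: "p ! r < n" if "r < n" for r using p that nth_mem[of r p] by auto
  define Y where "Y = mat_of_cols n (map (\<lambda>r. col X (p ! r)) [0..<n])"
  have Y: "Y \<in> carrier_mat n n" by (rule carrier_matI) (simp_all add: Y_def)
  have cY: "col Y r = col X (p ! r)" if "r < n" for r
    unfolding Y_def by (subst col_mat_of_cols) (use that X in auto)
  have YX: "compress M Y $$ (r, s) = compress M X $$ (p ! r, p ! s)"
    if "M \<in> carrier_mat n n" "r < n" "s < n" for M r s
    using that X Y by (simp add: compress_index[of _ n _ n] cY pn)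
  have pi: "p ! r = p ! s \<longleftrightarrow> r = s" if "r < n" "s < n" for r s
    using p that nth_eq_iff_index_eq by metis
  have ep: "pair_eig A B (Suc r) = e (p ! r)" if "r < n" for r
    unfolding pair_eig_def mp[symmetric] using that p by simp
  show ?thesis
  proof
    show "compress B Y = 1\<^sub>m n"
    proof (rule eq_matI)
      fix r s assume "r < dim_row (1\<^sub>m n :: complex mat)" "s < dim_col (1\<^sub>m n :: complex mat)"
      then show "compress B Y $$ (r, s) = 1\<^sub>m n $$ (r, s)" using A' X pn pi by (simp add: YX)
    qed (use A' Y in \<open>auto simp: compress_def\<close>)
    show "compress A Y = mat_diag n (\<lambda>r. complex_of_real (pair_eig A B (Suc r)))"
    proof (rule eq_matI)
      fix r s assume "r < dim_row (mat_diag n (\<lambda>r. complex_of_real (pair_eig A B (Suc r))))"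
        "s < dim_col (mat_diag n (\<lambda>r. complex_of_real (pair_eig A B (Suc r))))"
      then show "compress A Y $$ (r, s) = mat_diag n (\<lambda>r. complex_of_real (pair_eig A B (Suc r))) $$ (r, s)"
        using A' X pn pi ep by (simp add: YX mat_diag_def)
    qed (use A' Y in \<open>auto simp: compress_def mat_diag_def\<close>)
  qed (use Y pe in auto)
qed

section \<open>One half of the min-max principle\<close>

lemma wide_matrix_kernel:
  fixes M :: "complex mat"
  assumes M: "M \<in> carrier_mat k p" and "k < p"
  obtains c where "c \<in> carrier_vec p" "c \<noteq> 0\<^sub>v p" "M *\<^sub>v c = 0\<^sub>v k"
proof -
  \<comment> \<open>Padding with zero rows makes the matrix square. Its row \<open>k\<close>
    vanishes, so the transpose annihilates \<open>unit_vec p k\<close> and the determinant is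
    0.\<close>
  define M' where "M' = Matrix.mat p p (\<lambda>(r, s). if r < k then M $$ (r, s) else 0)"
  have M': "M' \<in> carrier_mat p p" by (simp add: M'_def)
  have "Determinant.det (transpose_mat M') = 0"
  proof (subst det_0_iff_vec_prod_zero_field[of _ p], goal_cases)
    case 2
    have "transpose_mat M' *\<^sub>v unit_vec p k = 0\<^sub>v p"
    proof (rule eq_vecI)
      fix r assume r: "r < dim_vec (0\<^sub>v p :: complex vec)"
      have "(transpose_mat M' *\<^sub>v unit_vec p k) $ r = (\<Sum>s<p. transpose_mat M' $$ (r, s) * unit_vec p k $ s)"
        using r M' by (intro mult_mat_vec_index[of _ p]) auto
      also have "\<dots> = 0"
        using r by (intro sum.neutral) (auto simp: M'_def unit_vec_def)
      finally show "(transpose_mat M' *\<^sub>v unit_vec p k) $ r = 0\<^sub>v p $ r" using r by simp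
    qed (use M' in auto)
    moreover have "unit_vec p k \<noteq> (0\<^sub>v p :: complex vec)" using \<open>k < p\<close> by simp
    ultimately show ?case by (intro exI[of _ "unit_vec p k"]) auto
  qed (use M' in auto)
  then have "Determinant.det M' = 0" using det_transpose[OF M'] by simp
  then obtain c where c: "c \<in> carrier_vec p" "c \<noteq> 0\<^sub>v p" "M' *\<^sub>v c = 0\<^sub>v p"
    using det_0_iff_vec_prod_zero_field[OF M'] by auto
  have "M *\<^sub>v c = 0\<^sub>v k"
  proof (rule eq_vecI)
    fix r assume "r < dim_vec (0\<^sub>v k :: complex vec)"
    then have r: "r < k" "r < p" using \<open>k < p\<close> by auto
    have "(M *\<^sub>v c) $ r = (M' *\<^sub>v c) $ r"
      unfolding mult_mat_vec_index[OF M c(1) r(1)] mult_mat_vec_index[OF M' c(1) r(2)]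
      by (rule sum.cong) (use r in \<open>auto simp: M'_def\<close>)
    then show "(M *\<^sub>v c) $ r = 0\<^sub>v k $ r" using r c(3) by simp
  qed (use M in auto)
  with c that show ?thesis by blast
qed

text \<open>The range of \<open>C\<close> has dimension \<open>l\<close>, so it contains a non-zero
  vector whose first \<open>l - 1\<close> eigencoordinates vanish. The Rayleigh quotient of this
  vector is at least the eigenvalue number \<open>l\<close> and at most
  \<open>\<theta>\<close>.\<close>

lemma pair_eig_le:
  assumes A: "hermitian_mat n A" and B: "pos_def_mat n B" and C: "C \<in> carrier_mat n l" and l: "1 \<le> l"
    and inj: "\<And>a. a \<in> carrier_vec l \<Longrightarrow> C *\<^sub>v a = 0\<^sub>v n \<Longrightarrow> a = 0\<^sub>v l"
    and le: "\<And>a. a \<in> carrier_vec l \<Longrightarrow>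
      Re ((A *\<^sub>v (C *\<^sub>v a)) \<bullet>c (C *\<^sub>v a)) \<le> \<theta> * Re ((B *\<^sub>v (C *\<^sub>v a)) \<bullet>c (C *\<^sub>v a))"
  shows "pair_eig A B l \<le> \<theta>"
proof (rule ccontr)
  assume "\<not> pair_eig A B l \<le> \<theta>"
  have A': "A \<in> carrier_mat n n" "B \<in> carrier_mat n n"
    using A B by (auto simp: hermitian_mat_def pos_def_mat_def)
  have "l \<le> n"
    using wide_matrix_kernel[OF C] inj by (metis not_le)
  obtain X where X: "X \<in> carrier_mat n n" and XB: "compress B X = 1\<^sub>m n"
    and XA: "compress A X = mat_diag n (\<lambda>r. complex_of_real (pair_eig A B (Suc r)))"
    and so: "sorted (pair_eigenvalues A B)" "length (pair_eigenvalues A B) = n"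
    using pencil_diagonalization_sorted[OF A B] .
  \<comment> \<open>\<open>L\<close> is the inverse of \<open>X\<close>: it reads off the
    coordinates in the basis of eigenvectors.\<close>
  define L where "L = mat_adjoint X * B"
  have L: "L \<in> carrier_mat n n" using X A' by (auto simp: L_def)
  have "L * X = 1\<^sub>m n" using XB by (simp add: L_def compress_def)
  then have XL: "X * L = 1\<^sub>m n" using mat_mult_left_right_inverse[OF L X] by simp
  define M where "M = Matrix.mat (l - 1) l (\<lambda>(r, s). (L * C) $$ (r, s))"
  have M: "M \<in> carrier_mat (l - 1) l" by (simp add: M_def)
  obtain c where c: "c \<in> carrier_vec l" "c \<noteq> 0\<^sub>v l" "M *\<^sub>v c = 0\<^sub>v (l - 1)"
    using wide_matrix_kernel[OF M] l by auto
  define x where "x = C *\<^sub>v c"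
  have x: "x \<in> carrier_vec n" "x \<noteq> 0\<^sub>v n" using C c inj by (auto simp: x_def)
  define v where "v = L *\<^sub>v x"
  have v: "v \<in> carrier_vec n" using L x by (auto simp: v_def)
  have xv: "x = X *\<^sub>v v"
    using XL x L X assoc_mult_mat_vec[OF X L x(1)] by (simp add: v_def)
  have v0: "v $ r = 0" if r: "r < l - 1" for r
  proof -
    have "v = (L * C) *\<^sub>v c" using assoc_mult_mat_vec[OF L C c(1)] by (simp add: v_def x_def)
    then have "v $ r = (\<Sum>s<l. (L * C) $$ (r, s) * c $ s)"
      using r \<open>l \<le> n\<close> mult_mat_vec_index[OF mult_carrier_mat[OF L C] c(1), of r] by simp
    also have "\<dots> = (M *\<^sub>v c) $ r"
      unfolding mult_mat_vec_index[OF M c(1) r] by (rule sum.cong) (use r in \<open>auto simp: M_def\<close>)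
    finally show ?thesis using c(3) r by simp
  qed
  define e where "e r = pair_eig A B (Suc r)" for r
  have fA: "(A *\<^sub>v x) \<bullet>c x = (\<Sum>r<n. of_real (e r * (cmod (v $ r))\<^sup>2))"
  proof -
    have "(A *\<^sub>v x) \<bullet>c x = (compress A X *\<^sub>v v) \<bullet>c v"
      unfolding xv using cprod_compress[OF A'(1) X v v] by simp
    also have "\<dots> = (\<Sum>r<n. of_real (e r * (cmod (v $ r))\<^sup>2))"
      unfolding XA mat_diag_mult_vec[OF v] using v
      by (subst cprod_sum[of _ n]) (auto simp: e_def mult.assoc complex_norm_square[symmetric] intro!: sum.cong)
    finally show ?thesis .
  qed
  have fB: "(B *\<^sub>v x) \<bullet>c x = (\<Sum>r<n. of_real ((cmod (v $ r))\<^sup>2))"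
  proof -
    have "(B *\<^sub>v x) \<bullet>c x = (compress B X *\<^sub>v v) \<bullet>c v"
      unfolding xv using cprod_compress[OF A'(2) X v v] by simp
    also have "\<dots> = (\<Sum>r<n. of_real ((cmod (v $ r))\<^sup>2))"
      unfolding XB using v
      by (subst cprod_sum[of _ n]) (auto simp: complex_norm_square[symmetric] intro!: sum.cong)
    finally show ?thesis .
  qed
  have "(\<Sum>r<n. e r * (cmod (v $ r))\<^sup>2) \<le> \<theta> * (\<Sum>r<n. (cmod (v $ r))\<^sup>2)"
    using le[OF c(1)] unfolding x_def[symmetric] fA fB by simp
  then have neg: "(\<Sum>r<n. (e r - \<theta>) * (cmod (v $ r))\<^sup>2) \<le> 0"
    by (simp add: left_diff_distrib sum_subtractf sum_distrib_left)
  have e: "\<theta> < e r" if "l - 1 \<le> r" "r < n" for r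
  proof -
    have "pair_eig A B l \<le> e r"
      unfolding e_def pair_eig_def using so that by (auto intro: sorted_nth_mono)
    with \<open>\<not> pair_eig A B l \<le> \<theta>\<close> show ?thesis by simp
  qed
  have nn: "0 \<le> (e r - \<theta>) * (cmod (v $ r))\<^sup>2" if "r < n" for r
    using e[of r] v0[of r] that by (cases "r < l - 1") auto
  have "v \<noteq> 0\<^sub>v n" using x xv X by auto
  then obtain r where r: "r < n" "v $ r \<noteq> 0" using v by (metis carrier_vecD eq_vecI index_zero_vec)
  then have "l - 1 \<le> r" using v0[of r] by (meson not_le)
  then have "0 < (e r - \<theta>) * (cmod (v $ r))\<^sup>2" using e[of r] r by auto
  then have "0 < (\<Sum>r<n. (e r - \<theta>) * (cmod (v $ r))\<^sup>2)"
    using r nn by (intro sum_pos2[of _ r]) auto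
  with neg show False by simp
qed

section \<open>The scalar estimate\<close>

text \<open>The variables are reciprocals: \<open>a = 1 / \<mu>\<^sub>j\<^sub>+\<^sub>1\<close>, \<open>b = 1 / \<mu>\<^sub>n\<close>, \<open>d = 1 / \<mu>\<^sub>j\<close>, while \<open>z\<close> and \<open>us\<close>
  belong to the old Ritz value and to the bound for the new one. The choice of \<open>s\<close> makes
  \<open>e * \<bar>u - s\<bar> \<le> \<gamma> * (u - m) + e * h\<close> an equality at both ends of \<open>{b..a}\<close>.\<close>

lemma reciprocal_cubic_nonpos:
  fixes a b d z us \<gamma> \<sigma> e h m s u :: real
  assumes ab: "b \<le> a" and az: "a < z" and zus: "z \<le> us" and usd: "us \<le> d" and zd: "z < d"
    and \<gamma>: "0 \<le> \<gamma>" "\<gamma> < 1" and \<sigma>: "0 \<le> \<sigma>" "\<sigma> \<le> 1" and e: "1 \<le> e"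
    and m: "m = (a + b) / 2" and h: "h = (a - b) / 2" and s: "s = m - \<gamma> * h / e"
    and e_us: "us - a = e\<^sup>2 * (z - a)" and \<sigma>_us: "d - us = \<sigma>\<^sup>2 * e\<^sup>2 * (d - z)"
    and \<sigma>_eq: "\<sigma> * ((d - m) + \<gamma> * h) = \<gamma> * (d - m) + h"
    and u: "b \<le> u" "u \<le> a \<or> d \<le> u"
  shows "(us - u) * (u - s)\<^sup>2 \<le> (z - u) * (\<gamma> * (u - m) + e * h)\<^sup>2"
proof -
  define L where "L = \<gamma> * (u - m) + e * h"
  have h0: "0 \<le> h" and D0: "h \<le> d - m" "0 < d - m" using ab az zd m h by auto
  have es: "e * (u - s) = e * (u - m) + \<gamma> * h" using e s by (simp add: field_simps)
  have "L = (e - \<gamma>) * h + \<gamma> * (u - b)" unfolding L_def m h by (simp add: field_simps)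
  then have L0: "0 \<le> L" using e \<gamma> h0 u by simp
  consider "u \<le> a" | "d \<le> u" using u by auto
  then show ?thesis
  proof cases
    case 1
    \<comment> \<open>The two differences are affine and vanish at \<open>u = a\<close> and at
      \<open>u = b\<close> respectively, so \<open>L\<close> dominates e |u - s| in between. The
      remaining factor satisfies \<open>us - u \<le> e\<^sup>2 * (z - u)\<close>, with equality at
      \<open>u = a\<close>.\<close>
    have "L - (e * (u - m) + \<gamma> * h) = (e - \<gamma>) * (a - u)"
      unfolding L_def m h by (simp add: field_simps)
    then have le1: "e * (u - s) \<le> L" using es e \<gamma> 1 by (smt (verit) mult_nonneg_nonneg)
    have "L + (e * (u - m) + \<gamma> * h) = (e + \<gamma>) * (u - b)"
      unfolding L_def m h by (simp add: field_simps)
    then have le2: "- (e * (u - s)) \<le> L" using es e \<gamma> u by (smt (verit) mult_nonneg_nonneg)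
    have "(e * (u - s))\<^sup>2 \<le> L\<^sup>2" using le1 le2 by (intro power2_le_iff_abs_le[THEN iffD2]) auto
    then have le3: "e\<^sup>2 * (u - s)\<^sup>2 \<le> L\<^sup>2" by (simp add: power_mult_distrib)
    have "1 * (a - u) \<le> e\<^sup>2 * (a - u)" using e 1 by (intro mult_right_mono) auto
    then have "us - u \<le> e\<^sup>2 * (z - u)" using e_us by (simp add: algebra_simps)
    then have "(us - u) * (u - s)\<^sup>2 \<le> e\<^sup>2 * (z - u) * (u - s)\<^sup>2" by (intro mult_right_mono) auto
    also have "\<dots> = (z - u) * (e\<^sup>2 * (u - s)\<^sup>2)" by (simp add: mult_ac)
    also have "\<dots> \<le> (z - u) * L\<^sup>2" using le3 az 1 by (intro mult_left_mono) auto
    finally show ?thesis by (simp add: L_def)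
  next
    case 2
    have "(\<sigma> - \<gamma>) * (d - m) = h * (1 - \<sigma> * \<gamma>)" using \<sigma>_eq by (simp add: algebra_simps)
    moreover have "\<sigma> * \<gamma> \<le> 1" using \<sigma> \<gamma> mult_le_one[of \<sigma> \<gamma>] by auto
    ultimately have "0 \<le> (\<sigma> - \<gamma>) * (d - m)" using h0 by simp
    then have "\<gamma> \<le> \<sigma>" using D0 by (simp add: zero_le_mult_iff)
    then have "\<gamma> \<le> \<sigma> * e" using \<sigma> e by (metis mult.right_neutral mult_left_mono order_trans)
    have "\<sigma> * h \<le> d - m" using \<sigma> h0 D0 mult_right_mono[of \<sigma> 1 h] by simp
    then have "0 \<le> (e - 1) * \<gamma> * (d - m - \<sigma> * h)" using e \<gamma> by simp
    moreover have "0 \<le> (\<sigma> * e - \<gamma>) * (u - d)" using \<open>\<gamma> \<le> \<sigma> * e\<close> 2 by simp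
    \<comment> \<open>Beyond \<open>d\<close> the comparison goes the other way. The surplus splits
      into growth from \<open>d\<close> to \<open>u\<close>, a gain from \<open>e \<ge> 1\<close>,
      and a multiple of the equation \<open>\<sigma>_eq\<close>, which is zero.\<close>
    moreover have "\<sigma> * (e * (u - m) + \<gamma> * h) - L
        = (\<sigma> * e - \<gamma>) * (u - d) + (e - 1) * \<gamma> * (d - m - \<sigma> * h)
          + e * (\<sigma> * ((d - m) + \<gamma> * h) - (\<gamma> * (d - m) + h))"
      by (simp add: L_def algebra_simps)
    ultimately have "L \<le> \<sigma> * (e * (u - s))" using \<sigma>_eq es by simp
    then have "L\<^sup>2 \<le> (\<sigma> * (e * (u - s)))\<^sup>2" using L0 by (intro power_mono)
    then have le: "L\<^sup>2 \<le> \<sigma>\<^sup>2 * e\<^sup>2 * (u - s)\<^sup>2" by (simp add: power_mult_distrib mult_ac)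
    \<comment> \<open>\<open>z \<le> us\<close> yields
      \<open>\<sigma>\<^sup>2 * e\<^sup>2 \<le> 1\<close>. The bound for \<open>u - us\<close> is an
      equality at \<open>u = d\<close>, and a slope of at most 1 preserves it for larger
      \<open>u\<close>.\<close>
    have "\<sigma>\<^sup>2 * e\<^sup>2 * (d - z) \<le> 1 * (d - z)" using \<sigma>_us zus by simp
    then have "\<sigma>\<^sup>2 * e\<^sup>2 \<le> 1" using zd by (simp only: mult_le_cancel_right_pos diff_gt_0_iff_gt)
    then have "\<sigma>\<^sup>2 * e\<^sup>2 * (u - d) \<le> 1 * (u - d)" using 2 by (intro mult_right_mono) auto
    then have "(u - z) * (\<sigma>\<^sup>2 * e\<^sup>2) \<le> u - us" using \<sigma>_us by (simp add: algebra_simps)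
    have "(u - z) * L\<^sup>2 \<le> (u - z) * (\<sigma>\<^sup>2 * e\<^sup>2 * (u - s)\<^sup>2)"
      using le 2 zd by (intro mult_left_mono) auto
    also have "\<dots> = (u - z) * (\<sigma>\<^sup>2 * e\<^sup>2) * (u - s)\<^sup>2" by simp
    also have "\<dots> \<le> (u - us) * (u - s)\<^sup>2" by (intro mult_right_mono) (fact, simp)
    finally show ?thesis by (simp add: L_def algebra_simps)
  qed
qed

text \<open>Completing the square: \<open>Lu\<close> times the difference of the two sides equals
  \<open>Lus\<close> times the slack of \<open>G\<close> (multiplied by |f|^2) plus
  \<open>\<gamma>\<close> times |(us - u) v - Lu d|^2. The coefficients fit because
  \<open>Lus - Lu = \<gamma> * (us - u)\<close>.\<close>

lemma coordinate_estimate: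
  fixes us u s z \<gamma> Lu Lus :: real and f d v :: complex
  assumes G: "(us - u) * (u - s)\<^sup>2 \<le> (z - u) * Lu\<^sup>2" and "0 \<le> Lu" "0 \<le> Lus" "0 \<le> \<gamma>"
    and L: "Lus - Lu = \<gamma> * (us - u)" and v: "v = of_real (u - s) * f"
  shows "(us - u) * (cmod (v + of_real \<gamma> * d))\<^sup>2
      \<le> \<gamma> * Lus * (cmod d)\<^sup>2 + Lus * (z - u) * Lu * (cmod f)\<^sup>2"
proof -
  have vf: "(cmod v)\<^sup>2 = (u - s)\<^sup>2 * (cmod f)\<^sup>2"
    by (simp add: v norm_mult power_mult_distrib del: of_real_diff)
  have Gf: "(us - u) * (cmod v)\<^sup>2 \<le> (z - u) * Lu\<^sup>2 * (cmod f)\<^sup>2"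
    using mult_right_mono[OF G, of "(cmod f)\<^sup>2"] by (simp add: vf mult_ac)
  show ?thesis
  \<comment> \<open>The identity carries a factor \<open>Lu\<close>, so \<open>Lu = 0\<close> is
    separate: there \<open>G\<close> forces \<open>v = 0\<close> if \<open>u < us\<close>, and the
    sign of \<open>Lus\<close> forces \<open>\<gamma> = 0\<close> if \<open>us < u\<close>.\<close>
  proof (cases "Lu = 0")
    case True
    consider "us = u" | "u < us" | "us < u" by linarith
    then show ?thesis
    proof cases
      case 1
      then show ?thesis using True assms by simp
    next
      case 2
      then have "(cmod v)\<^sup>2 \<le> 0" using Gf True by (simp add: mult_le_0_iff)
      then have "v = 0" by simp
      have "Lus = \<gamma> * (us - u)" using L True by simp
      then show ?thesis using True \<open>v = 0\<close> \<open>0 \<le> \<gamma>\<close>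
        by (simp add: norm_mult power_mult_distrib power2_eq_square mult_ac)
    next
      case 3
      have "Lus = \<gamma> * (us - u)" using L True by simp
      then have "\<gamma> * (us - u) = 0" using 3 assms by (smt (verit) mult_nonneg_nonpos)
      then have "\<gamma> = 0" using 3 by simp
      then show ?thesis using True Gf by simp
    qed
  next
    case False
    then have Lu: "0 < Lu" using assms by simp
    have sq: "(cmod (p + of_real c * q))\<^sup>2 = (cmod p)\<^sup>2 + 2 * c * Re (p * cnj q) + c\<^sup>2 * (cmod q)\<^sup>2"
      for p q :: complex and c :: real
      unfolding cmod_power2 by (simp add: power2_eq_square algebra_simps)
    have "\<gamma> * (Lus * Lu * (cmod d)\<^sup>2) + Lus * (us - u) * (cmod v)\<^sup>2
        - Lu * ((us - u) * (cmod (v + of_real \<gamma> * d))\<^sup>2)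
      = (Lus - Lu - \<gamma> * (us - u)) * (\<gamma> * Lu * (cmod d)\<^sup>2 + (us - u) * (cmod v)\<^sup>2)
        + \<gamma> * ((us - u)\<^sup>2 * (cmod v)\<^sup>2 - 2 * (us - u) * Lu * Re (v * cnj d) + Lu\<^sup>2 * (cmod d)\<^sup>2)"
      unfolding sq by (simp add: power2_eq_square algebra_simps)
    also have "(us - u)\<^sup>2 * (cmod v)\<^sup>2 - 2 * (us - u) * Lu * Re (v * cnj d) + Lu\<^sup>2 * (cmod d)\<^sup>2
      = (cmod (of_real (us - u) * v + of_real (- Lu) * d))\<^sup>2"
      unfolding sq by (simp add: norm_mult power_mult_distrib del: of_real_diff) (simp add: algebra_simps)
    finally have "\<gamma> * (Lus * Lu * (cmod d)\<^sup>2) + Lus * (us - u) * (cmod v)\<^sup>2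
        - Lu * ((us - u) * (cmod (v + of_real \<gamma> * d))\<^sup>2)
        = \<gamma> * (cmod (of_real (us - u) * v + of_real (- Lu) * d))\<^sup>2"
      unfolding L by simp
    moreover have "0 \<le> \<gamma> * (cmod (of_real (us - u) * v + of_real (- Lu) * d))\<^sup>2"
      by (intro mult_nonneg_nonneg) (use \<open>0 \<le> \<gamma>\<close> in auto)
    ultimately have "Lu * ((us - u) * (cmod (v + of_real \<gamma> * d))\<^sup>2)
        \<le> \<gamma> * (Lus * Lu * (cmod d)\<^sup>2) + Lus * (us - u) * (cmod v)\<^sup>2"
      by linarith
    also have "Lus * (us - u) * (cmod v)\<^sup>2 \<le> Lus * ((z - u) * Lu\<^sup>2 * (cmod f)\<^sup>2)"
      using mult_left_mono[OF Gf \<open>0 \<le> Lus\<close>] by (simp add: mult_ac)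
    finally have "Lu * ((us - u) * (cmod (v + of_real \<gamma> * d))\<^sup>2)
        \<le> Lu * (\<gamma> * Lus * (cmod d)\<^sup>2 + Lus * (z - u) * Lu * (cmod f)\<^sup>2)"
      by (simp add: algebra_simps power2_eq_square)
    then show ?thesis using Lu by (simp only: mult_le_cancel_left_pos)
  qed
qed

text \<open>Translates the factor into reciprocals. With \<open>D = 1 / p - 1 / w\<close> one has
  \<open>h = \<kappa> * D / 2\<close> and \<open>1 / p - m = (2 - \<kappa>) * D / 2\<close>, so
  numerator and denominator of \<open>\<sigma>\<close> are, up to the factor \<open>D / 2\<close>,
  the two sides of the last equation.\<close>

lemma convergence_factor_reciprocal:
  fixes p q w \<gamma> :: real
  assumes pq: "0 < p" "p < q" "q \<le> w" and \<gamma>: "0 \<le> \<gamma>" "\<gamma> < 1"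
    and \<kappa>: "\<kappa> = (p / q) * ((w - q) / (w - p))"
    and \<sigma>: "\<sigma> = (\<kappa> + \<gamma> * (2 - \<kappa>)) / ((2 - \<kappa>) + \<gamma> * \<kappa>)"
    and m: "m = (1 / q + 1 / w) / 2" and h: "h = (1 / q - 1 / w) / 2"
  shows "0 \<le> \<kappa>" "\<kappa> < 1" "0 \<le> \<sigma>" "\<sigma> < 1" "\<sigma> * ((1 / p - m) + \<gamma> * h) = \<gamma> * (1 / p - m) + h"
proof -
  show \<kappa>0: "0 \<le> \<kappa>" using pq by (simp add: \<kappa>)
  have "p * (w - q) < q * (w - p)" using pq by (simp add: algebra_simps)
  then show \<kappa>1: "\<kappa> < 1" using pq by (simp add: \<kappa> field_simps)
  have den: "0 < (2 - \<kappa>) + \<gamma> * \<kappa>" using \<kappa>0 \<kappa>1 \<gamma> by (intro add_pos_nonneg) auto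
  show "0 \<le> \<sigma>" using den \<kappa>0 \<kappa>1 \<gamma> by (simp add: \<sigma>)
  have "(2 - \<kappa> + \<gamma> * \<kappa>) - (\<kappa> + \<gamma> * (2 - \<kappa>)) = 2 * (1 - \<kappa>) * (1 - \<gamma>)" by (simp add: algebra_simps)
  moreover have "0 < 2 * (1 - \<kappa>) * (1 - \<gamma>)" using \<kappa>1 \<gamma> by simp
  ultimately show "\<sigma> < 1" using den by (simp add: \<sigma>)
  define D where "D = 1 / p - 1 / w"
  have D: "0 < D" using pq by (simp add: D_def frac_less2)
  have hD: "h = \<kappa> * D / 2" using pq by (simp add: h \<kappa> D_def field_simps)
  have mD: "1 / p - m = (2 - \<kappa>) * D / 2"
  proof -
    have "1 / p - m = D - h" by (simp add: m h D_def field_simps)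
    then show ?thesis by (simp add: hD algebra_simps)
  qed
  have "\<sigma> * ((2 - \<kappa>) + \<gamma> * \<kappa>) = \<kappa> + \<gamma> * (2 - \<kappa>)" using den by (simp add: \<sigma>)
  then have "\<sigma> * ((2 - \<kappa>) + \<gamma> * \<kappa>) * (D / 2) = (\<kappa> + \<gamma> * (2 - \<kappa>)) * (D / 2)" by simp
  then show "\<sigma> * ((1 / p - m) + \<gamma> * h) = \<gamma> * (1 / p - m) + h"
    unfolding hD mD by (simp add: field_simps)
qed

text \<open>Weighted sum of the coordinate estimates. \<open>s\<close> and \<open>\<theta>s\<close>
  are obtained before \<open>f\<close>, \<open>y\<close> and \<open>d\<close>, because the same pair
  has to work on a whole subspace; \<open>p\<close> and \<open>q\<close> are the ends of the
  spectral gap that contains the old Ritz value.\<close>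

lemma ritz_step_estimate:
  fixes \<mu> :: "'a \<Rightarrow> real" and p q w \<theta> \<gamma> \<kappa> \<sigma> :: real
  assumes I: "finite I" and \<mu>: "\<And>l. l \<in> I \<Longrightarrow> 0 < \<mu> l \<and> (\<mu> l \<le> p \<or> q \<le> \<mu> l) \<and> \<mu> l \<le> w"
    and p: "0 < p" and \<theta>: "p < \<theta>" "\<theta> < q" and qw: "q \<le> w" and \<gamma>: "0 \<le> \<gamma>" "\<gamma> < 1"
    and \<kappa>: "\<kappa> = (p / q) * ((w - q) / (w - p))"
    and \<sigma>: "\<sigma> = (\<kappa> + \<gamma> * (2 - \<kappa>)) / ((2 - \<kappa>) + \<gamma> * \<kappa>)"
  obtains s \<theta>s where "0 < s" "s \<le> 1 / q" "p \<le> \<theta>s" "\<theta>s < q" "(\<theta>s - p) / (q - \<theta>s) = \<sigma>\<^sup>2 * ((\<theta> - p) / (q - \<theta>))"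
    "\<And>f y d :: 'a \<Rightarrow> complex.
       (\<Sum>l\<in>I. \<mu> l * (cmod (d l))\<^sup>2) \<le> \<gamma>\<^sup>2 * (\<Sum>l\<in>I. \<mu> l * (cmod (y l - f l / of_real (\<mu> l)))\<^sup>2) \<Longrightarrow>
       (\<Sum>l\<in>I. \<mu> l * (cmod (y l - f l / of_real (\<mu> l)))\<^sup>2)
         \<le> (\<Sum>l\<in>I. \<mu> l * (cmod (f l / of_real \<theta> - f l / of_real (\<mu> l)))\<^sup>2) \<Longrightarrow>
       (\<Sum>l\<in>I. (\<mu> l - \<theta>) * (cmod (f l))\<^sup>2) \<le> 0 \<Longrightarrow>
       (\<Sum>l\<in>I. (\<mu> l - \<theta>s) * (cmod (f l / of_real (\<mu> l) - of_real s * f l + d l))\<^sup>2) \<le> 0"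
proof -
  have pq: "p < q" using \<theta> by simp
  define a where "a = 1 / q"
  define b where "b = 1 / w"
  define dd where "dd = 1 / p"
  define z where "z = 1 / \<theta>"
  define m where "m = (a + b) / 2"
  define h where "h = (a - b) / 2"
  note fac = convergence_factor_reciprocal[OF p pq qw \<gamma> \<kappa> \<sigma> m_def[unfolded a_def b_def] h_def[unfolded a_def b_def]]
  define c where "c = \<sigma>\<^sup>2 * ((\<theta> - p) / (q - \<theta>))"
  have c: "0 \<le> c" using \<theta> by (simp add: c_def)
  \<comment> \<open>The solution of (x - p) / (q - x) = c: the number that the new Ritz value must
    not exceed.\<close>
  define \<theta>s where "\<theta>s = (p + c * q) / (1 + c)"
  have \<theta>s_p: "\<theta>s - p = c * (q - p) / (1 + c)" and \<theta>s_q: "q - \<theta>s = (q - p) / (1 + c)"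
    using c by (simp_all add: \<theta>s_def field_simps)
  have \<theta>s: "p \<le> \<theta>s" "\<theta>s < q"
  proof -
    have "0 \<le> \<theta>s - p" unfolding \<theta>s_p using c pq by simp
    then show "p \<le> \<theta>s" by simp
    have "0 < q - \<theta>s" unfolding \<theta>s_q using c pq by simp
    then show "\<theta>s < q" by simp
  qed
  have \<theta>s_ratio: "(\<theta>s - p) / (q - \<theta>s) = c" unfolding \<theta>s_p \<theta>s_q using c pq by simp
  have \<sigma>2: "\<sigma>\<^sup>2 \<le> 1" using fac by (simp add: power_le_one)
  have "\<theta>s \<le> \<theta>"
  proof -
    have "(\<theta>s - p) * (q - \<theta>) = c * (q - \<theta>s) * (q - \<theta>)"
      unfolding \<theta>s_p \<theta>s_q by simp
    also have "\<dots> = \<sigma>\<^sup>2 * ((\<theta> - p) * (q - \<theta>s))" using \<theta> by (simp add: c_def field_simps)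
    also have "\<dots> \<le> 1 * ((\<theta> - p) * (q - \<theta>s))" using \<sigma>2 \<theta> \<theta>s by (intro mult_right_mono) auto
    finally have "0 \<le> (\<theta> - \<theta>s) * (q - p)" by (simp add: algebra_simps)
    then show ?thesis using pq by (simp add: zero_le_mult_iff)
  qed
  define us where "us = 1 / \<theta>s"
  have ord: "0 < b" "b \<le> a" "a < z" "z \<le> us" "us \<le> dd" "z < dd"
    using p pq qw \<theta> \<theta>s \<open>\<theta>s \<le> \<theta>\<close> by (auto simp: a_def b_def z_def us_def dd_def field_simps)
  \<comment> \<open>\<open>e\<^sup>2\<close> is the stretching of the distance to \<open>a\<close>
    when \<open>z\<close> moves to \<open>us\<close>. Passing to reciprocals multiplies every gap
    ratio by \<open>q / p\<close>, so the ratio of old and new keeps the factor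
    \<open>\<sigma>\<^sup>2\<close>; this is \<open>\<sigma>_us\<close>.\<close>
  define e where "e = sqrt ((us - a) / (z - a))"
  have e: "1 \<le> e" using ord by (simp add: e_def)
  have e2: "e\<^sup>2 = (us - a) / (z - a)" using ord by (simp add: e_def)
  then have e_us: "us - a = e\<^sup>2 * (z - a)" using ord by simp
  have \<sigma>_us: "dd - us = \<sigma>\<^sup>2 * e\<^sup>2 * (dd - z)"
  proof -
    have x: "(dd - 1 / x) / (1 / x - a) = (x - p) / (q - x) * (q / p)" if "0 < x" "x < q" for x
      using that p pq by (simp add: dd_def a_def field_simps)
    have "(dd - us) / (us - a) = c * (q / p)"
      using x[of \<theta>s] \<theta>s p \<theta>s_ratio by (simp add: us_def)
    also have "\<dots> = \<sigma>\<^sup>2 * ((dd - z) / (z - a))"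
      using x[of \<theta>] \<theta> p by (simp add: z_def c_def)
    finally have "dd - us = \<sigma>\<^sup>2 * ((dd - z) / (z - a)) * (us - a)" using ord by (simp add: field_simps)
    then show ?thesis using ord unfolding e2 by (simp add: mult_ac)
  qed
  define s where "s = m - \<gamma> * h / e"
  define L where "L u = \<gamma> * (u - m) + e * h" for u
  have h0: "0 \<le> h" using ord by (simp add: h_def)
  have "0 \<le> \<gamma> * h / e" "m \<le> a" using \<gamma> h0 e ord by (auto simp: m_def)
  then have s_a: "s \<le> a" by (simp add: s_def)
  have "0 < s"
  proof -
    have "\<gamma> * h / e \<le> 1 * h / 1" using \<gamma> h0 e by (intro frac_le mult_right_mono) auto
    then have "m - h \<le> s" by (simp add: s_def)
    then show ?thesis using ord by (simp add: m_def h_def field_simps)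
  qed
  have L0: "0 \<le> L u" if "b \<le> u" for u
  proof -
    have "L u = (e - \<gamma>) * h + \<gamma> * (u - b)" by (simp add: L_def m_def h_def field_simps)
    then show ?thesis using e \<gamma> h0 that by simp
  qed
  show ?thesis
  proof (rule that[of s \<theta>s])
    show "0 < s" by fact
    show "s \<le> 1 / q" using s_a by (simp add: a_def)
    show "p \<le> \<theta>s" "\<theta>s < q" by fact+
    show "(\<theta>s - p) / (q - \<theta>s) = \<sigma>\<^sup>2 * ((\<theta> - p) / (q - \<theta>))" using \<theta>s_ratio by (simp add: c_def)
    fix f y d :: "'a \<Rightarrow> complex"
    let ?z = "\<Sum>l\<in>I. \<mu> l * (cmod (f l / of_real \<theta> - f l / of_real (\<mu> l)))\<^sup>2"
    assume d: "(\<Sum>l\<in>I. \<mu> l * (cmod (d l))\<^sup>2) \<le> \<gamma>\<^sup>2 * (\<Sum>l\<in>I. \<mu> l * (cmod (y l - f l / of_real (\<mu> l)))\<^sup>2)"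
      and y: "(\<Sum>l\<in>I. \<mu> l * (cmod (y l - f l / of_real (\<mu> l)))\<^sup>2) \<le> ?z"
      and f: "(\<Sum>l\<in>I. (\<mu> l - \<theta>) * (cmod (f l))\<^sup>2) \<le> 0"
    have dz: "(\<Sum>l\<in>I. \<mu> l * (cmod (d l))\<^sup>2) \<le> \<gamma>\<^sup>2 * ?z"
      using d mult_left_mono[OF y, of "\<gamma>\<^sup>2"] by simp
    have z_eq: "?z = (\<Sum>l\<in>I. \<mu> l * (z - 1 / \<mu> l)\<^sup>2 * (cmod (f l))\<^sup>2)"
    proof (rule sum.cong)
      fix l assume "l \<in> I"
      have "f l / of_real \<theta> - f l / of_real (\<mu> l) = of_real (z - 1 / \<mu> l) * f l"
        by (simp add: z_def field_simps)
      then show "\<mu> l * (cmod (f l / of_real \<theta> - f l / of_real (\<mu> l)))\<^sup>2 = \<mu> l * (z - 1 / \<mu> l)\<^sup>2 * (cmod (f l))\<^sup>2"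
        by (simp add: norm_mult power_mult_distrib del: of_real_diff of_real_divide)
    qed simp
    \<comment> \<open>For \<open>\<gamma> = 0\<close> the quotient is \<open>0\<close>, but then \<open>d\<close> vanishes as well.\<close>
    define d' where "d' l = d l / of_real \<gamma>" for l
    have dd': "d l = of_real \<gamma> * d' l" if "l \<in> I" for l
    proof (cases "\<gamma> = 0")
      case True
      then have "(\<Sum>l\<in>I. \<mu> l * (cmod (d l))\<^sup>2) \<le> 0" using dz by simp
      then have "\<mu> l * (cmod (d l))\<^sup>2 = 0"
        using \<mu> I that sum_nonneg_eq_0_iff[of I "\<lambda>l. \<mu> l * (cmod (d l))\<^sup>2"]
        by (smt (verit) mult_nonneg_nonneg sum_nonneg zero_le_power2)
      then show ?thesis using \<mu>[OF that] True by simp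
    qed (simp add: d'_def)
    have d'z: "\<gamma> * (\<Sum>l\<in>I. \<mu> l * (cmod (d' l))\<^sup>2) \<le> \<gamma> * ?z"
    proof (cases "\<gamma> = 0")
      case False
      then have "\<gamma>\<^sup>2 * (\<Sum>l\<in>I. \<mu> l * (cmod (d' l))\<^sup>2) = (\<Sum>l\<in>I. \<mu> l * (cmod (d l))\<^sup>2)"
        by (simp add: d'_def norm_divide power_divide sum_distrib_left)
      then have "\<gamma>\<^sup>2 * (\<Sum>l\<in>I. \<mu> l * (cmod (d' l))\<^sup>2) \<le> \<gamma>\<^sup>2 * ?z" using dz by simp
      then have "(\<Sum>l\<in>I. \<mu> l * (cmod (d' l))\<^sup>2) \<le> ?z" using False by simp
      then show ?thesis using \<gamma> by (intro mult_left_mono) auto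
    qed simp
    have "(\<Sum>l\<in>I. (\<mu> l - \<theta>s) * (cmod (f l / of_real (\<mu> l) - of_real s * f l + d l))\<^sup>2)
      \<le> (\<Sum>l\<in>I. \<theta>s * \<mu> l * (\<gamma> * L us * (cmod (d' l))\<^sup>2 + L us * (z - 1 / \<mu> l) * L (1 / \<mu> l) * (cmod (f l))\<^sup>2))"
    proof (rule sum_mono)
      fix l assume l: "l \<in> I"
      define u where "u = 1 / \<mu> l"
      have u: "b \<le> u" "u \<le> a \<or> dd \<le> u"
        using \<mu>[OF l] p pq by (auto simp: u_def a_def b_def dd_def frac_le)
      have v: "f l / of_real (\<mu> l) - of_real s * f l = of_real (u - s) * f l"
        by (simp add: u_def field_simps)
      have "(us - u) * (cmod (f l / of_real (\<mu> l) - of_real s * f l + of_real \<gamma> * d' l))\<^sup>2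
        \<le> \<gamma> * L us * (cmod (d' l))\<^sup>2 + L us * (z - u) * L u * (cmod (f l))\<^sup>2"
      proof (rule coordinate_estimate[OF _ L0 L0 \<gamma>(1) _ v])
        show "(us - u) * (u - s)\<^sup>2 \<le> (z - u) * (L u)\<^sup>2"
          unfolding L_def
          by (rule reciprocal_cubic_nonpos[OF ord(2-6) \<gamma> fac(3) _ e m_def h_def s_def e_us \<sigma>_us _ u])
            (use fac in \<open>auto simp: dd_def\<close>)
      qed (use u ord in \<open>auto simp: L_def algebra_simps\<close>)
      \<comment> \<open>The weight \<open>\<theta>s * \<mu> l\<close> turns the difference of
        reciprocals back into \<open>\<mu> l - \<theta>s\<close>.\<close>
      then have "\<theta>s * \<mu> l * ((us - u) * (cmod (f l / of_real (\<mu> l) - of_real s * f l + of_real \<gamma> * d' l))\<^sup>2)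
        \<le> \<theta>s * \<mu> l * (\<gamma> * L us * (cmod (d' l))\<^sup>2 + L us * (z - u) * L u * (cmod (f l))\<^sup>2)"
        using \<mu>[OF l] \<theta>s p by (intro mult_left_mono) auto
      moreover have "\<theta>s * \<mu> l * (us - u) = \<mu> l - \<theta>s"
        using \<mu>[OF l] \<theta>s p by (simp add: us_def u_def field_simps)
      ultimately show "(\<mu> l - \<theta>s) * (cmod (f l / of_real (\<mu> l) - of_real s * f l + d l))\<^sup>2
        \<le> \<theta>s * \<mu> l * (\<gamma> * L us * (cmod (d' l))\<^sup>2 + L us * (z - 1 / \<mu> l) * L (1 / \<mu> l) * (cmod (f l))\<^sup>2)"
        unfolding dd'[OF l] u_def by (metis mult.assoc)
    qed
    also have "\<dots> = \<theta>s * L us * (\<gamma> * (\<Sum>l\<in>I. \<mu> l * (cmod (d' l))\<^sup>2)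
        + (\<Sum>l\<in>I. \<mu> l * ((z - 1 / \<mu> l) * L (1 / \<mu> l) * (cmod (f l))\<^sup>2)))"
      unfolding sum_distrib_left sum.distrib[symmetric]
      by (rule sum.cong[OF refl]) (simp only: distrib_left mult_ac)
    also have "\<dots> \<le> \<theta>s * L us * (\<gamma> * ?z
        + (\<Sum>l\<in>I. \<mu> l * ((z - 1 / \<mu> l) * L (1 / \<mu> l) * (cmod (f l))\<^sup>2)))"
      by (rule mult_left_mono[OF add_right_mono[OF d'z]]) (use L0[of us] ord \<theta>s p in auto)
    \<comment> \<open>This is where the slope of \<open>L\<close> matters: in each coordinate the
      bound for the disturbance and the remaining term add up to \<open>L z\<close>, which no longer
      depends on \<open>l\<close>, and only the hypothesis on \<open>f\<close> is left.\<close>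
    also have "\<gamma> * ?z + (\<Sum>l\<in>I. \<mu> l * ((z - 1 / \<mu> l) * L (1 / \<mu> l) * (cmod (f l))\<^sup>2))
      = z * L z * (\<Sum>l\<in>I. (\<mu> l - \<theta>) * (cmod (f l))\<^sup>2)"
      unfolding z_eq sum_distrib_left sum.distrib[symmetric]
    proof (rule sum.cong)
      fix l assume l: "l \<in> I"
      have "\<mu> l * (z - 1 / \<mu> l) = z * (\<mu> l - \<theta>)" using \<mu>[OF l] \<theta> p by (simp add: z_def field_simps)
      moreover have "\<gamma> * (z - 1 / \<mu> l) + L (1 / \<mu> l) = L z" by (simp add: L_def algebra_simps)
      moreover have "\<gamma> * (\<mu> l * (z - 1 / \<mu> l)\<^sup>2 * (cmod (f l))\<^sup>2) + \<mu> l * ((z - 1 / \<mu> l) * L (1 / \<mu> l) * (cmod (f l))\<^sup>2)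
        = \<mu> l * (z - 1 / \<mu> l) * (\<gamma> * (z - 1 / \<mu> l) + L (1 / \<mu> l)) * (cmod (f l))\<^sup>2"
        by (simp add: power2_eq_square algebra_simps)
      ultimately show "\<gamma> * (\<mu> l * (z - 1 / \<mu> l)\<^sup>2 * (cmod (f l))\<^sup>2) + \<mu> l * ((z - 1 / \<mu> l) * L (1 / \<mu> l) * (cmod (f l))\<^sup>2)
        = z * L z * ((\<mu> l - \<theta>) * (cmod (f l))\<^sup>2)" by (simp add: mult_ac)
    qed simp
    also have "\<theta>s * L us * (z * L z * (\<Sum>l\<in>I. (\<mu> l - \<theta>) * (cmod (f l))\<^sup>2)) \<le> 0"
      using f L0[of us] L0[of z] ord \<theta>s p
      by (intro mult_nonneg_nonpos mult_nonneg_nonneg) auto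
    finally show "(\<Sum>l\<in>I. (\<mu> l - \<theta>s) * (cmod (f l / of_real (\<mu> l) - of_real s * f l + d l))\<^sup>2) \<le> 0" .
  qed
qed

section \<open>Column spaces and preconditioners\<close>

lemma mult_unit_vec_col:
  fixes A :: "complex mat"
  assumes "A \<in> carrier_mat n k" "r < k"
  shows "A *\<^sub>v unit_vec k r = col A r"
  using assms by (intro eq_vecI)
    (auto simp: mult_mat_vec_index[of _ n k] unit_vec_def if_distrib[of "(*) _"] simp del: index_mult_mat_vec cong: if_cong)

text \<open>Rank and independence are about the set of columns, in which repetitions disappear. The
  columns are therefore shown to be distinct first: a repetition would leave fewer vectors than the
  rank requires.\<close>

lemma full_col_rank_imp_injective:
  assumes "full_col_rank n W"
  shows "W \<in> carrier_mat n (dim_col W)"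
    and "a \<in> carrier_vec (dim_col W) \<Longrightarrow> W *\<^sub>v a = 0\<^sub>v n \<Longrightarrow> a = 0\<^sub>v (dim_col W)"
proof -
  interpret vec_space "TYPE(complex)" n .
  define k where "k = dim_col W"
  show W: "W \<in> carrier_mat n (dim_col W)" using assms by (auto simp: full_col_rank_def)
  have rank: "rank W = k" using assms by (simp add: full_col_rank_def k_def)
  have "distinct (cols W)"
  proof -
    obtain S where S: "maximal S (\<lambda>T. T \<subseteq> set (cols W) \<and> lin_indpt T)"
      using maximal_exists[of "(\<lambda>T. T \<subseteq> set (cols W) \<and> lin_indpt T)" "card (set (cols W))" "{}"]
      by (meson List.finite_set card_mono empty_iff empty_subsetI finite_lin_indpt2 rev_finite_subset)
    then have "card S \<le> card (set (cols W))" by (simp add: card_mono maximal_def)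
    then have "k \<le> card (set (cols W))" using rank_card_indpt[OF W S] rank by simp
    then show ?thesis by (metis card_distinct card_length cols_length k_def le_antisym)
  qed
  then show "a \<in> carrier_vec (dim_col W) \<Longrightarrow> W *\<^sub>v a = 0\<^sub>v n \<Longrightarrow> a = 0\<^sub>v (dim_col W)"
    using lin_depI[OF W] full_rank_lin_indpt[OF W] rank by (auto simp: k_def)
qed

lemma full_col_rankI:
  assumes W: "W \<in> carrier_mat n k"
    and inj: "\<And>a. a \<in> carrier_vec k \<Longrightarrow> W *\<^sub>v a = 0\<^sub>v n \<Longrightarrow> a = 0\<^sub>v k"
  shows "full_col_rank n W"
proof -
  interpret vec_space "TYPE(complex)" n .
  have "distinct (cols W)"
  proof (rule ccontr)
    assume "\<not> distinct (cols W)"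
    then obtain r s where rs: "r < k" "s < k" "r \<noteq> s" "col W r = col W s"
      using W by (auto simp: distinct_conv_nth)
    have "W *\<^sub>v (unit_vec k r - unit_vec k s) = 0\<^sub>v n"
      using W rs by (simp add: mult_minus_distrib_mat_vec[of _ n k] mult_unit_vec_col[of _ n])
    then have "unit_vec k r - unit_vec k s = (0\<^sub>v k :: complex vec)" by (intro inj) auto
    then have "(unit_vec k r - unit_vec k s) $ r = (0\<^sub>v k :: complex vec) $ r" by simp
    then show False using rs by simp
  qed
  moreover have "lin_indpt (set (cols W))"
    using lin_depE[OF W _ \<open>distinct (cols W)\<close>] inj by metis
  ultimately have "rank W = k" by (rule lin_indpt_full_rank[OF W])
  then show ?thesis using W by (auto simp: full_col_rank_def)
qed

lemma span_of_cols:
  assumes W: "W \<in> carrier_mat n k"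
  shows "span_of n (set (cols W)) = {W *\<^sub>v a | a. a \<in> carrier_vec k}"
proof -
  interpret vec_space "TYPE(complex)" n .
  have dim: "\<forall>w\<in>set (cols W). dim_vec w = n" using W by (auto simp: cols_def)
  have len: "length (cols W) = k" "mat_of_cols n (cols W) = W" using W by auto
  have "span_of n (set (cols W)) = span_list (cols W)"
    unfolding span_of_def using W by (intro span_list_as_span[symmetric]) (auto simp: cols_def)
  also have "\<dots> = {W *\<^sub>v Matrix.vec k c | c. True}"
    unfolding span_list_def lincomb_list_as_mat_mult[OF dim] len by auto
  also have "\<dots> = {W *\<^sub>v a | a. a \<in> carrier_vec k}"
  proof (intro equalityI subsetI; clarify)
    fix a :: "complex vec" assume "a \<in> carrier_vec k"
    then have "a = Matrix.vec k (($) a)" by auto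
    then show "\<exists>c. W *\<^sub>v a = W *\<^sub>v Matrix.vec k c \<and> True" by metis
  next
    fix c :: "nat \<Rightarrow> complex"
    show "\<exists>a. W *\<^sub>v Matrix.vec k c = W *\<^sub>v a \<and> a \<in> carrier_vec k" by (intro exI conjI) auto
  qed
  finally show ?thesis .
qed

lemma span_of_mem: "X \<subseteq> carrier_vec n \<Longrightarrow> x \<in> X \<Longrightarrow> x \<in> span_of n X"
proof -
  interpret vec_space "TYPE(complex)" n .
  show "X \<subseteq> carrier_vec n \<Longrightarrow> x \<in> X \<Longrightarrow> x \<in> span_of n X"
    unfolding span_of_def using in_own_span by auto
qed

lemma span_of_add:
  "X \<subseteq> carrier_vec n \<Longrightarrow> x \<in> span_of n X \<Longrightarrow> y \<in> span_of n X \<Longrightarrow> x + y \<in> span_of n X"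
proof -
  interpret vec_space "TYPE(complex)" n .
  show "X \<subseteq> carrier_vec n \<Longrightarrow> x \<in> span_of n X \<Longrightarrow> y \<in> span_of n X \<Longrightarrow> x + y \<in> span_of n X"
    unfolding span_of_def using span_add1 by auto
qed

lemma span_of_smult:
  "X \<subseteq> carrier_vec n \<Longrightarrow> x \<in> span_of n X \<Longrightarrow> c \<cdot>\<^sub>v x \<in> span_of n X"
proof -
  interpret vec_space "TYPE(complex)" n .
  show "X \<subseteq> carrier_vec n \<Longrightarrow> x \<in> span_of n X \<Longrightarrow> c \<cdot>\<^sub>v x \<in> span_of n X"
    unfolding span_of_def using smult_in_span by auto
qed

lemma span_of_mono:
  "X \<subseteq> carrier_vec n \<Longrightarrow> Y \<subseteq> span_of n X \<Longrightarrow> span_of n Y \<subseteq> span_of n X"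
proof -
  interpret vec_space "TYPE(complex)" n .
  show "X \<subseteq> carrier_vec n \<Longrightarrow> Y \<subseteq> span_of n X \<Longrightarrow> span_of n Y \<subseteq> span_of n X"
    unfolding span_of_def by (rule span_subsetI)
qed

lemma col_mult_mat_vec:
  assumes "A \<in> carrier_mat n k" "B \<in> carrier_mat k m" "r < m"
  shows "col (A * B) r = A *\<^sub>v col B r"
  using assms by (intro eq_vecI) auto

lemma factor_through_span:
  assumes W: "W \<in> carrier_mat n q" and M: "M \<in> carrier_mat n k"
    and sub: "\<And>r. r < k \<Longrightarrow> col M r \<in> span_of n (set (cols W))"
  obtains B where "B \<in> carrier_mat q k" "M = W * B"
proof -
  have "\<forall>r<k. \<exists>b. b \<in> carrier_vec q \<and> col M r = W *\<^sub>v b"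
    using sub unfolding span_of_cols[OF W] by blast
  then obtain b where b: "\<And>r. r < k \<Longrightarrow> b r \<in> carrier_vec q \<and> col M r = W *\<^sub>v b r" by metis
  define B where "B = mat_of_cols q (map b [0..<k])"
  have B: "B \<in> carrier_mat q k" by (rule carrier_matI) (simp_all add: B_def)
  have cB: "col B r = b r" if "r < k" for r
    unfolding B_def by (subst col_mat_of_cols) (use that b in auto)
  have "M = W * B"
  proof (rule mat_col_eqI)
    fix r assume "r < dim_col (W * B)"
    then show "col M r = col (W * B) r"
      using B by (simp add: col_mult_mat_vec[OF W B] cB b)
  qed (use M W B in auto)
  with B that show ?thesis by blast
qed

section \<open>Preconditioned operators in the energy norm\<close>

lemma pos_def_mat_diag:
  assumes "\<And>r. r < m \<Longrightarrow> 0 < \<mu> r"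
  shows "pos_def_mat m (mat_diag m (\<lambda>r. complex_of_real (\<mu> r)))"
  unfolding pos_def_mat_def
proof (intro conjI ballI impI)
  show "hermitian_mat m (mat_diag m (\<lambda>r. complex_of_real (\<mu> r)))"
    by (auto simp: hermitian_mat_def mat_diag_def intro!: eq_matI)
  fix x :: "complex vec" assume x: "x \<in> carrier_vec m" "x \<noteq> 0\<^sub>v m"
  then obtain r where r: "r < m" "x $ r \<noteq> 0" by (metis carrier_vecD eq_vecI index_zero_vec)
  have "(mat_diag m (\<lambda>r. complex_of_real (\<mu> r)) *\<^sub>v x) \<bullet>c x = of_real (\<Sum>r<m. \<mu> r * (cmod (x $ r))\<^sup>2)"
    unfolding mat_diag_mult_vec[OF x(1)] using x
    by (simp add: cprod_sum[of _ m] complex_norm_square mult_ac del: of_real_power)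
  moreover have "0 < (\<Sum>r<m. \<mu> r * (cmod (x $ r))\<^sup>2)"
    by (rule sum_pos2[of _ r]) (use r assms in \<open>auto intro!: mult_nonneg_nonneg less_imp_le[OF assms]\<close>)
  ultimately show "0 < Re ((mat_diag m (\<lambda>r. complex_of_real (\<mu> r)) *\<^sub>v x) \<bullet>c x)" by simp
qed

text \<open>The eigenvector equation is tested with y = D x: the form of \<open>T\<close> at y
  equals \<open>c\<close> times the energy of x, and both forms are positive. This makes the
  smallest eigenvalue in the quality parameter positive.\<close>

lemma mult_diag_posdef_spectrum:
  assumes T: "pos_def_mat m T" and \<mu>: "\<And>r. r < m \<Longrightarrow> 0 < \<mu> r"
    and c: "c \<in> spectrum (T * mat_diag m (\<lambda>r. complex_of_real (\<mu> r)))"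
  shows "0 < Re c"
proof -
  let ?D = "mat_diag m (\<lambda>r. complex_of_real (\<mu> r))"
  have TH: "hermitian_mat m T" and T': "T \<in> carrier_mat m m"
    using T by (auto simp: pos_def_mat_def hermitian_mat_def)
  have D: "?D \<in> carrier_mat m m" by simp
  obtain x where x: "x \<in> carrier_vec m" "x \<noteq> 0\<^sub>v m" "(T * ?D) *\<^sub>v x = c \<cdot>\<^sub>v x"
    using c T' by (auto simp: spectrum_def eigenvalue_def eigenvector_def)
  define y where "y = ?D *\<^sub>v x"
  have y: "y \<in> carrier_vec m" "\<And>r. r < m \<Longrightarrow> y $ r = of_real (\<mu> r) * x $ r"
    using x by (simp_all add: y_def mat_diag_mult_vec)
  have Ty: "T *\<^sub>v y = c \<cdot>\<^sub>v x" using x(3) assoc_mult_mat_vec[OF T' D x(1)] by (simp add: y_def)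
  obtain r where r: "r < m" "x $ r \<noteq> 0" using x by (metis carrier_vecD eq_vecI index_zero_vec)
  then have "y $ r \<noteq> 0" using y(2)[OF r(1)] \<mu>[OF r(1)] by simp
  then have "y \<noteq> 0\<^sub>v m" using r by auto
  then have "0 < Re ((T *\<^sub>v y) \<bullet>c y)" using T y by (auto simp: pos_def_mat_def)
  moreover have "(T *\<^sub>v y) \<bullet>c y = c * of_real (\<Sum>r<m. \<mu> r * (cmod (x $ r))\<^sup>2)"
  proof -
    have "(T *\<^sub>v y) \<bullet>c y = c * (x \<bullet>c y)" unfolding Ty using x y by (simp add: cprod_smult_left[of _ m])
    also have "x \<bullet>c y = of_real (\<Sum>r<m. \<mu> r * (cmod (x $ r))\<^sup>2)"
      using y by (simp add: cprod_sum[of _ m] complex_norm_square mult_ac del: of_real_power)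
    finally show ?thesis .
  qed
  moreover have "0 \<le> (\<Sum>r<m. \<mu> r * (cmod (x $ r))\<^sup>2)"
    by (intro sum_nonneg mult_nonneg_nonneg) (auto intro: less_imp_le[OF \<mu>])
  ultimately show ?thesis by (simp add: zero_less_mult_iff)
qed

text \<open>The eigenvectors of \<open>T D\<close> can be chosen orthonormal for \<open>D\<close>, because they belong to the
  Hermitian pencil \<open>(D T D, D)\<close>.\<close>

lemma preconditioner_contraction:
  assumes T: "pos_def_mat m T" and \<mu>: "\<And>r. r < m \<Longrightarrow> 0 < \<mu> r" and m: "0 < m"
    and D_def: "D = mat_diag m (\<lambda>r. complex_of_real (\<mu> r))"
    and \<sigma>_def: "\<sigma> = Re ` spectrum (T * D)"
    and \<epsilon>_def: "\<epsilon> = (Max \<sigma> - Min \<sigma>) / (Max \<sigma> + Min \<sigma>)"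
  obtains \<omega> where "0 < \<omega>" "0 \<le> \<epsilon>" "\<epsilon> < 1"
    "\<And>q. q \<in> carrier_vec m \<Longrightarrow>
      (\<Sum>r<m. \<mu> r * (cmod (q $ r - of_real \<omega> * (T *\<^sub>v (D *\<^sub>v q)) $ r))\<^sup>2)
        \<le> \<epsilon>\<^sup>2 * (\<Sum>r<m. \<mu> r * (cmod (q $ r))\<^sup>2)"
proof -
  have TH: "hermitian_mat m T" and T': "T \<in> carrier_mat m m"
    using T by (auto simp: pos_def_mat_def hermitian_mat_def)
  have D: "D \<in> carrier_mat m m" by (simp add: D_def)
  have TD: "T * D \<in> carrier_mat m m" using T' D by simp
  have Dform: "(D *\<^sub>v x) \<bullet>c x = of_real (\<Sum>r<m. \<mu> r * (cmod (x $ r))\<^sup>2)" if "x \<in> carrier_vec m" for x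
    unfolding D_def mat_diag_mult_vec[OF that] using that
    by (simp add: cprod_sum[of _ m] complex_norm_square mult_ac del: of_real_power)
  have Dpos: "pos_def_mat m D" unfolding D_def by (rule pos_def_mat_diag[OF \<mu>])
  obtain X e where X: "X \<in> carrier_mat m m" and XD: "compress D X = 1\<^sub>m m"
    and XA: "compress (compress T D) X = mat_diag m (\<lambda>r. complex_of_real (e r))"
    using pencil_diagonalization[OF hermitian_compress[OF TH D] Dpos] by blast
  have aD: "mat_adjoint D = D" using Dpos by (simp add: pos_def_mat_def hermitian_mat_def)
  have cTD: "compress T D = D * (T * D)"
    unfolding compress_def aD using T' D by (intro assoc_mult_mat[of _ m m _ m _ m]) auto
  \<comment> \<open>\<open>Y\<close> is the inverse of \<open>X\<close>, so that
    \<open>T * D\<close> becomes the real diagonal matrix \<open>E\<close> in a basis that is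
    orthonormal for \<open>D\<close>.\<close>
  define Y where "Y = mat_adjoint X * D"
  have Y: "Y \<in> carrier_mat m m" using X D by (auto simp: Y_def)
  have YX: "Y * X = 1\<^sub>m m" using XD by (simp add: Y_def compress_def)
  then have XY: "X * Y = 1\<^sub>m m" using mat_mult_left_right_inverse[OF Y X] by simp
  define E where "E = mat_diag m (\<lambda>r. complex_of_real (e r))"
  have E: "E \<in> carrier_mat m m" by (simp add: E_def)
  have TDX: "(T * D) * X = X * E"
  proof -
    have "E = mat_adjoint X * (D * (T * D)) * X"
      using XA by (simp add: E_def compress_def[of _ X] cTD)
    also have "mat_adjoint X * (D * (T * D)) = Y * (T * D)"
      unfolding Y_def using X D TD by (intro assoc_mult_mat[symmetric, of _ m m _ m _ m]) auto
    also have "Y * (T * D) * X = Y * ((T * D) * X)"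
      using X Y TD by (intro assoc_mult_mat[of _ m m _ m _ m]) auto
    finally have "X * E = X * (Y * ((T * D) * X))" by simp
    also have "\<dots> = (X * Y) * ((T * D) * X)"
      using X Y TD by (intro assoc_mult_mat[symmetric, of _ m m _ m _ m]) auto
    finally show ?thesis using XY left_mult_one_mat[OF mult_carrier_mat[OF TD X]] by simp
  qed
  have fin: "finite \<sigma>" using card_finite_spectrum[OF TD] by (simp add: \<sigma>_def)
  have e_in: "e r \<in> \<sigma>" if r: "r < m" for r
  proof -
    have "(T * D) *\<^sub>v col X r = col ((T * D) * X) r"
      using col_mult_mat_vec[OF TD X r] by simp
    also have "\<dots> = X *\<^sub>v col E r" unfolding TDX by (rule col_mult_mat_vec[OF X E r])
    also have "col E r = of_real (e r) \<cdot>\<^sub>v unit_vec m r"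
      using r by (intro eq_vecI) (auto simp: E_def mat_diag_def)
    also have "X *\<^sub>v \<dots> = of_real (e r) \<cdot>\<^sub>v col X r"
      using X r by (simp add: mult_mat_vec[of _ m m] mult_unit_vec_col[of _ m])
    finally have ev: "(T * D) *\<^sub>v col X r = of_real (e r) \<cdot>\<^sub>v col X r" .
    have "col X r \<noteq> 0\<^sub>v m"
    proof
      assume "col X r = 0\<^sub>v m"
      then have "compress D X $$ (r, r) = 0"
        using D X r by (simp add: compress_index[OF D X r r])
      then show False using XD r by simp
    qed
    then have "of_real (e r) \<in> spectrum (T * D)"
      using ev X TD T' by (auto simp: spectrum_def eigenvalue_def eigenvector_def intro!: exI[of _ "col X r"])
    then have "Re (of_real (e r)) \<in> \<sigma>" unfolding \<sigma>_def by (rule imageI)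
    then show ?thesis by simp
  qed
  have ne: "\<sigma> \<noteq> {}" using e_in m by auto
  define \<alpha> where "\<alpha> = Min \<sigma>"
  define \<beta> where "\<beta> = Max \<sigma>"
  have "\<alpha> \<in> \<sigma>" using fin ne by (simp add: \<alpha>_def)
  then have \<alpha>: "0 < \<alpha>" using mult_diag_posdef_spectrum[OF T \<mu>] by (auto simp: \<sigma>_def D_def)
  have \<alpha>\<beta>: "\<alpha> \<le> \<beta>" using \<open>\<alpha> \<in> \<sigma>\<close> fin by (simp add: \<beta>_def)
  have \<epsilon>: "\<epsilon> = (\<beta> - \<alpha>) / (\<beta> + \<alpha>)" by (simp add: \<epsilon>_def \<alpha>_def \<beta>_def)
  \<comment> \<open>The step length that centres the spectrum: 1 - \<omega> e runs through the
    interval from -\<epsilon> to \<epsilon> when e runs from \<alpha> to \<beta>.\<close>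
  define \<omega> where "\<omega> = 2 / (\<beta> + \<alpha>)"
  have e_bound: "(1 - \<omega> * e r)\<^sup>2 \<le> \<epsilon>\<^sup>2" if "r < m" for r
  proof -
    have "\<alpha> \<le> e r" "e r \<le> \<beta>" using e_in[OF that] fin by (auto simp: \<alpha>_def \<beta>_def)
    then have "\<bar>\<beta> + \<alpha> - 2 * e r\<bar> \<le> \<beta> - \<alpha>" by (simp add: abs_le_iff)
    moreover have "1 - \<omega> * e r = (\<beta> + \<alpha> - 2 * e r) / (\<beta> + \<alpha>)"
      using \<alpha> \<alpha>\<beta> by (simp add: \<omega>_def field_simps)
    ultimately have "\<bar>1 - \<omega> * e r\<bar> \<le> \<epsilon>"
      unfolding \<epsilon> using \<alpha> \<alpha>\<beta> by (simp add: abs_divide divide_right_mono)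
    then show ?thesis by (simp add: abs_le_square_iff[symmetric])
  qed
  show ?thesis
  proof
    show "0 < \<omega>" "0 \<le> \<epsilon>" "\<epsilon> < 1" using \<alpha> \<alpha>\<beta> by (auto simp: \<omega>_def \<epsilon>)
    fix q :: "complex vec" assume q: "q \<in> carrier_vec m"
    define c where "c = Y *\<^sub>v q"
    have c: "c \<in> carrier_vec m" using Y q by (auto simp: c_def)
    have qc: "q = X *\<^sub>v c" using XY q assoc_mult_mat_vec[OF X Y q] by (simp add: c_def)
    \<comment> \<open>\<open>X\<close> maps the Euclidean norm isometrically to the norm of
      \<open>D\<close>, which reduces the contraction to the diagonal entries.\<close>
    have norm: "(\<Sum>r<m. \<mu> r * (cmod ((X *\<^sub>v v) $ r))\<^sup>2) = (\<Sum>r<m. (cmod (v $ r))\<^sup>2)"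
      if v: "v \<in> carrier_vec m" for v
    proof -
      have Xv: "X *\<^sub>v v \<in> carrier_vec m" using X v by simp
      have "complex_of_real (\<Sum>r<m. \<mu> r * (cmod ((X *\<^sub>v v) $ r))\<^sup>2) = (compress D X *\<^sub>v v) \<bullet>c v"
        unfolding cprod_compress[OF D X v v] Dform[OF Xv] ..
      also have "\<dots> = complex_of_real (\<Sum>r<m. (cmod (v $ r))\<^sup>2)"
        unfolding XD using v by (simp add: cprod_sum[of _ m] complex_norm_square del: of_real_power)
      finally show ?thesis by (simp only: of_real_eq_iff)
    qed
    define c' where "c' = c - of_real \<omega> \<cdot>\<^sub>v (E *\<^sub>v c)"
    have c': "c' \<in> carrier_vec m" using c E by (auto simp: c'_def)
    have Ec: "E *\<^sub>v c \<in> carrier_vec m" using c E by auto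
    have "T *\<^sub>v (D *\<^sub>v q) = (T * D) *\<^sub>v (X *\<^sub>v c)" unfolding qc using T' D X c by (intro assoc_mult_mat_vec[symmetric]) auto
    also have "\<dots> = ((T * D) * X) *\<^sub>v c" using TD X c by (intro assoc_mult_mat_vec[symmetric]) auto
    also have "\<dots> = X *\<^sub>v (E *\<^sub>v c)" unfolding TDX using X E c by (intro assoc_mult_mat_vec) auto
    finally have TDq: "T *\<^sub>v (D *\<^sub>v q) = X *\<^sub>v (E *\<^sub>v c)" .
    have Xc': "X *\<^sub>v c' = q - of_real \<omega> \<cdot>\<^sub>v (T *\<^sub>v (D *\<^sub>v q))"
      unfolding c'_def TDq using X c Ec
      by (simp add: mult_minus_distrib_mat_vec[of _ m m] mult_mat_vec[of _ m m] qc[symmetric])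
    have "(\<Sum>r<m. \<mu> r * (cmod (q $ r - of_real \<omega> * (T *\<^sub>v (D *\<^sub>v q)) $ r))\<^sup>2)
        = (\<Sum>r<m. \<mu> r * (cmod ((X *\<^sub>v c') $ r))\<^sup>2)"
      unfolding Xc' using q T' D by (intro sum.cong) auto
    also have "\<dots> = (\<Sum>r<m. (cmod (c' $ r))\<^sup>2)" by (rule norm[OF c'])
    also have "\<dots> \<le> (\<Sum>r<m. \<epsilon>\<^sup>2 * (cmod (c $ r))\<^sup>2)"
    proof (rule sum_mono)
      fix r assume "r \<in> {..<m}"
      then have r: "r < m" by simp
      have "c' $ r = of_real (1 - \<omega> * e r) * c $ r"
        using r c E by (simp add: c'_def E_def mat_diag_mult_vec algebra_simps)
      then have "(cmod (c' $ r))\<^sup>2 = (1 - \<omega> * e r)\<^sup>2 * (cmod (c $ r))\<^sup>2"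
        by (simp only: norm_mult norm_of_real power_mult_distrib power2_abs)
      also have "\<dots> \<le> \<epsilon>\<^sup>2 * (cmod (c $ r))\<^sup>2" by (intro mult_right_mono e_bound r) auto
      finally show "(cmod (c' $ r))\<^sup>2 \<le> \<epsilon>\<^sup>2 * (cmod (c $ r))\<^sup>2" .
    qed
    also have "\<dots> = \<epsilon>\<^sup>2 * (\<Sum>r<m. \<mu> r * (cmod (q $ r))\<^sup>2)"
      unfolding qc norm[OF c] by (simp add: sum_distrib_left)
    finally show "(\<Sum>r<m. \<mu> r * (cmod (q $ r - of_real \<omega> * (T *\<^sub>v (D *\<^sub>v q)) $ r))\<^sup>2)
        \<le> \<epsilon>\<^sup>2 * (\<Sum>r<m. \<mu> r * (cmod (q $ r))\<^sup>2)" .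
  qed
qed

section \<open>Coordinates in an eigenbasis\<close>

definition hcat :: "complex mat \<Rightarrow> complex mat \<Rightarrow> complex mat" where
  "hcat A B = Matrix.mat (dim_row A) (dim_col A + dim_col B)
     (\<lambda>(r, c). if c < dim_col A then A $$ (r, c) else B $$ (r, c - dim_col A))"

lemma hcat_carrier [simp]:
  "A \<in> carrier_mat n k \<Longrightarrow> B \<in> carrier_mat n l \<Longrightarrow> hcat A B \<in> carrier_mat n (k + l)"
  by (auto simp: hcat_def)

lemma sum_lessThan_add:
  fixes f :: "nat \<Rightarrow> 'a :: comm_monoid_add"
  shows "(\<Sum>s<k + l. f s) = (\<Sum>s<k. f s) + (\<Sum>s<l. f (k + s))"
  by (induction l) (simp_all add: add.assoc)

lemma hcat_mult_vec:
  assumes A: "A \<in> carrier_mat n k" and B: "B \<in> carrier_mat n l" and a: "a \<in> carrier_vec (k + l)"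
  shows "hcat A B *\<^sub>v a = A *\<^sub>v vec_first a k + B *\<^sub>v vec_last a l"
proof (rule eq_vecI)
  fix r assume "r < dim_vec (A *\<^sub>v vec_first a k + B *\<^sub>v vec_last a l)"
  then have r: "r < n" using B by simp
  have "(hcat A B *\<^sub>v a) $ r = (\<Sum>s<k + l. hcat A B $$ (r, s) * a $ s)"
    by (rule mult_mat_vec_index[OF hcat_carrier[OF A B] a r])
  also have "\<dots> = (\<Sum>s<k. A $$ (r, s) * vec_first a k $ s) + (\<Sum>s<l. B $$ (r, s) * vec_last a l $ s)"
    unfolding sum_lessThan_add using A B a r
    by (intro arg_cong2[of _ _ _ _ "(+)"] sum.cong) (auto simp: hcat_def vec_first_def vec_last_def)
  also have "\<dots> = (A *\<^sub>v vec_first a k + B *\<^sub>v vec_last a l) $ r"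
    using A B r mult_mat_vec_index[OF A vec_first_carrier r, of a] mult_mat_vec_index[OF B vec_last_carrier r, of a]
    by simp
  finally show "(hcat A B *\<^sub>v a) $ r = (A *\<^sub>v vec_first a k + B *\<^sub>v vec_last a l) $ r" .
qed (use A B in \<open>simp add: hcat_def\<close>)

lemma compress_one [simp]: "A \<in> carrier_mat n n \<Longrightarrow> compress A (1\<^sub>m n) = A"
proof -
  assume A: "A \<in> carrier_mat n n"
  have "mat_adjoint (1\<^sub>m n :: complex mat) = 1\<^sub>m n" by (rule eq_matI) auto
  then show ?thesis using A by (simp add: compress_def)
qed

locale pencil_eigenbasis =
  fixes n :: nat and H S :: "complex mat" and u :: "nat \<Rightarrow> complex vec" and lam :: "nat \<Rightarrow> real"
  assumes H_hermitian: "hermitian_mat n H"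
    and S_pos_def: "pos_def_mat n S"
    and u_carrier: "l \<in> {1..n} \<Longrightarrow> u l \<in> carrier_vec n"
    and u_orthonormal: "l \<in> {1..n} \<Longrightarrow> k \<in> {1..n} \<Longrightarrow> (S *\<^sub>v u l) \<bullet>c u k = (if l = k then 1 else 0)"
    and u_eigen: "l \<in> {1..n} \<Longrightarrow> H *\<^sub>v u l = complex_of_real (lam l) \<cdot>\<^sub>v (S *\<^sub>v u l)"
begin

lemma H_carrier [simp]: "H \<in> carrier_mat n n" and S_carrier [simp]: "S \<in> carrier_mat n n"
  and S_hermitian: "hermitian_mat n S"
  using H_hermitian S_pos_def by (auto simp: hermitian_mat_def pos_def_mat_def)

text \<open>Coordinates with respect to the S-orthonormal basis, numbered from 1 like
  \<open>u\<close>; the columns of \<open>G\<close> are numbered from 0, hence the shifts by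
  \<open>Suc\<close> below.\<close>

definition coef :: "complex vec \<Rightarrow> nat \<Rightarrow> complex" where
  "coef x l = (S *\<^sub>v x) \<bullet>c u l"

definition G :: "complex mat" where
  "G = mat_of_cols n (map u [1..<Suc n])"

lemma G_carrier [simp]: "G \<in> carrier_mat n n"
  by (rule carrier_matI) (simp_all add: G_def)

lemma dim_G [simp]: "dim_row G = n" "dim_col G = n"
  using carrier_matD[OF G_carrier] by auto

lemma col_G: "r < n \<Longrightarrow> col G r = u (Suc r)"
  unfolding G_def by (subst col_mat_of_cols) (auto intro!: u_carrier simp del: upt_Suc)

lemma compress_S_G: "compress S G = 1\<^sub>m n"
proof (rule eq_matI)
  fix r s assume "r < dim_row (1\<^sub>m n :: complex mat)" "s < dim_col (1\<^sub>m n :: complex mat)"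
  then show "compress S G $$ (r, s) = 1\<^sub>m n $$ (r, s)"
    by (simp add: compress_index[OF S_carrier G_carrier] col_G u_orthonormal)
qed (simp_all add: compress_def)

lemma compress_H_G: "compress H G = mat_diag n (\<lambda>r. complex_of_real (lam (Suc r)))"
proof (rule eq_matI)
  fix r s assume "r < dim_row (mat_diag n (\<lambda>r. complex_of_real (lam (Suc r))))"
    "s < dim_col (mat_diag n (\<lambda>r. complex_of_real (lam (Suc r))))"
  then have rs: "r < n" "s < n" by (simp_all add: mat_diag_def)
  have "(S *\<^sub>v u (Suc s)) \<in> carrier_vec n" using u_carrier[of "Suc s"] rs by (intro mult_mat_vec_carrier[of _ n n]) auto
  then show "compress H G $$ (r, s) = mat_diag n (\<lambda>r. complex_of_real (lam (Suc r))) $$ (r, s)"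
    using rs by (simp add: compress_index[OF H_carrier G_carrier] col_G u_eigen u_carrier
        cprod_smult_left[of _ n] u_orthonormal mat_diag_def)
qed (simp_all add: compress_def mat_diag_def)

lemma pair_eigenvalues_eq: "pair_eigenvalues H S = sort (map (\<lambda>r. lam (Suc r)) [0..<n])"
  by (rule pair_eigenvalues_diagonalized[OF H_carrier S_carrier G_carrier compress_S_G compress_H_G])

text \<open>S-orthonormality makes \<open>mat_adjoint G * S\<close> a left inverse of the square
  matrix \<open>G\<close>, hence a right inverse. The second identity is the adjoint of the
  first.\<close>

lemma G_adjoint_S: "G * (mat_adjoint G * S) = 1\<^sub>m n" and S_G_adjoint: "S * G * mat_adjoint G = 1\<^sub>m n"
proof -
  have c: "mat_adjoint G * S \<in> carrier_mat n n" by (intro mult_carrier_mat[of _ n n]) auto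
  have "(mat_adjoint G * S) * G = 1\<^sub>m n" using compress_S_G by (simp add: compress_def)
  then show 1: "G * (mat_adjoint G * S) = 1\<^sub>m n" by (rule mat_mult_left_right_inverse[OF c G_carrier])
  have "mat_adjoint (G * (mat_adjoint G * S)) = mat_adjoint (mat_adjoint G * S) * mat_adjoint G"
    by (rule mat_adjoint_mult[OF G_carrier c])
  also have "mat_adjoint (mat_adjoint G * S) = S * G"
    using S_hermitian by (subst mat_adjoint_mult[of _ n n _ n]) (auto simp: hermitian_mat_def)
  finally have "S * G * mat_adjoint G = mat_adjoint (1\<^sub>m n)" unfolding 1 by simp
  also have "\<dots> = 1\<^sub>m n" by (rule eq_matI) auto
  finally show "S * G * mat_adjoint G = 1\<^sub>m n" .
qed

lemma coef_vec:
  assumes x: "x \<in> carrier_vec n"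
  shows "(mat_adjoint G * S) *\<^sub>v x = Matrix.vec n (\<lambda>r. coef x (Suc r))"
proof (rule eq_vecI)
  fix r assume "r < dim_vec (Matrix.vec n (\<lambda>r. coef x (Suc r)))"
  then have r: "r < n" by simp
  have Sx: "S *\<^sub>v x \<in> carrier_vec n" using x by (intro mult_mat_vec_carrier[of _ n n]) auto
  have "((mat_adjoint G * S) *\<^sub>v x) $ r = row (mat_adjoint G) r \<bullet> (S *\<^sub>v x)"
    using x r by (subst assoc_mult_mat_vec[of _ n n _ n]) auto
  also have "row (mat_adjoint G) r = conjugate (col G r)"
    using r by (intro eq_vecI) (auto simp: carrier_matD[OF G_carrier])
  also have "\<dots> \<bullet> (S *\<^sub>v x) = (S *\<^sub>v x) \<bullet>c col G r"
    using r Sx by (intro comm_scalar_prod[of _ n]) auto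
  finally show "((mat_adjoint G * S) *\<^sub>v x) $ r = Matrix.vec n (\<lambda>r. coef x (Suc r)) $ r"
    using r by (simp add: coef_def col_G)
qed (use carrier_matD[OF G_carrier] in simp)

lemma expansion:
  assumes x: "x \<in> carrier_vec n"
  shows "x = G *\<^sub>v Matrix.vec n (\<lambda>r. coef x (Suc r))"
proof -
  have c: "mat_adjoint G * S \<in> carrier_mat n n" by (intro mult_carrier_mat[of _ n n]) auto
  have "G *\<^sub>v ((mat_adjoint G * S) *\<^sub>v x) = (G * (mat_adjoint G * S)) *\<^sub>v x"
    by (rule assoc_mult_mat_vec[symmetric, OF G_carrier c x])
  then show ?thesis unfolding G_adjoint_S coef_vec[OF x] using x by simp
qed

lemma sum_Suc_lessThan: "(\<Sum>r<n. f (Suc r)) = (\<Sum>l\<in>{1..n}. f l)"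
  by (simp add: lessThan_atLeast0 sum.atLeast_Suc_atMost_Suc_shift flip: atLeastLessThanSuc_atLeastAtMost sum.shift_bounds_Suc_ivl)

lemma S_form:
  assumes x: "x \<in> carrier_vec n" and y: "y \<in> carrier_vec n"
  shows "(S *\<^sub>v x) \<bullet>c y = (\<Sum>l\<in>{1..n}. coef x l * cnj (coef y l))"
proof -
  let ?v = "\<lambda>x. Matrix.vec n (\<lambda>r. coef x (Suc r))"
  have "(S *\<^sub>v x) \<bullet>c y = (S *\<^sub>v (G *\<^sub>v ?v x)) \<bullet>c (G *\<^sub>v ?v y)"
    using expansion[OF x] expansion[OF y] by simp
  also have "\<dots> = (compress S G *\<^sub>v ?v x) \<bullet>c ?v y"
    by (rule cprod_compress[OF S_carrier G_carrier, symmetric]) auto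
  also have "\<dots> = (\<Sum>r<n. coef x (Suc r) * cnj (coef y (Suc r)))"
    unfolding compress_S_G by (simp add: cprod_sum[of _ n])
  also have "\<dots> = (\<Sum>l\<in>{1..n}. coef x l * cnj (coef y l))"
    by (rule sum_Suc_lessThan)
  finally show ?thesis .
qed

lemma H_form:
  assumes x: "x \<in> carrier_vec n" and y: "y \<in> carrier_vec n"
  shows "(H *\<^sub>v x) \<bullet>c y = (\<Sum>l\<in>{1..n}. of_real (lam l) * (coef x l * cnj (coef y l)))"
proof -
  let ?v = "\<lambda>x. Matrix.vec n (\<lambda>r. coef x (Suc r))"
  have "(H *\<^sub>v x) \<bullet>c y = (H *\<^sub>v (G *\<^sub>v ?v x)) \<bullet>c (G *\<^sub>v ?v y)"
    using expansion[OF x] expansion[OF y] by simp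
  also have "\<dots> = (compress H G *\<^sub>v ?v x) \<bullet>c ?v y"
    by (rule cprod_compress[OF H_carrier G_carrier, symmetric]) auto
  also have "\<dots> = (\<Sum>r<n. of_real (lam (Suc r)) * (coef x (Suc r) * cnj (coef y (Suc r))))"
    unfolding compress_H_G by (simp add: mat_diag_mult_vec[of _ n] cprod_sum[of _ n] mult.assoc)
  also have "\<dots> = (\<Sum>l\<in>{1..n}. of_real (lam l) * (coef x l * cnj (coef y l)))"
    by (rule sum_Suc_lessThan)
  finally show ?thesis .
qed

lemma coef_eqI:
  assumes "x \<in> carrier_vec n" "y \<in> carrier_vec n" "\<And>l. l \<in> {1..n} \<Longrightarrow> coef x l = coef y l"
  shows "x = y"
proof -
  have "Matrix.vec n (\<lambda>r. coef x (Suc r)) = Matrix.vec n (\<lambda>r. coef y (Suc r))"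
    using assms(3) by auto
  then show ?thesis using expansion[OF assms(1)] expansion[OF assms(2)] by metis
qed

lemma coef_add:
  "x \<in> carrier_vec n \<Longrightarrow> y \<in> carrier_vec n \<Longrightarrow> l \<in> {1..n} \<Longrightarrow> coef (x + y) l = coef x l + coef y l"
  unfolding coef_def using u_carrier[of l]
  by (simp add: mult_add_distrib_mat_vec[OF S_carrier] cprod_add_left[of _ n] mult_mat_vec_carrier[OF S_carrier])

lemma coef_smult:
  "x \<in> carrier_vec n \<Longrightarrow> l \<in> {1..n} \<Longrightarrow> coef (c \<cdot>\<^sub>v x) l = c * coef x l"
  unfolding coef_def using u_carrier[of l]
  by (simp add: mult_mat_vec[OF S_carrier] cprod_smult_left[of _ n] mult_mat_vec_carrier[OF S_carrier])

lemma coef_minus: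
  assumes "x \<in> carrier_vec n" "y \<in> carrier_vec n" "l \<in> {1..n}"
  shows "coef (x - y) l = coef x l - coef y l"
proof -
  have "x - y = x + (- 1) \<cdot>\<^sub>v y" using assms by (intro eq_vecI) auto
  then show ?thesis using assms by (simp add: coef_add coef_smult)
qed

lemma coef_zero: "l \<in> {1..n} \<Longrightarrow> coef (0\<^sub>v n) l = 0"
proof -
  assume "l \<in> {1..n}"
  moreover have "0 \<cdot>\<^sub>v 0\<^sub>v n = (0\<^sub>v n :: complex vec)" by (intro eq_vecI) auto
  ultimately show ?thesis using coef_smult[of "0\<^sub>v n" l 0] by simp
qed

lemma coef_u: "l \<in> {1..n} \<Longrightarrow> k \<in> {1..n} \<Longrightarrow> coef (u k) l = (if l = k then 1 else 0)"
  by (simp add: coef_def u_orthonormal)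

lemma coef_H:
  assumes x: "x \<in> carrier_vec n" and l: "l \<in> {1..n}"
  shows "(H *\<^sub>v x) \<bullet>c u l = of_real (lam l) * coef x l"
proof -
  have ul: "u l \<in> carrier_vec n" "S *\<^sub>v u l \<in> carrier_vec n"
    using u_carrier[OF l] mult_mat_vec_carrier[OF S_carrier] by auto
  have "(H *\<^sub>v x) \<bullet>c u l = cnj ((H *\<^sub>v u l) \<bullet>c x)" by (rule hermitian_cprod[OF H_hermitian x ul(1)])
  also have "\<dots> = of_real (lam l) * cnj ((S *\<^sub>v u l) \<bullet>c x)"
    using ul x by (simp add: u_eigen[OF l] cprod_smult_left[of _ n])
  also have "cnj ((S *\<^sub>v u l) \<bullet>c x) = coef x l"
    unfolding coef_def by (rule hermitian_cprod[OF S_hermitian x ul(1), symmetric])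
  finally show ?thesis .
qed

lemma coef_mult_mat_vec:
  assumes M: "M \<in> carrier_mat n k" and a: "a \<in> carrier_vec k" and l: "l \<in> {1..n}"
  shows "coef (M *\<^sub>v a) l = (\<Sum>r<k. a $ r * coef (col M r) l)"
proof -
  define c where "c = mat_adjoint (S * M) *\<^sub>v u l"
  have SM: "S * M \<in> carrier_mat n k" using M by (intro mult_carrier_mat[OF S_carrier])
  have c: "c \<in> carrier_vec k"
    unfolding c_def by (rule mult_mat_vec_carrier[OF mat_adjoint_carrier[OF SM] u_carrier[OF l]])
  have *: "coef (M *\<^sub>v b) l = b \<bullet>c c" if "b \<in> carrier_vec k" for b
    unfolding coef_def c_def
    using cprod_adjoint[OF SM that u_carrier[OF l]] assoc_mult_mat_vec[OF S_carrier M that] by simp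
  have "coef (col M r) l = cnj (c $ r)" if "r < k" for r
    using *[of "unit_vec k r"] that c mult_unit_vec_col[OF M that]
    by (simp add: cprod_sum[of _ k] unit_vec_def if_distrib[of "\<lambda>x. x * _"] cong: if_cong)
  then show ?thesis using *[OF a] c by (simp add: cprod_sum[of _ k])
qed

end

section \<open>Ritz values in a subspace\<close>

lemma mult_mat_vec_zero:
  fixes A :: "complex mat"
  assumes "A \<in> carrier_mat n k"
  shows "A *\<^sub>v 0\<^sub>v k = 0\<^sub>v n"
  using assms by (intro eq_vecI) auto

text \<open>The min-max half inside the range of \<open>W\<close>; \<open>C\<close> holds the
  coordinates of the trial vectors in that basis.\<close>

lemma ritz_value_le:
  assumes H: "hermitian_mat n H" and S: "pos_def_mat n S"
    and W: "full_col_rank n W" and C: "C \<in> carrier_mat (dim_col W) l" and l: "1 \<le> l"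
    and inj: "\<And>a. a \<in> carrier_vec l \<Longrightarrow> W *\<^sub>v (C *\<^sub>v a) = 0\<^sub>v n \<Longrightarrow> a = 0\<^sub>v l"
    and le: "\<And>a. a \<in> carrier_vec l \<Longrightarrow>
      Re ((H *\<^sub>v (W *\<^sub>v (C *\<^sub>v a))) \<bullet>c (W *\<^sub>v (C *\<^sub>v a)))
        \<le> \<theta> * Re ((S *\<^sub>v (W *\<^sub>v (C *\<^sub>v a))) \<bullet>c (W *\<^sub>v (C *\<^sub>v a)))"
  shows "ritz_value H S W l \<le> \<theta>"
proof -
  note Wc = full_col_rank_imp_injective[OF W]
  have HS: "H \<in> carrier_mat n n" "S \<in> carrier_mat n n"
    using H S by (auto simp: hermitian_mat_def pos_def_mat_def)
  have Ca: "C *\<^sub>v a \<in> carrier_vec (dim_col W)" if "a \<in> carrier_vec l" for a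
    using C that by auto
  show ?thesis
    unfolding ritz_value_def
  proof (rule pair_eig_le[OF hermitian_compress[OF H Wc(1)] pos_def_compress[OF S Wc(1) Wc(2)] C l])
    fix a :: "complex vec" assume a: "a \<in> carrier_vec l"
    show "a = 0\<^sub>v l" if "C *\<^sub>v a = 0\<^sub>v (dim_col W)"
    proof (rule inj[OF a])
      show "W *\<^sub>v (C *\<^sub>v a) = 0\<^sub>v n" unfolding that by (rule mult_mat_vec_zero[OF Wc(1)])
    qed
    show "Re ((compress H W *\<^sub>v (C *\<^sub>v a)) \<bullet>c (C *\<^sub>v a)) \<le> \<theta> * Re ((compress S W *\<^sub>v (C *\<^sub>v a)) \<bullet>c (C *\<^sub>v a))"
      unfolding cprod_compress[OF HS(1) Wc(1) Ca[OF a] Ca[OF a]] cprod_compress[OF HS(2) Wc(1) Ca[OF a] Ca[OF a]]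
      by (rule le[OF a])
  qed auto
qed

lemma ritz_values_sorted:
  assumes H: "hermitian_mat n H" and S: "pos_def_mat n S" and W: "full_col_rank n W"
    and "1 \<le> r" "r \<le> s" "s \<le> dim_col W"
  shows "ritz_value H S W r \<le> ritz_value H S W s"
proof -
  note Wc = full_col_rank_imp_injective[OF W]
  have "sorted (pair_eigenvalues (compress H W) (compress S W))"
    "length (pair_eigenvalues (compress H W) (compress S W)) = dim_col W"
    using pencil_diagonalization_sorted[OF hermitian_compress[OF H Wc(1)] pos_def_compress[OF S Wc(1) Wc(2)]]
    by metis+
  then show ?thesis using assms(4-6) unfolding ritz_value_def pair_eig_def
    by (auto intro!: sorted_nth_mono)
qed

text \<open>Testing the Ritz equation of one column with another column shows that the H-form is
  \<open>\<theta>\<close> times the S-form, so \<open>compress H Z\<close> is diagonal. Ritz vectors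
  of a large space are thus Ritz vectors of their own span with the same values.\<close>

lemma ritz_value_of_ritz_vectors:
  assumes H: "hermitian_mat n H" and S: "pos_def_mat n S" and W: "W \<in> carrier_mat n q"
    and Z: "Z \<in> carrier_mat n k" and SZ: "compress S Z = 1\<^sub>m k"
    and ritz: "\<And>l. l \<in> {1..k} \<Longrightarrow> ritz_vector H S W (\<theta> l) (col Z (l - 1))"
    and mono: "\<And>l l'. 1 \<le> l \<Longrightarrow> l \<le> l' \<Longrightarrow> l' \<le> k \<Longrightarrow> \<theta> l \<le> \<theta> l'"
    and t: "t \<in> {1..k}"
  shows "ritz_value H S Z t = \<theta> t"
proof -
  have HS: "H \<in> carrier_mat n n" "S \<in> carrier_mat n n"
    using H S by (auto simp: hermitian_mat_def pos_def_mat_def)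
  have HZ: "compress H Z = mat_diag k (\<lambda>r. complex_of_real (\<theta> (Suc r)))"
  proof (rule eq_matI)
    fix r s assume "r < dim_row (mat_diag k (\<lambda>r. complex_of_real (\<theta> (Suc r))))"
      "s < dim_col (mat_diag k (\<lambda>r. complex_of_real (\<theta> (Suc r))))"
    then have rs: "r < k" "s < k" by (simp_all add: mat_diag_def)
    obtain g where g: "g \<in> carrier_vec q" "col Z s = W *\<^sub>v g"
      "compress H W *\<^sub>v g = complex_of_real (\<theta> (Suc s)) \<cdot>\<^sub>v (compress S W *\<^sub>v g)"
      using ritz[of "Suc s"] rs W by (auto simp: ritz_vector_def)
    obtain g' where g': "g' \<in> carrier_vec q" "col Z r = W *\<^sub>v g'"
      using ritz[of "Suc r"] rs W by (auto simp: ritz_vector_def)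
    have SWg: "compress S W *\<^sub>v g \<in> carrier_vec q"
      using g(1) HS W by (intro mult_mat_vec_carrier[of _ q q]) auto
    have "compress H Z $$ (r, s) = (compress H W *\<^sub>v g) \<bullet>c g'"
      unfolding compress_index[OF HS(1) Z rs] g(2) g'(2) cprod_compress[OF HS(1) W g(1) g'(1)] ..
    also have "\<dots> = of_real (\<theta> (Suc s)) * ((compress S W *\<^sub>v g) \<bullet>c g')"
      unfolding g(3) by (rule cprod_smult_left[OF SWg g'(1)])
    also have "(compress S W *\<^sub>v g) \<bullet>c g' = compress S Z $$ (r, s)"
      unfolding compress_index[OF HS(2) Z rs] g(2) g'(2) cprod_compress[OF HS(2) W g(1) g'(1)] ..
    finally show "compress H Z $$ (r, s) = mat_diag k (\<lambda>r. complex_of_real (\<theta> (Suc r))) $$ (r, s)"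
      using rs by (auto simp: SZ mat_diag_def)
  qed (use HS Z in \<open>simp_all add: compress_def mat_diag_def\<close>)
  have "pair_eigenvalues (compress H Z) (compress S Z) = sort (map (\<lambda>r. \<theta> (Suc r)) [0..<k])"
    by (rule pair_eigenvalues_diagonalized[of _ k _ "1\<^sub>m k"]) (simp_all add: HZ SZ)
  also have "\<dots> = map (\<lambda>r. \<theta> (Suc r)) [0..<k]"
    by (rule sort_key_id_if_sorted[where f = "\<lambda>x. x", simplified]) (auto simp: sorted_iff_nth_mono intro!: mono)
  finally have "pair_eigenvalues (compress H Z) (compress S Z) = map (\<lambda>r. \<theta> (Suc r)) [0..<k]" .
  moreover obtain r where "t = Suc r" "r < k" using t by (cases t) auto
  ultimately show ?thesis by (simp add: ritz_value_def pair_eig_def)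
qed

section \<open>Coordinates split into the deflated part and its complement\<close>

locale deflated_eigenbasis = pencil_eigenbasis +
  fixes i :: nat and U V :: "complex mat"
  assumes i_range: "i \<in> {1..n}"
    and lam_mono: "1 \<le> l \<Longrightarrow> l \<le> l' \<Longrightarrow> l' \<le> n \<Longrightarrow> lam l \<le> lam l'"
    and U_eq: "U = mat_of_cols n (map u [1..<i])"
    and V_eq: "V = mat_of_cols n (map u [i..<Suc n])"
begin

definition m :: nat where "m = n - i + 1"

lemma m_pos: "0 < m" by (simp add: m_def)

lemma U_carrier [simp]: "U \<in> carrier_mat n (i - 1)"
  unfolding U_eq by (rule carrier_matI) (simp_all)

lemma V_carrier [simp]: "V \<in> carrier_mat n m"
  unfolding V_eq using i_range by (intro carrier_matI) (auto simp: m_def simp del: upt_Suc)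

lemma col_U: "r < i - 1 \<Longrightarrow> col U r = u (Suc r)"
  unfolding U_eq using i_range by (subst col_mat_of_cols) (auto intro!: u_carrier)

lemma col_V: "r < m \<Longrightarrow> col V r = u (i + r)"
  unfolding V_eq m_def using i_range by (subst col_mat_of_cols) (auto intro!: u_carrier simp del: upt_Suc)

lemma V_index: "r < m \<Longrightarrow> i + r \<in> {1..n}"
  using i_range by (auto simp: m_def)

lemma sum_split: "(\<Sum>l\<in>{1..n}. f l) = (\<Sum>l\<in>{1..<i}. f l) + (\<Sum>r<m. f (i + r))"
proof -
  have "{1..n} = {1..<i} \<union> {i..<i + m}" using i_range by (auto simp: m_def)
  then have "(\<Sum>l\<in>{1..n}. f l) = (\<Sum>l\<in>{1..<i}. f l) + (\<Sum>l\<in>{i..<i + m}. f l)"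
    by (simp add: sum.union_disjoint)
  also have "(\<Sum>l\<in>{i..<i + m}. f l) = (\<Sum>r<m. f (i + r))"
    using sum.shift_bounds_nat_ivl[of f 0 i m] by (simp add: lessThan_atLeast0 add.commute)
  finally show ?thesis .
qed

lemma coef_U:
  assumes a: "a \<in> carrier_vec (i - 1)" and l: "l \<in> {1..n}"
  shows "coef (U *\<^sub>v a) l = (if l < i then a $ (l - 1) else 0)"
proof -
  have "coef (U *\<^sub>v a) l = (\<Sum>r<i - 1. a $ r * coef (u (Suc r)) l)"
    unfolding coef_mult_mat_vec[OF U_carrier a l] by (rule sum.cong) (auto simp: col_U)
  also have "\<dots> = (\<Sum>r<i - 1. if r = l - 1 then a $ r else 0)"
  proof (rule sum.cong)
    fix r assume "r \<in> {..<i - 1}"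
    then have "Suc r \<in> {1..n}" using i_range by auto
    moreover have "l = Suc r \<longleftrightarrow> r = l - 1" using l by auto
    ultimately show "a $ r * coef (u (Suc r)) l = (if r = l - 1 then a $ r else 0)"
      using coef_u[OF l, of "Suc r"] by simp
  qed simp
  finally show ?thesis using l by (auto simp: sum.delta)
qed

lemma coef_V:
  assumes c: "c \<in> carrier_vec m" and l: "l \<in> {1..n}"
  shows "coef (V *\<^sub>v c) l = (if l < i then 0 else c $ (l - i))"
proof -
  have "coef (V *\<^sub>v c) l = (\<Sum>r<m. c $ r * coef (u (i + r)) l)"
    unfolding coef_mult_mat_vec[OF V_carrier c l] by (rule sum.cong) (auto simp: col_V)
  also have "\<dots> = (\<Sum>r<m. if r = l - i \<and> i \<le> l then c $ r else 0)"
    using V_index l by (intro sum.cong) (auto simp: coef_u)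
  also have "\<dots> = (if l < i then 0 else c $ (l - i))"
    using l by (cases "i \<le> l") (auto simp: m_def)
  finally show ?thesis .
qed

lemma span_V_iff:
  "x \<in> span_of n (set (cols V)) \<longleftrightarrow> x \<in> carrier_vec n \<and> (\<forall>l\<in>{1..<i}. coef x l = 0)"
proof
  assume "x \<in> span_of n (set (cols V))"
  then obtain a where a: "a \<in> carrier_vec m" "x = V *\<^sub>v a" by (auto simp: span_of_cols[OF V_carrier])
  have "coef x l = 0" if "l \<in> {1..<i}" for l
    using coef_V[OF a(1), of l] that i_range unfolding a(2) by auto
  then show "x \<in> carrier_vec n \<and> (\<forall>l\<in>{1..<i}. coef x l = 0)"
    using a mult_mat_vec_carrier[OF V_carrier] by auto
next
  assume x: "x \<in> carrier_vec n \<and> (\<forall>l\<in>{1..<i}. coef x l = 0)"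
  define a where "a = Matrix.vec m (\<lambda>r. coef x (i + r))"
  have a: "a \<in> carrier_vec m" by (simp add: a_def)
  have "x = V *\<^sub>v a"
  proof (rule coef_eqI)
    show "x \<in> carrier_vec n" using x by simp
    show "V *\<^sub>v a \<in> carrier_vec n" by (rule mult_mat_vec_carrier[OF V_carrier a])
    fix l assume l: "l \<in> {1..n}"
    show "coef x l = coef (V *\<^sub>v a) l"
    proof (cases "l < i")
      case True
      then show ?thesis using coef_V[OF a l] x l by simp
    next
      case False
      then have "l - i < m" "i + (l - i) = l" using l by (auto simp: m_def)
      then show ?thesis using coef_V[OF a l] False by (simp add: a_def)
    qed
  qed
  then show "x \<in> span_of n (set (cols V))" using a by (auto simp: span_of_cols[OF V_carrier])
qed

text \<open>A vector annihilated by the columns of \<open>U\<close> has the form S V c, where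
  \<open>c\<close> holds its products with the columns of \<open>V\<close>. Hence only the effective
  preconditioner is seen by the complement.\<close>

lemma coef_preconditioned:
  assumes K: "K \<in> carrier_mat n n" and w: "w \<in> carrier_vec n"
    and w0: "\<And>l. l \<in> {1..<i} \<Longrightarrow> w \<bullet>c u l = 0" and r: "r < m"
  shows "coef (K *\<^sub>v w) (i + r) = (effective_prec S V K *\<^sub>v Matrix.vec m (\<lambda>r. w \<bullet>c u (i + r))) $ r"
proof -
  define c where "c = Matrix.vec m (\<lambda>r. w \<bullet>c u (i + r))"
  have c: "c \<in> carrier_vec m" by (simp add: c_def)
  have Vc: "V *\<^sub>v c \<in> carrier_vec n" by (rule mult_mat_vec_carrier[OF V_carrier c])
  have adj: "(mat_adjoint G *\<^sub>v w) $ s = w \<bullet>c u (Suc s)" if s: "s < n" for s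
  proof -
    have "(mat_adjoint G *\<^sub>v w) $ s = row (mat_adjoint G) s \<bullet> w" using s by simp
    also have "row (mat_adjoint G) s = conjugate (col G s)"
      using s by (intro eq_vecI) auto
    also have "conjugate (col G s) \<bullet> w = w \<bullet>c col G s"
      using s w by (intro comm_scalar_prod[of _ n]) (auto intro: carrier_vecI)
    finally show ?thesis by (simp add: col_G[OF s])
  qed
  define b where "b = mat_adjoint G *\<^sub>v w"
  have b: "b \<in> carrier_vec n" unfolding b_def by (rule mult_mat_vec_carrier[OF mat_adjoint_carrier[OF G_carrier] w])
  have Gb: "G *\<^sub>v b \<in> carrier_vec n" by (rule mult_mat_vec_carrier[OF G_carrier b])
  have coefG: "coef (G *\<^sub>v b) l = b $ (l - 1)" if l: "l \<in> {1..n}" for l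
  proof -
    have "coef (G *\<^sub>v b) l = (\<Sum>r<n. b $ r * coef (u (Suc r)) l)"
      unfolding coef_mult_mat_vec[OF G_carrier b l] by (rule sum.cong) (auto simp: col_G)
    also have "\<dots> = (\<Sum>r<n. if r = l - 1 then b $ r else 0)"
    proof (rule sum.cong)
      fix r assume "r \<in> {..<n}"
      moreover have "l = Suc r \<longleftrightarrow> r = l - 1" using l by auto
      ultimately show "b $ r * coef (u (Suc r)) l = (if r = l - 1 then b $ r else 0)"
        using coef_u[OF l, of "Suc r"] by simp
    qed simp
    also have "\<dots> = b $ (l - 1)"
    proof -
      have "l - 1 < n" using l by auto
      then show ?thesis by (simp add: sum.delta)
    qed
    finally show ?thesis .
  qed
  \<comment> \<open>\<open>w\<close> plays the role of a residual: its coordinates are the plain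
    products with \<open>u l\<close>, without \<open>S\<close>, and are carried by the basis
    \<open>S * G\<close>.\<close>
  have "w = (S * G * mat_adjoint G) *\<^sub>v w" using S_G_adjoint w by simp
  also have "\<dots> = (S * G) *\<^sub>v b"
    unfolding b_def by (rule assoc_mult_mat_vec[OF mult_carrier_mat[OF S_carrier G_carrier] mat_adjoint_carrier[OF G_carrier] w])
  also have "\<dots> = S *\<^sub>v (G *\<^sub>v b)" by (rule assoc_mult_mat_vec[OF S_carrier G_carrier b])
  also have "G *\<^sub>v b = V *\<^sub>v c"
  proof (rule coef_eqI[OF Gb Vc])
    fix l assume l: "l \<in> {1..n}"
    have "coef (V *\<^sub>v c) l = w \<bullet>c u l"
    proof (cases "l < i")
      case True
      then show ?thesis using coef_V[OF c l] w0[of l] l by simp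
    next
      case False
      then have "l - i < m" "i + (l - i) = l" using l by (auto simp: m_def)
      then show ?thesis using coef_V[OF c l] False by (simp add: c_def)
    qed
    also have "\<dots> = coef (G *\<^sub>v b) l" unfolding coefG[OF l] 
    proof -
      have "l - 1 < n" "Suc (l - 1) = l" using l by auto
      then show "w \<bullet>c u l = b $ (l - 1)" using adj[of "l - 1"] by (simp only: b_def)
    qed
    finally show "coef (G *\<^sub>v b) l = coef (V *\<^sub>v c) l" ..
  qed
  finally have wS: "w = S *\<^sub>v (V *\<^sub>v c)" .
  have aV: "mat_adjoint V \<in> carrier_mat m n" by auto
  have VS: "mat_adjoint V * S \<in> carrier_mat m n" by (rule mult_carrier_mat[OF aV S_carrier])
  have VSK: "mat_adjoint V * S * K \<in> carrier_mat m n" by (rule mult_carrier_mat[OF VS K])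
  have SVc: "S *\<^sub>v (V *\<^sub>v c) \<in> carrier_vec n" by (rule mult_mat_vec_carrier[OF S_carrier Vc])
  have Kw: "K *\<^sub>v w \<in> carrier_vec n" by (rule mult_mat_vec_carrier[OF K w])
  have SKw: "S *\<^sub>v (K *\<^sub>v w) \<in> carrier_vec n" by (rule mult_mat_vec_carrier[OF S_carrier Kw])
  have "effective_prec S V K *\<^sub>v c = (mat_adjoint V * S * K) *\<^sub>v (S *\<^sub>v (V *\<^sub>v c))"
    unfolding effective_prec_def
    by (simp add: assoc_mult_mat_vec[OF mult_carrier_mat[OF VSK S_carrier] V_carrier c]
        assoc_mult_mat_vec[OF VSK S_carrier Vc])
  also have "\<dots> = mat_adjoint V *\<^sub>v (S *\<^sub>v (K *\<^sub>v w))"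
    unfolding wS[symmetric]
    by (simp add: assoc_mult_mat_vec[OF VS K w] assoc_mult_mat_vec[OF aV S_carrier Kw])
  finally have "(effective_prec S V K *\<^sub>v c) $ r = row (mat_adjoint V) r \<bullet> (S *\<^sub>v (K *\<^sub>v w))"
    using r carrier_matD[OF V_carrier] by simp
  also have "row (mat_adjoint V) r = conjugate (col V r)"
    using r carrier_matD[OF V_carrier] by (intro eq_vecI) auto
  also have "conjugate (col V r) \<bullet> (S *\<^sub>v (K *\<^sub>v w)) = (S *\<^sub>v (K *\<^sub>v w)) \<bullet>c col V r"
    using r SKw carrier_matD[OF V_carrier] by (intro comm_scalar_prod[of _ n]) (auto intro: carrier_vecI)
  finally show ?thesis by (simp add: c_def coef_def col_V[OF r])
qed

end

section \<open>The convergence bound\<close>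

context deflated_eigenbasis
begin

text \<open>The bound for an iterate whose relevant Ritz values are already in order. The
  factorizations through \<open>W\<close> express that its range contains the columns of
  \<open>U\<close>, \<open>Z\<close> and of the preconditioned residual. The target \<open>x\<close>
  satisfies the claimed relation with equality; monotonicity of the ratio is applied later.\<close>

lemma ritz_step_core:
  fixes \<theta> :: "nat \<Rightarrow> real"
  assumes Z: "Z \<in> carrier_mat n k" and SZ: "compress S Z = 1\<^sub>m k"
    and HZ: "compress H Z = mat_diag k (\<lambda>r. complex_of_real (\<theta> r))"
    and ZV: "\<And>r. r < k \<Longrightarrow> col Z r \<in> span_of n (set (cols V))"
    and K: "K \<in> carrier_mat n n" and T: "effectively_pos_def S V K"
    and \<nu>: "\<nu> < lam i" and Lnu: "Lnu = mat_diag m (\<lambda>r. complex_of_real (lam (i + r) - \<nu>))"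
    and W: "full_col_rank n W"
    and BU: "BU \<in> carrier_mat (dim_col W) (i - 1)" "U = W * BU"
    and BZ: "BZ \<in> carrier_mat (dim_col W) k" "Z = W * BZ"
    and BP: "BP \<in> carrier_mat (dim_col W) k" "K * residual H S Z = W * BP"
    and t: "1 \<le> t" "t \<le> k" and \<theta>_le: "\<And>r. r < t \<Longrightarrow> \<theta> r \<le> \<theta> (t - 1)"
    and j: "i \<le> j" "j + 1 \<le> n" and \<theta>_j: "lam j < \<theta> (t - 1)" "\<theta> (t - 1) < lam (j + 1)"
    and \<kappa>: "\<kappa> = ((lam j - \<nu>) / (lam (j + 1) - \<nu>)) * ((lam n - lam (j + 1)) / (lam n - lam j))"
    and \<epsilon>: "\<epsilon> = quality_param S V K Lnu"
    and \<sigma>: "\<sigma> = (\<kappa> + \<epsilon> * (2 - \<kappa>)) / ((2 - \<kappa>) + \<epsilon> * \<kappa>)"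
  obtains x where "ritz_value H S W (i - 1 + t) \<le> x" "lam j \<le> x" "x < lam (j + 1)"
    "(x - lam j) / (lam (j + 1) - x) = \<sigma>\<^sup>2 * ((\<theta> (t - 1) - lam j) / (lam (j + 1) - \<theta> (t - 1)))"
proof -
  define \<mu> where "\<mu> r = lam (i + r) - \<nu>" for r
  define E where "E = effective_prec S V K"
  have E: "pos_def_mat m E"
    using T carrier_matD[OF V_carrier] by (simp add: effectively_pos_def_def E_def)
  then have Ec: "E \<in> carrier_mat m m" by (auto simp: pos_def_mat_def hermitian_mat_def)
  have \<mu>_pos: "0 < \<mu> r" if "r < m" for r
    using lam_mono[of i "i + r"] V_index[OF that] i_range \<nu> by (auto simp: \<mu>_def)
  have Lnu\<mu>: "Lnu = mat_diag m (\<lambda>r. complex_of_real (\<mu> r))" by (simp add: Lnu \<mu>_def)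
  have \<epsilon>': "\<epsilon> = (Max (Re ` spectrum (E * Lnu)) - Min (Re ` spectrum (E * Lnu)))
      / (Max (Re ` spectrum (E * Lnu)) + Min (Re ` spectrum (E * Lnu)))"
    by (simp add: \<epsilon> quality_param_def E_def Let_def)
  obtain \<omega> where \<omega>: "0 < \<omega>" and \<epsilon>01: "0 \<le> \<epsilon>" "\<epsilon> < 1"
    and contr: "\<And>q. q \<in> carrier_vec m \<Longrightarrow>
      (\<Sum>r<m. \<mu> r * (cmod (q $ r - of_real \<omega> * (E *\<^sub>v (Lnu *\<^sub>v q)) $ r))\<^sup>2)
        \<le> \<epsilon>\<^sup>2 * (\<Sum>r<m. \<mu> r * (cmod (q $ r))\<^sup>2)"
  proof (rule preconditioner_contraction[OF E \<mu>_pos m_pos Lnu\<mu> refl \<epsilon>'], goal_cases)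
    case (2 \<omega>)
    show ?case by (rule 2(1)) (use 2 in auto)
  qed auto
  define p where "p = lam j - \<nu>"
  define q where "q = lam (j + 1) - \<nu>"
  define \<tau> where "\<tau> = \<theta> (t - 1) - \<nu>"
  have p0: "0 < p" using lam_mono[of i j] i_range j \<nu> by (simp add: p_def)
  have \<tau>: "p < \<tau>" "\<tau> < q" using \<theta>_j by (auto simp: p_def q_def \<tau>_def)
  have qw: "q \<le> lam n - \<nu>" using lam_mono[of "j + 1" n] j by (simp add: q_def)
  have \<kappa>': "\<kappa> = (p / q) * (((lam n - \<nu>) - q) / ((lam n - \<nu>) - p))" by (simp add: \<kappa> p_def q_def)
  have \<mu>_gap: "0 < \<mu> r \<and> (\<mu> r \<le> p \<or> q \<le> \<mu> r) \<and> \<mu> r \<le> lam n - \<nu>" if "r \<in> {..<m}" for r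
  proof -
    have r: "r < m" "i + r \<in> {1..n}" using that V_index by auto
    show ?thesis
      using \<mu>_pos[OF r(1)] lam_mono[of "i + r" j] lam_mono[of "j + 1" "i + r"] lam_mono[of "i + r" n] r j
      by (cases "i + r \<le> j") (auto simp: \<mu>_def p_def q_def)
  qed
  obtain s x where s: "0 < s" "s \<le> 1 / q" and x: "p \<le> x" "x < q" "(x - p) / (q - x) = \<sigma>\<^sup>2 * ((\<tau> - p) / (q - \<tau>))"
    and est: "\<And>f y d :: nat \<Rightarrow> complex.
       (\<Sum>l<m. \<mu> l * (cmod (d l))\<^sup>2) \<le> \<epsilon>\<^sup>2 * (\<Sum>l<m. \<mu> l * (cmod (y l - f l / of_real (\<mu> l)))\<^sup>2) \<Longrightarrow>
       (\<Sum>l<m. \<mu> l * (cmod (y l - f l / of_real (\<mu> l)))\<^sup>2)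
         \<le> (\<Sum>l<m. \<mu> l * (cmod (f l / of_real \<tau> - f l / of_real (\<mu> l)))\<^sup>2) \<Longrightarrow>
       (\<Sum>l<m. (\<mu> l - \<tau>) * (cmod (f l))\<^sup>2) \<le> 0 \<Longrightarrow>
       (\<Sum>l<m. (\<mu> l - x) * (cmod (f l / of_real (\<mu> l) - of_real s * f l + d l))\<^sup>2) \<le> 0"
  proof (rule ritz_step_estimate[of "{..<m}" \<mu> p q "lam n - \<nu>" \<tau> \<epsilon> \<kappa> \<sigma>, OF finite_lessThan \<mu>_gap p0 \<tau> qw \<epsilon>01 \<kappa>' \<sigma>], goal_cases)
    case (2 s x)
    show ?case by (rule 2(1)) (fact 2)+
  qed auto

  define R where "R = residual H S Z"
  define P where "P = K * R"
  define D\<theta> where "D\<theta> = mat_diag k (\<lambda>r. complex_of_real (\<theta> r))"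
  define D\<nu> where "D\<nu> = mat_diag k (\<lambda>r. complex_of_real (\<theta> r - \<nu>))"
  \<comment> \<open>For a combination of Ritz vectors, f carries the factors \<theta> r - \<nu>, so
    y - s f is obtained from y by these diagonal factors.\<close>
  define Ds where "Ds = mat_diag k (\<lambda>r. complex_of_real (1 - s * (\<theta> r - \<nu>)))"
  have D: "D\<theta> \<in> carrier_mat k k" "D\<nu> \<in> carrier_mat k k" "Ds \<in> carrier_mat k k"
    by (simp_all add: D\<theta>_def D\<nu>_def Ds_def)
  have HZc: "H * Z \<in> carrier_mat n k" using mult_carrier_mat[OF H_carrier Z] .
  have SZc: "S * Z \<in> carrier_mat n k" using mult_carrier_mat[OF S_carrier Z] .
  have R_eq: "R = H * Z - S * Z * D\<theta>" by (simp add: R_def residual_def HZ D\<theta>_def)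
  have R: "R \<in> carrier_mat n k" unfolding R_eq by (rule minus_carrier_mat[OF mult_carrier_mat[OF SZc D(1)]])
  have P: "P \<in> carrier_mat n k" unfolding P_def by (rule mult_carrier_mat[OF K R])
  note Wc = full_col_rank_imp_injective(1)[OF W]

  define y where "y h = coef (Z *\<^sub>v h)" for h
  define f where "f h = coef (Z *\<^sub>v (D\<nu> *\<^sub>v h))" for h
  \<comment> \<open>The shift cancels: this is the coordinate of the ordinary residual applied to
    \<open>h\<close>, written with both operators shifted by \<open>\<nu>\<close>.\<close>
  define res where "res h l = of_real (lam l - \<nu>) * y h l - f h l" for h l
  define prc where "prc h l = coef (P *\<^sub>v h) l" for h l
  have Zh: "Z *\<^sub>v h \<in> carrier_vec n" if "h \<in> carrier_vec k" for h
    using mult_mat_vec_carrier[OF Z that] .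
  have Dh: "D\<theta> *\<^sub>v h \<in> carrier_vec k" "D\<nu> *\<^sub>v h \<in> carrier_vec k" "Ds *\<^sub>v h \<in> carrier_vec k"
    if "h \<in> carrier_vec k" for h
    using mult_mat_vec_carrier[OF _ that] D by auto
  have Z_low: "coef (Z *\<^sub>v h) l = 0" if h: "h \<in> carrier_vec k" and l: "l \<in> {1..<i}" for h l
  proof -
    have l': "l \<in> {1..n}" using l i_range by auto
    have "coef (col Z r) l = 0" if "r < k" for r using ZV[OF that] l unfolding span_V_iff by auto
    then show ?thesis unfolding coef_mult_mat_vec[OF Z h l'] by simp
  qed
  have coef_Ds: "coef (Z *\<^sub>v (Ds *\<^sub>v h)) l = y h l - of_real s * f h l"
    if h: "h \<in> carrier_vec k" and l: "l \<in> {1..n}" for h l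
    unfolding y_def f_def coef_mult_mat_vec[OF Z Dh(3)[OF h] l] coef_mult_mat_vec[OF Z h l]
      coef_mult_mat_vec[OF Z Dh(2)[OF h] l] sum_distrib_left sum_subtractf[symmetric]
    by (rule sum.cong) (use h in \<open>auto simp: Ds_def D\<nu>_def mat_diag_mult_vec algebra_simps\<close>)
  have coef_D\<theta>: "coef (Z *\<^sub>v (D\<theta> *\<^sub>v h)) l = f h l + of_real \<nu> * y h l"
    if h: "h \<in> carrier_vec k" and l: "l \<in> {1..n}" for h l
    unfolding y_def f_def coef_mult_mat_vec[OF Z Dh(1)[OF h] l] coef_mult_mat_vec[OF Z h l]
      coef_mult_mat_vec[OF Z Dh(2)[OF h] l] sum_distrib_left sum.distrib[symmetric]
    by (rule sum.cong) (use h in \<open>auto simp: D\<theta>_def D\<nu>_def mat_diag_mult_vec algebra_simps\<close>)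
  have Rh: "R *\<^sub>v h = H *\<^sub>v (Z *\<^sub>v h) - S *\<^sub>v (Z *\<^sub>v (D\<theta> *\<^sub>v h))" if h: "h \<in> carrier_vec k" for h
    unfolding R_eq
    by (simp add: minus_mult_distrib_mat_vec[OF HZc mult_carrier_mat[OF SZc D(1)] h]
        assoc_mult_mat_vec[OF H_carrier Z h] assoc_mult_mat_vec[OF SZc D(1) h]
        assoc_mult_mat_vec[OF S_carrier Z Dh(1)[OF h]])
  have Rc: "R *\<^sub>v h \<in> carrier_vec n" if "h \<in> carrier_vec k" for h
    using mult_mat_vec_carrier[OF R that] .
  have HR: "H *\<^sub>v (Z *\<^sub>v h) = R *\<^sub>v h + S *\<^sub>v (Z *\<^sub>v (D\<theta> *\<^sub>v h))" if h: "h \<in> carrier_vec k" for h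
    unfolding Rh[OF h] using carrier_matD[OF H_carrier] carrier_matD[OF S_carrier] by (intro eq_vecI) auto
  have R_form: "(R *\<^sub>v h) \<bullet>c v = (\<Sum>l\<in>{1..n}. res h l * cnj (coef v l))"
    if h: "h \<in> carrier_vec k" and v: "v \<in> carrier_vec n" for h v
  proof -
    note c2 = mult_mat_vec_carrier[OF S_carrier Zh[OF Dh(1)[OF h]]]
    have "(H *\<^sub>v (Z *\<^sub>v h)) \<bullet>c v = (R *\<^sub>v h) \<bullet>c v + (S *\<^sub>v (Z *\<^sub>v (D\<theta> *\<^sub>v h))) \<bullet>c v"
      unfolding HR[OF h] by (rule cprod_add_left[OF Rc[OF h] c2 v])
    then have "(R *\<^sub>v h) \<bullet>c v = (\<Sum>l\<in>{1..n}. of_real (lam l) * (y h l * cnj (coef v l)))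
       - (\<Sum>l\<in>{1..n}. coef (Z *\<^sub>v (D\<theta> *\<^sub>v h)) l * cnj (coef v l))"
      by (simp add: H_form[OF Zh[OF h] v] S_form[OF Zh[OF Dh(1)[OF h]] v] y_def)
    also have "\<dots> = (\<Sum>l\<in>{1..n}. res h l * cnj (coef v l))"
      unfolding sum_subtractf[symmetric]
      by (rule sum.cong) (auto simp: coef_D\<theta>[OF h] res_def algebra_simps)
    finally show ?thesis .
  qed
  have R_u: "(R *\<^sub>v h) \<bullet>c u l = res h l" if h: "h \<in> carrier_vec k" and l: "l \<in> {1..n}" for h l
  proof -
    have "(R *\<^sub>v h) \<bullet>c u l = (\<Sum>l'\<in>{1..n}. if l' = l then res h l' else 0)"
      unfolding R_form[OF h u_carrier[OF l]] using l by (intro sum.cong) (auto simp: coef_u)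
    then show ?thesis using l by simp
  qed
  have res_low: "res h l = 0" if "h \<in> carrier_vec k" "l \<in> {1..<i}" for h l
    using Z_low[OF that] Z_low[OF Dh(2)[OF that(1)] that(2)] by (simp add: res_def y_def f_def)
  have Z_sum: "(\<Sum>l\<in>{1..n}. g l * cnj (coef (Z *\<^sub>v b) l)) = (\<Sum>r<m. g (i + r) * cnj (coef (Z *\<^sub>v b) (i + r)))"
    if "b \<in> carrier_vec k" for g b
    unfolding sum_split using Z_low[OF that] by simp
  \<comment> \<open>The Galerkin condition: on the columns of \<open>Z\<close> both forms are
    diagonal, so \<open>H *\<^sub>v (Z *\<^sub>v h)\<close> and
    \<open>S *\<^sub>v (Z *\<^sub>v (D\<theta> *\<^sub>v h))\<close> have the same products with the
    range of \<open>Z\<close>.\<close>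
  have res_orth: "(\<Sum>r<m. res h (i + r) * cnj (coef (Z *\<^sub>v b) (i + r))) = 0"
    if h: "h \<in> carrier_vec k" and b: "b \<in> carrier_vec k" for h b
  proof -
    have "(R *\<^sub>v h) \<bullet>c (Z *\<^sub>v b) = (H *\<^sub>v (Z *\<^sub>v h)) \<bullet>c (Z *\<^sub>v b) - (S *\<^sub>v (Z *\<^sub>v (D\<theta> *\<^sub>v h))) \<bullet>c (Z *\<^sub>v b)"
      unfolding HR[OF h]
      using cprod_add_left[OF Rc[OF h] mult_mat_vec_carrier[OF S_carrier Zh[OF Dh(1)[OF h]]] Zh[OF b]] by simp
    also have "\<dots> = 0"
      unfolding cprod_compress[OF H_carrier Z h b, symmetric] cprod_compress[OF S_carrier Z Dh(1)[OF h] b, symmetric]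
        HZ SZ D\<theta>_def[symmetric] using Dh(1)[OF h] by simp
    finally show ?thesis unfolding R_form[OF h Zh[OF b]] Z_sum[OF b] .
  qed
  have prc_eq: "prc h (i + r) = (E *\<^sub>v Matrix.vec m (\<lambda>r. res h (i + r))) $ r"
    if h: "h \<in> carrier_vec k" and r: "r < m" for h r
  proof -
    have "P *\<^sub>v h = K *\<^sub>v (R *\<^sub>v h)" unfolding P_def by (rule assoc_mult_mat_vec[OF K R h])
    moreover have "(R *\<^sub>v h) \<bullet>c u l = 0" if "l \<in> {1..<i}" for l
      using that i_range R_u[OF h, of l] res_low[OF h that] by auto
    moreover have "Matrix.vec m (\<lambda>r. (R *\<^sub>v h) \<bullet>c u (i + r)) = Matrix.vec m (\<lambda>r. res h (i + r))"
      using R_u[OF h] V_index by (intro eq_vecI) auto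
    ultimately show ?thesis
      using coef_preconditioned[OF K Rc[OF h] _ r] by (simp add: prc_def E_def)
  qed

  \<comment> \<open>The trial vector belonging to \<open>h\<close>. In coordinate
    \<open>i + r\<close> it equals f/\<mu> - s f + d, where d is what remains of y - f/\<mu> after
    one preconditioned correction; this is the form required by \<open>est\<close>.\<close>
  define X where "X h = Z *\<^sub>v (Ds *\<^sub>v h) - of_real \<omega> \<cdot>\<^sub>v (P *\<^sub>v h)" for h
  have Ph: "P *\<^sub>v h \<in> carrier_vec n" if "h \<in> carrier_vec k" for h
    using mult_mat_vec_carrier[OF P that] .
  have X: "X h \<in> carrier_vec n" if h: "h \<in> carrier_vec k" for h
    unfolding X_def using Zh[OF Dh(3)[OF h]] Ph[OF h] by auto
  have coef_X: "coef (X h) l = y h l - of_real s * f h l - of_real \<omega> * prc h l"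
    if h: "h \<in> carrier_vec k" and l: "l \<in> {1..n}" for h l
    unfolding X_def using Zh[OF Dh(3)[OF h]] Ph[OF h]
    by (simp add: coef_minus[OF _ _ l] coef_smult[OF _ l] coef_Ds[OF h l] prc_def)

  \<comment> \<open>Combinations of the first \<open>t\<close> columns; indices start at 0, so the
    column \<open>t - 1\<close> carries the old Ritz value number \<open>t\<close>.\<close>
  define low where "low h \<longleftrightarrow> h \<in> carrier_vec k \<and> (\<forall>r. t \<le> r \<longrightarrow> r < k \<longrightarrow> h $ r = 0)" for h :: "complex vec"
  have X_form: "(\<Sum>r<m. (\<mu> r - x) * (cmod (coef (X h) (i + r)))\<^sup>2) \<le> 0" if "low h" for h
  proof -
    have h: "h \<in> carrier_vec k" using that by (simp add: low_def)
    define y' where "y' r = y h (i + r)" for r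
    define f' where "f' r = f h (i + r)" for r
    define qv where "qv = Matrix.vec m (\<lambda>r. y' r - f' r / of_real (\<mu> r))"
    define d where "d r = qv $ r - of_real \<omega> * prc h (i + r)" for r
    have qv: "qv \<in> carrier_vec m" by (simp add: qv_def)
    have qr: "of_real (\<mu> r) * (y' r - f' r / of_real (\<mu> r)) = res h (i + r)" if "r < m" for r
    proof -
      have "res h (i + r) = of_real (\<mu> r) * y' r - f' r"
        by (simp add: res_def \<mu>_def y'_def f'_def)
      moreover have "\<mu> r \<noteq> 0" using \<mu>_pos[OF that] by simp
      ultimately show ?thesis by (simp add: right_diff_distrib)
    qed
    have "Lnu *\<^sub>v qv = Matrix.vec m (\<lambda>r. res h (i + r))"
      unfolding Lnu\<mu> mat_diag_mult_vec[OF qv] using qr by (intro eq_vecI) (auto simp: qv_def)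
    then have prc: "prc h (i + r) = (E *\<^sub>v (Lnu *\<^sub>v qv)) $ r" if "r < m" for r
      using prc_eq[OF h that] by simp
    have "(\<Sum>r<m. (\<mu> r - x) * (cmod (f' r / of_real (\<mu> r) - of_real s * f' r + d r))\<^sup>2) \<le> 0"
    proof (rule est[where y = y'])
      have "(\<Sum>r<m. \<mu> r * (cmod (d r))\<^sup>2) = (\<Sum>r<m. \<mu> r * (cmod (qv $ r - of_real \<omega> * (E *\<^sub>v (Lnu *\<^sub>v qv)) $ r))\<^sup>2)"
        by (rule sum.cong) (auto simp: d_def prc)
      also have "\<dots> \<le> \<epsilon>\<^sup>2 * (\<Sum>r<m. \<mu> r * (cmod (qv $ r))\<^sup>2)" by (rule contr[OF qv])
      also have "(\<Sum>r<m. \<mu> r * (cmod (qv $ r))\<^sup>2) = (\<Sum>r<m. \<mu> r * (cmod (y' r - f' r / of_real (\<mu> r)))\<^sup>2)"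
        by (rule sum.cong) (auto simp: qv_def)
      finally show "(\<Sum>r<m. \<mu> r * (cmod (d r))\<^sup>2) \<le> \<epsilon>\<^sup>2 * (\<Sum>r<m. \<mu> r * (cmod (y' r - f' r / of_real (\<mu> r)))\<^sup>2)" .
    next
      \<comment> \<open>\<open>Z *\<^sub>v b\<close> is f/\<tau> - y, a vector in the range of
        \<open>Z\<close>. By \<open>res_orth\<close> the mixed term vanishes, so Pythagoras in the
        energy norm gives the comparison.\<close>
      define b where "b = of_real (1 / \<tau>) \<cdot>\<^sub>v (D\<nu> *\<^sub>v h) - h"
      have b: "b \<in> carrier_vec k" using Dh(2)[OF h] h by (auto simp: b_def)
      have cb: "coef (Z *\<^sub>v b) (i + r) = f' r / of_real \<tau> - y' r" if "r < m" for r
      proof -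
        have "Z *\<^sub>v b = of_real (1 / \<tau>) \<cdot>\<^sub>v (Z *\<^sub>v (D\<nu> *\<^sub>v h)) - Z *\<^sub>v h"
          unfolding b_def using Dh(2)[OF h] h Z
          by (simp add: mult_minus_distrib_mat_vec[of _ n k] mult_mat_vec[of _ n k])
        then show ?thesis
          using V_index[OF that] Zh[OF h] Zh[OF Dh(2)[OF h]]
          by (simp add: coef_minus coef_smult f'_def y'_def f_def y_def)
      qed
      have "(\<Sum>r<m. \<mu> r * (cmod (y' r - f' r / of_real (\<mu> r)))\<^sup>2)
          + 2 * Re (\<Sum>r<m. res h (i + r) * cnj (coef (Z *\<^sub>v b) (i + r)))
          + (\<Sum>r<m. \<mu> r * (cmod (coef (Z *\<^sub>v b) (i + r)))\<^sup>2)
        = (\<Sum>r<m. \<mu> r * (cmod (f' r / of_real \<tau> - f' r / of_real (\<mu> r)))\<^sup>2)"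
        unfolding Re_sum sum_distrib_left sum.distrib[symmetric]
      proof (rule sum.cong)
        fix r assume "r \<in> {..<m}"
        then have r: "r < m" by simp
        define A where "A = y' r - f' r / of_real (\<mu> r)"
        define B where "B = coef (Z *\<^sub>v b) (i + r)"
        have AB: "f' r / of_real \<tau> - f' r / of_real (\<mu> r) = A + B" using cb[OF r] by (simp add: A_def B_def)
        have "(cmod (A + B))\<^sup>2 = (cmod A)\<^sup>2 + 2 * Re (A * cnj B) + (cmod B)\<^sup>2"
          unfolding cmod_power2 by (simp add: power2_eq_square algebra_simps)
        moreover have "res h (i + r) = of_real (\<mu> r) * A" using qr[OF r] by (simp add: A_def)
        ultimately show "\<mu> r * (cmod (y' r - f' r / of_real (\<mu> r)))\<^sup>2
          + 2 * Re (res h (i + r) * cnj (coef (Z *\<^sub>v b) (i + r)))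
          + \<mu> r * (cmod (coef (Z *\<^sub>v b) (i + r)))\<^sup>2
          = \<mu> r * (cmod (f' r / of_real \<tau> - f' r / of_real (\<mu> r)))\<^sup>2"
          unfolding AB A_def[symmetric] B_def[symmetric] by (simp add: algebra_simps)
      qed simp
      moreover have "0 \<le> (\<Sum>r<m. \<mu> r * (cmod (coef (Z *\<^sub>v b) (i + r)))\<^sup>2)"
        by (intro sum_nonneg mult_nonneg_nonneg) (auto intro: less_imp_le[OF \<mu>_pos])
      ultimately show "(\<Sum>r<m. \<mu> r * (cmod (y' r - f' r / of_real (\<mu> r)))\<^sup>2)
         \<le> (\<Sum>r<m. \<mu> r * (cmod (f' r / of_real \<tau> - f' r / of_real (\<mu> r)))\<^sup>2)"
        unfolding res_orth[OF h b] by simp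
    next
      \<comment> \<open>Multiplication by the diagonal \<open>D\<nu>\<close> keeps the support in
        the first \<open>t\<close> entries, so f is again a combination of Ritz vectors with values
        at most \<open>\<theta> (t - 1)\<close>.\<close>
      define g where "g = D\<nu> *\<^sub>v h"
      have g: "g \<in> carrier_vec k" unfolding g_def by (rule Dh(2)[OF h])
      have "complex_of_real (\<Sum>r<m. (\<mu> r - \<tau>) * (cmod (f' r))\<^sup>2)
        = (H *\<^sub>v (Z *\<^sub>v g)) \<bullet>c (Z *\<^sub>v g) - of_real (\<theta> (t - 1)) * ((S *\<^sub>v (Z *\<^sub>v g)) \<bullet>c (Z *\<^sub>v g))"
        unfolding H_form[OF Zh[OF g] Zh[OF g]] S_form[OF Zh[OF g] Zh[OF g]] mult.assoc[symmetric] Z_sum[OF g]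
          sum_distrib_left sum_subtractf[symmetric] of_real_sum
        by (rule sum.cong) (auto simp: f'_def f_def g_def \<mu>_def \<tau>_def complex_norm_square algebra_simps simp del: of_real_power)
      also have "\<dots> = complex_of_real (\<Sum>r<k. (\<theta> r - \<theta> (t - 1)) * (cmod (g $ r))\<^sup>2)"
        unfolding cprod_compress[OF H_carrier Z g g, symmetric] cprod_compress[OF S_carrier Z g g, symmetric] HZ SZ
          mat_diag_mult_vec[OF g] using g
        by (simp add: cprod_sum[of _ k] sum_distrib_left sum_subtractf[symmetric] complex_norm_square algebra_simps del: of_real_power)
      finally have "(\<Sum>r<m. (\<mu> r - \<tau>) * (cmod (f' r))\<^sup>2) = (\<Sum>r<k. (\<theta> r - \<theta> (t - 1)) * (cmod (g $ r))\<^sup>2)"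
        by (simp only: of_real_eq_iff)
      also have "\<dots> \<le> 0"
      proof (rule sum_nonpos)
        fix r assume r: "r \<in> {..<k}"
        show "(\<theta> r - \<theta> (t - 1)) * (cmod (g $ r))\<^sup>2 \<le> 0"
        proof (cases "r < t")
          case True
          then show ?thesis using \<theta>_le[of r] by (intro mult_nonpos_nonneg) auto
        next
          case False
          then have "g $ r = 0" using that r unfolding g_def D\<nu>_def mat_diag_mult_vec[OF h] by (auto simp: low_def)
          then show ?thesis by simp
        qed
      qed
      finally show "(\<Sum>r<m. (\<mu> r - \<tau>) * (cmod (f' r))\<^sup>2) \<le> 0" .
    qed
    also have "(\<Sum>r<m. (\<mu> r - x) * (cmod (f' r / of_real (\<mu> r) - of_real s * f' r + d r))\<^sup>2)
      = (\<Sum>r<m. (\<mu> r - x) * (cmod (coef (X h) (i + r)))\<^sup>2)"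
    proof (rule sum.cong)
      fix r assume "r \<in> {..<m}"
      then have r: "r < m" by simp
      have "f' r / of_real (\<mu> r) - of_real s * f' r + d r = coef (X h) (i + r)"
        unfolding coef_X[OF h V_index[OF r]] d_def using r by (simp add: qv_def y'_def f'_def)
      then show "(\<mu> r - x) * (cmod (f' r / of_real (\<mu> r) - of_real s * f' r + d r))\<^sup>2
          = (\<mu> r - x) * (cmod (coef (X h) (i + r)))\<^sup>2" by simp
    qed simp
    finally show ?thesis .
  qed
  \<comment> \<open>If the trial vector vanishes on the complement, its preconditioned part lies in
    the range of \<open>Z\<close> and is orthogonal to the residual. Positivity of \<open>E\<close>
    then makes the residual zero, hence also the preconditioned part, so
    \<open>Z *\<^sub>v (Ds *\<^sub>v h)\<close> and finally \<open>h\<close> are zero.\<close>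
  have X_inj: "h = 0\<^sub>v k" if h': "low h" and X0: "\<And>r. r < m \<Longrightarrow> coef (X h) (i + r) = 0" for h
  proof -
    have h: "h \<in> carrier_vec k" using h' by (simp add: low_def)
    define rv where "rv = Matrix.vec m (\<lambda>r. res h (i + r))"
    have rv: "rv \<in> carrier_vec m" by (simp add: rv_def)
    have prc_X: "of_real \<omega> * prc h (i + r) = coef (Z *\<^sub>v (Ds *\<^sub>v h)) (i + r)" if "r < m" for r
      using X0[OF that] coef_X[OF h V_index[OF that]] coef_Ds[OF h V_index[OF that]] by simp
    have "of_real \<omega> * ((E *\<^sub>v rv) \<bullet>c rv) = cnj (\<Sum>r<m. res h (i + r) * cnj (of_real \<omega> * prc h (i + r)))"
      using rv Ec by (simp add: cprod_sum[of _ m] rv_def prc_eq[OF h] sum_distrib_left mult_ac)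
    also have "(\<Sum>r<m. res h (i + r) * cnj (of_real \<omega> * prc h (i + r))) = 0"
      using res_orth[OF h Dh(3)[OF h]] by (simp add: prc_X)
    finally have "(E *\<^sub>v rv) \<bullet>c rv = 0" using \<omega> by simp
    then have "rv = 0\<^sub>v m" using E rv by (force simp: pos_def_mat_def)
    then have res0: "res h (i + r) = 0" if "r < m" for r using that by (metis index_vec index_zero_vec(1) rv_def)
    have "E *\<^sub>v rv = 0\<^sub>v m" unfolding \<open>rv = 0\<^sub>v m\<close> by (rule mult_mat_vec_zero[OF Ec])
    then have prc0: "prc h (i + r) = 0" if "r < m" for r using prc_eq[OF h that] that by (simp add: rv_def)
    have "Z *\<^sub>v (Ds *\<^sub>v h) = 0\<^sub>v n"
    proof (rule coef_eqI[OF Zh[OF Dh(3)[OF h]] zero_carrier_vec])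
      fix l assume l: "l \<in> {1..n}"
      show "coef (Z *\<^sub>v (Ds *\<^sub>v h)) l = coef (0\<^sub>v n) l"
      proof (cases "l < i")
        case True
        then show ?thesis using Z_low[OF Dh(3)[OF h], of l] l by (simp add: coef_zero)
      next
        case False
        then have "l - i < m" "i + (l - i) = l" using l by (auto simp: m_def)
        then show ?thesis using prc_X[of "l - i"] prc0[of "l - i"] l by (simp add: coef_zero)
      qed
    qed
    moreover have "Ds *\<^sub>v h = mat_adjoint Z *\<^sub>v (S *\<^sub>v (Z *\<^sub>v (Ds *\<^sub>v h)))"
    proof -
      have aZ: "mat_adjoint Z \<in> carrier_mat k n" using Z by auto
      have "Ds *\<^sub>v h = compress S Z *\<^sub>v (Ds *\<^sub>v h)" unfolding SZ using Dh(3)[OF h] by simp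
      then show ?thesis
        unfolding compress_def assoc_mult_mat_vec[OF mult_carrier_mat[OF aZ S_carrier] Z Dh(3)[OF h]]
          assoc_mult_mat_vec[OF aZ S_carrier Zh[OF Dh(3)[OF h]]] .
    qed
    ultimately have Ds0: "Ds *\<^sub>v h = 0\<^sub>v k"
      using mult_mat_vec_zero[OF S_carrier] mult_mat_vec_zero[of "mat_adjoint Z" k n] Z by auto
    show ?thesis
    proof (rule eq_vecI)
      fix r assume "r < dim_vec (0\<^sub>v k :: complex vec)"
      then have r: "r < k" by simp
      show "h $ r = 0\<^sub>v k $ r"
      proof (cases "r < t")
        case True
        \<comment> \<open>The bound \<open>s \<le> 1 / q\<close> enters here: since
          \<open>\<tau> < q\<close>, none of the first \<open>t\<close> diagonal entries of
          \<open>Ds\<close> vanishes.\<close>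
        have "s * (\<theta> r - \<nu>) \<le> s * \<tau>" using \<theta>_le[OF True] s by (intro mult_left_mono) (auto simp: \<tau>_def)
        also have "\<dots> < s * q" using \<tau> s by (intro mult_strict_left_mono) auto
        also have "\<dots> \<le> 1" using s p0 \<tau> by (simp add: field_simps)
        finally have "1 - s * (\<theta> r - \<nu>) \<noteq> 0" by simp
        moreover have "of_real (1 - s * (\<theta> r - \<nu>)) * h $ r = 0"
          using arg_cong[OF Ds0, of "\<lambda>v. v $ r"] r unfolding Ds_def mat_diag_mult_vec[OF h] by simp
        ultimately have "h $ r = 0" by (metis mult_eq_0_iff of_real_eq_0_iff)
        then show ?thesis using r by simp
      next
        case False
        then show ?thesis using h' r by (auto simp: low_def)
      qed
    qed (use h in auto)
  qed

  define J where "J = Matrix.mat k t (\<lambda>(r, c). if r = c then 1 else 0 :: complex)"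
  have J: "J \<in> carrier_mat k t" by (simp add: J_def)
  have Jg: "(J *\<^sub>v g) $ r = (if r < t then g $ r else 0)" if g: "g \<in> carrier_vec t" and r: "r < k" for g r
  proof -
    have "(J *\<^sub>v g) $ r = (\<Sum>c<t. if c = r then g $ c else 0)"
      unfolding mult_mat_vec_index[OF J g r] by (rule sum.cong) (use r in \<open>auto simp: J_def\<close>)
    then show ?thesis by auto
  qed
  have J_low: "low (J *\<^sub>v g)" if g: "g \<in> carrier_vec t" for g
    unfolding low_def using Jg[OF g] mult_mat_vec_carrier[OF J g] by auto
  define C1 where "C1 = (BZ * Ds - of_real \<omega> \<cdot>\<^sub>m BP) * J"
  have BZDs: "BZ * Ds \<in> carrier_mat (dim_col W) k" by (rule mult_carrier_mat[OF BZ(1) D(3)])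
  have wBP: "of_real \<omega> \<cdot>\<^sub>m BP \<in> carrier_mat (dim_col W) k" using BP(1) by simp
  have C0: "BZ * Ds - of_real \<omega> \<cdot>\<^sub>m BP \<in> carrier_mat (dim_col W) k" by (rule minus_carrier_mat[OF wBP])
  have C1: "C1 \<in> carrier_mat (dim_col W) t" unfolding C1_def by (rule mult_carrier_mat[OF C0 J])
  have WC1: "W *\<^sub>v (C1 *\<^sub>v g) = X (J *\<^sub>v g)" if g: "g \<in> carrier_vec t" for g
  proof -
    define h where "h = J *\<^sub>v g"
    have h: "h \<in> carrier_vec k" unfolding h_def by (rule mult_mat_vec_carrier[OF J g])
    have "C1 *\<^sub>v g = (BZ * Ds - of_real \<omega> \<cdot>\<^sub>m BP) *\<^sub>v h"
      unfolding C1_def h_def by (rule assoc_mult_mat_vec[OF C0 J g])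
    also have "\<dots> = (BZ * Ds) *\<^sub>v h - (of_real \<omega> \<cdot>\<^sub>m BP) *\<^sub>v h"
      by (rule minus_mult_distrib_mat_vec[OF BZDs wBP h])
    also have "(BZ * Ds) *\<^sub>v h = BZ *\<^sub>v (Ds *\<^sub>v h)" by (rule assoc_mult_mat_vec[OF BZ(1) D(3) h])
    also have "(of_real \<omega> \<cdot>\<^sub>m BP) *\<^sub>v h = of_real \<omega> \<cdot>\<^sub>v (BP *\<^sub>v h)"
      using BP(1) h by (intro eq_vecI) (auto simp: scalar_prod_def sum_distrib_left mult.assoc)
    finally have e: "C1 *\<^sub>v g = BZ *\<^sub>v (Ds *\<^sub>v h) - of_real \<omega> \<cdot>\<^sub>v (BP *\<^sub>v h)" .
    have c1: "BZ *\<^sub>v (Ds *\<^sub>v h) \<in> carrier_vec (dim_col W)" by (rule mult_mat_vec_carrier[OF BZ(1) Dh(3)[OF h]])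
    have c2: "BP *\<^sub>v h \<in> carrier_vec (dim_col W)" by (rule mult_mat_vec_carrier[OF BP(1) h])
    have "W *\<^sub>v (C1 *\<^sub>v g) = W *\<^sub>v (BZ *\<^sub>v (Ds *\<^sub>v h)) - of_real \<omega> \<cdot>\<^sub>v (W *\<^sub>v (BP *\<^sub>v h))"
      unfolding e mult_minus_distrib_mat_vec[OF Wc c1 smult_carrier_vec[THEN iffD2, OF c2]] mult_mat_vec[OF Wc c2] ..
    also have "W *\<^sub>v (BZ *\<^sub>v (Ds *\<^sub>v h)) = Z *\<^sub>v (Ds *\<^sub>v h)"
      unfolding BZ(2) by (rule assoc_mult_mat_vec[OF Wc BZ(1) Dh(3)[OF h], symmetric])
    also have "W *\<^sub>v (BP *\<^sub>v h) = P *\<^sub>v h"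
      unfolding P_def R_def BP(2) by (rule assoc_mult_mat_vec[OF Wc BP(1) h, symmetric])
    finally show ?thesis by (simp add: X_def h_def)
  qed
  \<comment> \<open>All \<open>i - 1 + t\<close> trial vectors together. They are independent:
    columns of \<open>U\<close> have no coordinates from \<open>i\<close> on, where
    \<open>X_inj\<close> applies, and the lower coordinates then determine the combination of
    \<open>U\<close>.\<close>
  define C where "C = hcat BU C1"
  have C: "C \<in> carrier_mat (dim_col W) (i - 1 + t)" unfolding C_def by (rule hcat_carrier[OF BU(1) C1])
  have WC: "W *\<^sub>v (C *\<^sub>v a) = U *\<^sub>v vec_first a (i - 1) + X (J *\<^sub>v vec_last a t)"
    if a: "a \<in> carrier_vec (i - 1 + t)" for a
    unfolding C_def hcat_mult_vec[OF BU(1) C1 a]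
      mult_add_distrib_mat_vec[OF Wc mult_mat_vec_carrier[OF BU(1) vec_first_carrier] mult_mat_vec_carrier[OF C1 vec_last_carrier]]
      WC1[OF vec_last_carrier] BU(2) assoc_mult_mat_vec[OF Wc BU(1) vec_first_carrier] ..
  have "ritz_value H S W (i - 1 + t) \<le> x + \<nu>"
  proof (rule ritz_value_le[OF H_hermitian S_pos_def W C])
    show "1 \<le> i - 1 + t" using t by simp
    fix a :: "complex vec" assume a: "a \<in> carrier_vec (i - 1 + t)"
    define h where "h = J *\<^sub>v vec_last a t"
    have lh: "low h" unfolding h_def by (rule J_low[OF vec_last_carrier])
    then have h: "h \<in> carrier_vec k" by (simp add: low_def)
    define v where "v = W *\<^sub>v (C *\<^sub>v a)"
    have v_eq: "v = U *\<^sub>v vec_first a (i - 1) + X h" unfolding v_def WC[OF a] h_def ..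
    have Ua: "U *\<^sub>v vec_first a (i - 1) \<in> carrier_vec n" by (rule mult_mat_vec_carrier[OF U_carrier vec_first_carrier])
    have v: "v \<in> carrier_vec n" unfolding v_eq using Ua X[OF h] by simp
    have cv: "coef v l = coef (U *\<^sub>v vec_first a (i - 1)) l + coef (X h) l" if "l \<in> {1..n}" for l
      unfolding v_eq by (rule coef_add[OF Ua X[OF h] that])
    have cvV: "coef v (i + r) = coef (X h) (i + r)" if "r < m" for r
      unfolding cv[OF V_index[OF that]] using coef_U[OF vec_first_carrier V_index[OF that], of a] by simp
    show "a = 0\<^sub>v (i - 1 + t)" if "W *\<^sub>v (C *\<^sub>v a) = 0\<^sub>v n"
    proof -
      have v0: "coef v l = 0" if "l \<in> {1..n}" for l
        using \<open>W *\<^sub>v (C *\<^sub>v a) = 0\<^sub>v n\<close> that by (simp add: v_def coef_zero)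
      have "h = 0\<^sub>v k" by (rule X_inj[OF lh]) (metis cvV v0 V_index)
      then have last: "vec_last a t $ r = 0" if "r < t" for r
        using Jg[OF vec_last_carrier, of r a] that t unfolding h_def by simp
      have "X h = 0\<^sub>v n"
        unfolding X_def \<open>h = 0\<^sub>v k\<close> using mult_mat_vec_zero[OF D(3)] mult_mat_vec_zero[OF Z] mult_mat_vec_zero[OF P]
        by (intro eq_vecI) auto
      have first: "vec_first a (i - 1) $ r = 0" if "r < i - 1" for r
      proof -
        have l: "Suc r \<in> {1..n}" "Suc r < i" using that i_range by auto
        then show ?thesis
          using cv[OF l(1)] v0[OF l(1)] coef_U[OF vec_first_carrier l(1), of a] \<open>X h = 0\<^sub>v n\<close> by (simp add: coef_zero)
      qed
      show ?thesis
      proof (rule eq_vecI)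
        fix r assume "r < dim_vec (0\<^sub>v (i - 1 + t) :: complex vec)"
        then show "a $ r = 0\<^sub>v (i - 1 + t) $ r"
          using first[of r] last[of "r - (i - 1)"] a by (cases "r < i - 1") (auto simp: vec_first_def vec_last_def)
      qed (use a in auto)
    qed
    have "(\<Sum>l\<in>{1..n}. (lam l - (x + \<nu>)) * (cmod (coef v l))\<^sup>2) \<le> 0"
    proof -
      have "(\<Sum>l\<in>{1..<i}. (lam l - (x + \<nu>)) * (cmod (coef v l))\<^sup>2) \<le> 0"
      proof (intro sum_nonpos mult_nonpos_nonneg)
        fix l assume "l \<in> {1..<i}"
        then show "lam l - (x + \<nu>) \<le> 0" using lam_mono[of l j] j x(1) by (auto simp: p_def)
      qed auto
      moreover have "(\<Sum>r<m. (lam (i + r) - (x + \<nu>)) * (cmod (coef v (i + r)))\<^sup>2) \<le> 0"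
      proof -
        have "(\<Sum>r<m. (lam (i + r) - (x + \<nu>)) * (cmod (coef v (i + r)))\<^sup>2)
            = (\<Sum>r<m. (\<mu> r - x) * (cmod (coef (X h) (i + r)))\<^sup>2)"
        proof (rule sum.cong)
          fix r assume "r \<in> {..<m}"
          then have "coef v (i + r) = coef (X h) (i + r)" by (simp add: cvV)
          moreover have "lam (i + r) - (x + \<nu>) = \<mu> r - x" by (simp add: \<mu>_def)
          ultimately show "(lam (i + r) - (x + \<nu>)) * (cmod (coef v (i + r)))\<^sup>2
              = (\<mu> r - x) * (cmod (coef (X h) (i + r)))\<^sup>2" by (simp only:)
        qed simp
        then show ?thesis using X_form[OF lh] by simp
      qed
      ultimately show ?thesis unfolding sum_split by simp
    qed
    moreover have "Re ((H *\<^sub>v v) \<bullet>c v) = (\<Sum>l\<in>{1..n}. lam l * (cmod (coef v l))\<^sup>2)"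
      unfolding H_form[OF v v] Re_sum by (rule sum.cong) (auto simp: complex_norm_square[symmetric] simp flip: of_real_mult)
    moreover have "Re ((S *\<^sub>v v) \<bullet>c v) = (\<Sum>l\<in>{1..n}. (cmod (coef v l))\<^sup>2)"
      unfolding S_form[OF v v] Re_sum by (rule sum.cong) (auto simp: complex_norm_square[symmetric])
    ultimately show "Re ((H *\<^sub>v (W *\<^sub>v (C *\<^sub>v a))) \<bullet>c (W *\<^sub>v (C *\<^sub>v a)))
        \<le> (x + \<nu>) * Re ((S *\<^sub>v (W *\<^sub>v (C *\<^sub>v a))) \<bullet>c (W *\<^sub>v (C *\<^sub>v a)))"
      unfolding v_def[symmetric] by (simp add: left_diff_distrib sum_subtractf sum_distrib_left)
  qed
  then show ?thesis
    by (rule that) (use x in \<open>simp_all add: p_def q_def \<tau>_def algebra_simps\<close>)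
qed

end

section \<open>From ordered columns to an arbitrary iterate\<close>

lemma gap_ratio_mono:
  fixes r x p q :: real
  assumes "r \<le> x" "x < q" "p < q"
  shows "(r - p) / (q - r) \<le> (x - p) / (q - x)"
proof -
  have "(r - p) * (q - x) - (x - p) * (q - r) = - ((x - r) * (q - p))" by (simp add: algebra_simps)
  also have "\<dots> \<le> 0" using assms by simp
  finally show ?thesis
    using assms by (subst frac_le_eq) (auto intro!: divide_nonpos_pos)
qed

context deflated_eigenbasis
begin

text \<open>With \<Theta> = \<open>compress H Z\<close>, unitarity gives
  \<open>X * compress \<Theta> X = \<Theta> * X\<close>. This permits replacing an iterate by
  another orthonormal basis of the same subspace.\<close>

lemma residual_mult_unitary:
  assumes Z: "Z \<in> carrier_mat n k" and X: "X \<in> carrier_mat k k" and XX: "X * mat_adjoint X = 1\<^sub>m k"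
  shows "residual H S (Z * X) = residual H S Z * X"
proof -
  define \<Theta> where "\<Theta> = compress H Z"
  have \<Theta>: "\<Theta> \<in> carrier_mat k k" unfolding \<Theta>_def by (rule compress_carrier[OF H_carrier Z])
  have aX: "mat_adjoint X \<in> carrier_mat k k" using X by auto
  have HZ: "H * Z \<in> carrier_mat n k" and SZ: "S * Z \<in> carrier_mat n k"
    by (rule mult_carrier_mat[OF H_carrier Z] mult_carrier_mat[OF S_carrier Z])+
  have \<Theta>X: "\<Theta> * X \<in> carrier_mat k k" by (rule mult_carrier_mat[OF \<Theta> X])
  have "X * (mat_adjoint X * \<Theta> * X) = X * (mat_adjoint X * (\<Theta> * X))"
    by (simp only: assoc_mult_mat[OF aX \<Theta> X])
  also have "\<dots> = (X * mat_adjoint X) * (\<Theta> * X)" by (rule assoc_mult_mat[OF X aX \<Theta>X, symmetric])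
  also have "\<dots> = \<Theta> * X" unfolding XX using left_mult_one_mat[OF \<Theta>X] .
  finally have 1: "X * compress \<Theta> X = \<Theta> * X" by (simp add: compress_def)
  have "residual H S (Z * X) = H * (Z * X) - S * (Z * X) * compress \<Theta> X"
    unfolding residual_def \<Theta>_def compress_compress[OF H_carrier Z X] ..
  also have "S * (Z * X) * compress \<Theta> X = S * Z * \<Theta> * X"
  proof -
    have "S * (Z * X) * compress \<Theta> X = (S * Z) * X * compress \<Theta> X"
      by (simp only: assoc_mult_mat[OF S_carrier Z X])
    also have "\<dots> = (S * Z) * (X * compress \<Theta> X)"
      by (rule assoc_mult_mat[OF SZ X compress_carrier[OF \<Theta> X]])
    also have "\<dots> = S * Z * \<Theta> * X" unfolding 1 by (rule assoc_mult_mat[OF SZ \<Theta> X, symmetric])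
    finally show ?thesis .
  qed
  also have "H * (Z * X) = H * Z * X" by (rule assoc_mult_mat[OF H_carrier Z X, symmetric])
  also have "H * Z * X - S * Z * \<Theta> * X = residual H S Z * X"
    unfolding residual_def \<Theta>_def[symmetric]
    by (rule minus_mult_distrib_mat[OF HZ mult_carrier_mat[OF SZ \<Theta>] X, symmetric])
  finally show ?thesis .
qed

text \<open>The columns of an iterate may carry their Ritz values in any order. A unitary
  \<open>X\<close> sorts them; the iterate and the preconditioned residual are multiplied by the
  same \<open>X\<close>, so both remain in the range of \<open>W\<close>.\<close>

lemma ritz_step_estimate_bpsd:
  assumes K: "hermitian_mat n K" and T: "effectively_pos_def S V K"
    and it: "bpsd_iterate n H S k Z" and rank: "full_col_rank n Z"
    and ZV: "set (cols Z) \<subseteq> span_of n (set (cols V))"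
    and step: "bpsd_id_step n H S U k K Z Z'"
    and t: "t \<in> {1..k}" and j: "i - 1 + t \<le> j" "j + 1 \<le> n"
    and \<theta>_j: "ritz_value H S Z t \<in> {lam j <..< lam (j + 1)}"
    and \<nu>: "\<nu> < lam i" and Lnu: "Lnu = mat_diag (n - i + 1) (\<lambda>r. complex_of_real (lam (i + r) - \<nu>))"
    and \<kappa>: "\<kappa> = ((lam j - \<nu>) / (lam (j + 1) - \<nu>)) * ((lam n - lam (j + 1)) / (lam n - lam j))"
    and \<epsilon>: "\<epsilon> = quality_param S V K Lnu"
  shows "ritz_value H S Z' t < lam (j + 1)"
    and "(ritz_value H S Z' t - lam j) / (lam (j + 1) - ritz_value H S Z' t)
      \<le> ((\<kappa> + \<epsilon> * (2 - \<kappa>)) / ((2 - \<kappa>) + \<epsilon> * \<kappa>))\<^sup>2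
         * ((ritz_value H S Z t - lam j) / (lam (j + 1) - ritz_value H S Z t))"
proof -
  have Z: "Z \<in> carrier_mat n k" and SZ: "compress S Z = 1\<^sub>m k" using it by (auto simp: bpsd_iterate_def)
  have Kc: "K \<in> carrier_mat n n" using K by (simp add: hermitian_mat_def)
  have dZ: "dim_col Z = k" using Z by simp
  have Zinj: "\<And>a. a \<in> carrier_vec k \<Longrightarrow> Z *\<^sub>v a = 0\<^sub>v n \<Longrightarrow> a = 0\<^sub>v k"
    using full_col_rank_imp_injective(2)[OF rank] unfolding dZ .
  obtain X where X: "X \<in> carrier_mat k k" and XS: "compress (compress S Z) X = 1\<^sub>m k"
    and XH: "compress (compress H Z) X = mat_diag k (\<lambda>r. complex_of_real (pair_eig (compress H Z) (compress S Z) (Suc r)))"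
    and so: "sorted (pair_eigenvalues (compress H Z) (compress S Z))"
      "length (pair_eigenvalues (compress H Z) (compress S Z)) = k"
    using pencil_diagonalization_sorted[OF hermitian_compress[OF H_hermitian Z] pos_def_compress[OF S_pos_def Z Zinj]] .
  define \<theta> where "\<theta> r = ritz_value H S Z (Suc r)" for r
  have \<theta>_t: "\<theta> (t - 1) = ritz_value H S Z t" using t by (simp add: \<theta>_def)
  have \<theta>_le: "\<theta> r \<le> \<theta> (t - 1)" if "r < t" for r
    using so that t unfolding \<theta>_def ritz_value_def pair_eig_def by (auto intro!: sorted_nth_mono)
  have "mat_adjoint X * X = 1\<^sub>m k"
    using XS unfolding SZ compress_def[of "1\<^sub>m k"] right_mult_one_mat[OF mat_adjoint_carrier[OF X]] .
  then have XX: "X * mat_adjoint X = 1\<^sub>m k" using mat_mult_left_right_inverse[of "mat_adjoint X" k X] X by auto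
  define P where "P = K * residual H S Z"
  have R: "residual H S Z \<in> carrier_mat n k"
    unfolding residual_def
    by (rule minus_carrier_mat[OF mult_carrier_mat[OF mult_carrier_mat[OF S_carrier Z] compress_carrier[OF H_carrier Z]]])
  have P: "P \<in> carrier_mat n k" unfolding P_def by (rule mult_carrier_mat[OF Kc R])
  have dU: "dim_col U = i - 1" using carrier_matD[OF U_carrier] by simp
  obtain W where W: "full_col_rank n W"
    and span: "span_of n (set (cols W)) = span_of n (set (cols U) \<union> set (cols Z) \<union> set (cols P))"
    and Z': "Z' \<in> carrier_mat n k" and SZ': "compress S Z' = 1\<^sub>m k"
    and ritz: "\<And>l. l \<in> {1..k} \<Longrightarrow> ritz_vector H S W (ritz_value H S W (i - 1 + l)) (col Z' (l - 1))"
    using step unfolding bpsd_id_step_def Let_def P_def[symmetric] dU by blast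
  note Wc = full_col_rank_imp_injective(1)[OF W]
  have sub: "set (cols U) \<union> set (cols Z) \<union> set (cols P) \<subseteq> carrier_vec n"
    using cols_dim[of U] cols_dim[of Z] cols_dim[of P] carrier_matD[OF U_carrier] Z P by auto
  have colmem: "col M r \<in> set (cols M)" if "M \<in> carrier_mat n l" "r < l" for M :: "complex mat" and l r
    using that by (auto simp: cols_def)
  have inW: "x \<in> span_of n (set (cols W))" if "x \<in> set (cols U) \<union> set (cols Z) \<union> set (cols P)" for x
    unfolding span by (rule span_of_mem[OF sub that])
  obtain BU where BU: "BU \<in> carrier_mat (dim_col W) (i - 1)" "U = W * BU"
    using factor_through_span[OF Wc U_carrier inW] colmem[OF U_carrier] by blast
  obtain BZ where BZ: "BZ \<in> carrier_mat (dim_col W) k" "Z = W * BZ"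
    using factor_through_span[OF Wc Z inW] colmem[OF Z] by blast
  obtain BP where BP: "BP \<in> carrier_mat (dim_col W) k" "P = W * BP"
    using factor_through_span[OF Wc P inW] colmem[OF P] by blast
  have V_sub: "set (cols V) \<subseteq> carrier_vec n" using cols_dim[of V] carrier_matD[OF V_carrier] by auto
  have Zv_V: "Z *\<^sub>v a \<in> span_of n (set (cols V))" if "a \<in> carrier_vec k" for a
  proof -
    have "Z *\<^sub>v a \<in> span_of n (set (cols Z))" unfolding span_of_cols[OF Z] using that by blast
    then show ?thesis using span_of_mono[OF V_sub ZV] by blast
  qed
  \<comment> \<open>Guarantees that the Ritz values numbered up to \<open>i - 1 + k\<close> exist,
    so that their order can be used. A smaller dimension would produce a linear dependence between
    the columns of \<open>U\<close> and \<open>Z\<close>, which are independent.\<close>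
  have dimW: "i - 1 + k \<le> dim_col W"
  proof (rule ccontr)
    assume "\<not> i - 1 + k \<le> dim_col W"
    then obtain a where a: "a \<in> carrier_vec (i - 1 + k)" "a \<noteq> 0\<^sub>v (i - 1 + k)"
      "hcat BU BZ *\<^sub>v a = 0\<^sub>v (dim_col W)"
      using wide_matrix_kernel[OF hcat_carrier[OF BU(1) BZ(1)]] by (metis not_le)
    define v where "v = Z *\<^sub>v vec_last a k"
    have v: "v \<in> carrier_vec n" unfolding v_def by (rule mult_mat_vec_carrier[OF Z vec_last_carrier])
    have Ua: "U *\<^sub>v vec_first a (i - 1) \<in> carrier_vec n" by (rule mult_mat_vec_carrier[OF U_carrier vec_first_carrier])
    have "W *\<^sub>v (hcat BU BZ *\<^sub>v a) = U *\<^sub>v vec_first a (i - 1) + v"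
      unfolding hcat_mult_vec[OF BU(1) BZ(1) a(1)] v_def
        mult_add_distrib_mat_vec[OF Wc mult_mat_vec_carrier[OF BU(1) vec_first_carrier] mult_mat_vec_carrier[OF BZ(1) vec_last_carrier]]
        BU(2) BZ(2) assoc_mult_mat_vec[OF Wc BU(1) vec_first_carrier] assoc_mult_mat_vec[OF Wc BZ(1) vec_last_carrier] ..
    then have 0: "U *\<^sub>v vec_first a (i - 1) + v = 0\<^sub>v n"
      unfolding a(3) mult_mat_vec_zero[OF Wc] ..
    have v_low: "coef v l = 0" if "l \<in> {1..<i}" for l
      using Zv_V[OF vec_last_carrier, of a] that unfolding span_V_iff v_def by auto
    have c0: "(if l < i then vec_first a (i - 1) $ (l - 1) else 0) + coef v l = 0" if "l \<in> {1..n}" for l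
      using coef_add[OF Ua v that] coef_U[OF vec_first_carrier that, of a] coef_zero[OF that] unfolding 0 by simp
    have first: "vec_first a (i - 1) $ r = 0" if "r < i - 1" for r
    proof -
      have l: "Suc r \<in> {1..n}" "Suc r < i" using that i_range by auto
      then show ?thesis using c0[OF l(1)] v_low[of "Suc r"] by simp
    qed
    have "v = 0\<^sub>v n"
    proof (rule coef_eqI[OF v zero_carrier_vec])
      fix l assume l: "l \<in> {1..n}"
      show "coef v l = coef (0\<^sub>v n) l"
        using c0[OF l] v_low[of l] l by (cases "l < i") (auto simp: coef_zero)
    qed
    then have "vec_last a k = 0\<^sub>v k" using Zinj[OF vec_last_carrier] by (simp add: v_def)
    then have last: "vec_last a k $ r = 0" if "r < k" for r using that by simp
    have "a = 0\<^sub>v (i - 1 + k)"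
    proof (rule eq_vecI)
      fix r assume "r < dim_vec (0\<^sub>v (i - 1 + k) :: complex vec)"
      then show "a $ r = 0\<^sub>v (i - 1 + k) $ r"
        using first[of r] last[of "r - (i - 1)"] a(1) by (cases "r < i - 1") (auto simp: vec_first_def vec_last_def)
    qed (use a in auto)
    then show False using a by simp
  qed
  define ZX where "ZX = Z * X"
  have ZX: "ZX \<in> carrier_mat n k" unfolding ZX_def by (rule mult_carrier_mat[OF Z X])
  have \<theta>_j': "lam j < \<theta> (t - 1)" "\<theta> (t - 1) < lam (j + 1)" using \<theta>_j \<theta>_t by auto
  obtain x where x: "ritz_value H S W (i - 1 + t) \<le> x" "x < lam (j + 1)"
    "(x - lam j) / (lam (j + 1) - x) = ((\<kappa> + \<epsilon> * (2 - \<kappa>)) / ((2 - \<kappa>) + \<epsilon> * \<kappa>))\<^sup>2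
        * ((\<theta> (t - 1) - lam j) / (lam (j + 1) - \<theta> (t - 1)))"
  proof (rule ritz_step_core[of ZX k \<theta> K \<nu> Lnu W BU "BZ * X" "BP * X" t j \<kappa> \<epsilon> _, OF ZX _ _ _ Kc T \<nu> _ W BU _ _ _ _ _ _ \<theta>_le _ _ _ _ \<kappa> \<epsilon> refl])
    show "compress S ZX = 1\<^sub>m k" unfolding ZX_def compress_compress[OF S_carrier Z X, symmetric] by (rule XS)
    show "compress H ZX = mat_diag k (\<lambda>r. complex_of_real (\<theta> r))"
      unfolding ZX_def compress_compress[OF H_carrier Z X, symmetric] \<theta>_def ritz_value_def by (rule XH)
    show "col ZX r \<in> span_of n (set (cols V))" if "r < k" for r
      unfolding ZX_def col_mult_mat_vec[OF Z X that] by (rule Zv_V) (use X in auto)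
    show "Lnu = mat_diag m (\<lambda>r. complex_of_real (lam (i + r) - \<nu>))" using Lnu by (simp add: m_def)
    show "BZ * X \<in> carrier_mat (dim_col W) k" by (rule mult_carrier_mat[OF BZ(1) X])
    show "ZX = W * (BZ * X)" unfolding ZX_def BZ(2) by (rule assoc_mult_mat[OF Wc BZ(1) X])
    show "BP * X \<in> carrier_mat (dim_col W) k" by (rule mult_carrier_mat[OF BP(1) X])
    have "K * residual H S ZX = P * X"
      unfolding ZX_def residual_mult_unitary[OF Z X XX] P_def by (rule assoc_mult_mat[OF Kc R X, symmetric])
    also have "\<dots> = W * (BP * X)" unfolding BP(2) by (rule assoc_mult_mat[OF Wc BP(1) X])
    finally show "K * residual H S ZX = W * (BP * X)" .
  qed (use t j \<theta>_j' i_range in auto)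
  have Z't: "ritz_value H S Z' t = ritz_value H S W (i - 1 + t)"
    by (rule ritz_value_of_ritz_vectors[OF H_hermitian S_pos_def Wc Z' SZ' ritz _ t])
      (use dimW in \<open>auto intro!: ritz_values_sorted[OF H_hermitian S_pos_def W]\<close>)
  show "ritz_value H S Z' t < lam (j + 1)" using x Z't by simp
  \<comment> \<open>The comparison of ratios asks for no lower bound of the new Ritz value, which
    may lie below \<open>lam j\<close>.\<close>
  have "(ritz_value H S Z' t - lam j) / (lam (j + 1) - ritz_value H S Z' t) \<le> (x - lam j) / (lam (j + 1) - x)"
    using x Z't \<theta>_j by (intro gap_ratio_mono) auto
  then show "(ritz_value H S Z' t - lam j) / (lam (j + 1) - ritz_value H S Z' t)
      \<le> ((\<kappa> + \<epsilon> * (2 - \<kappa>)) / ((2 - \<kappa>) + \<epsilon> * \<kappa>))\<^sup>2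
         * ((ritz_value H S Z t - lam j) / (lam (j + 1) - ritz_value H S Z t))"
    unfolding x(3) \<theta>_t .
qed

end

section \<open>Sharpness\<close>

context pencil_eigenbasis
begin

text \<open>For S-unit vectors this is the Rayleigh quotient.\<close>

definition rho :: "complex vec \<Rightarrow> real" where
  "rho v = Re ((H *\<^sub>v v) \<bullet>c v)"

text \<open>A list form of an S-orthonormal basis of Ritz vectors of its span: with the list sorted
  by \<open>rho\<close>, Ritz values and vectors can be read off by position. Distinctness lets
  orthogonality be stated on the set.\<close>

definition ritz_system :: "complex vec list \<Rightarrow> bool" where
  "ritz_system xs \<longleftrightarrow> distinct xs \<and> set xs \<subseteq> carrier_vec n \<and>
     (\<forall>x\<in>set xs. (S *\<^sub>v x) \<bullet>c x = 1) \<and>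
     (\<forall>x\<in>set xs. \<forall>y\<in>set xs. x \<noteq> y \<longrightarrow> (S *\<^sub>v x) \<bullet>c y = 0 \<and> (H *\<^sub>v x) \<bullet>c y = 0)"

lemma ritz_systemD:
  assumes "ritz_system xs"
  shows "distinct xs" "set xs \<subseteq> carrier_vec n" "x \<in> set xs \<Longrightarrow> (S *\<^sub>v x) \<bullet>c x = 1"
    "x \<in> set xs \<Longrightarrow> y \<in> set xs \<Longrightarrow> x \<noteq> y \<Longrightarrow> (S *\<^sub>v x) \<bullet>c y = 0"
    "x \<in> set xs \<Longrightarrow> y \<in> set xs \<Longrightarrow> x \<noteq> y \<Longrightarrow> (H *\<^sub>v x) \<bullet>c y = 0"
  using assms unfolding ritz_system_def by simp_all

lemma ritz_system_subset:
  assumes xs: "ritz_system xs" and ys: "distinct ys" "set ys \<subseteq> set xs"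
  shows "ritz_system ys"
  unfolding ritz_system_def
proof (intro conjI ballI impI)
  show "distinct ys" by fact
  show "set ys \<subseteq> carrier_vec n" using ys(2) ritz_systemD(2)[OF xs] by (rule order_trans)
  fix x assume x: "x \<in> set ys"
  show "(S *\<^sub>v x) \<bullet>c x = 1" by (rule ritz_systemD(3)[OF xs subsetD[OF ys(2) x]])
  fix y assume y: "y \<in> set ys" "x \<noteq> y"
  show "(S *\<^sub>v x) \<bullet>c y = 0" "(H *\<^sub>v x) \<bullet>c y = 0"
    by (rule ritz_systemD(4,5)[OF xs subsetD[OF ys(2) x] subsetD[OF ys(2) y(1)] y(2)])+
qed

lemma rho_eq: "v \<in> carrier_vec n \<Longrightarrow> (H *\<^sub>v v) \<bullet>c v = of_real (rho v)"
  using arg_cong[OF hermitian_cprod[OF H_hermitian, of v v], of Im] by (simp add: rho_def complex_eq_iff)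

lemma col_mat_of_cols_nth:
  "set xs \<subseteq> carrier_vec n \<Longrightarrow> r < length xs \<Longrightarrow> col (mat_of_cols n xs) r = xs ! r"
  by (rule col_mat_of_cols) auto

lemma mat_of_cols_carrier_length [simp]: "mat_of_cols n xs \<in> carrier_mat n (length xs)"
  by simp

lemma ritz_system_compress:
  assumes xs: "ritz_system xs"
  shows "compress S (mat_of_cols n xs) = 1\<^sub>m (length xs)"
    and "compress H (mat_of_cols n xs) = mat_diag (length xs) (\<lambda>r. complex_of_real (rho (xs ! r)))"
proof -
  let ?M = "mat_of_cols n xs"
  have M: "?M \<in> carrier_mat n (length xs)" by simp
  have c: "set xs \<subseteq> carrier_vec n" and d: "distinct xs" using xs by (auto simp: ritz_system_def)
  have e: "xs ! r \<in> set xs" if "r < length xs" for r using that by simp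
  have ne: "xs ! s = xs ! r \<longleftrightarrow> s = r" if "r < length xs" "s < length xs" for r s
    by (rule nth_eq_iff_index_eq[OF d that(2,1)])
  show "compress S ?M = 1\<^sub>m (length xs)"
  proof (rule eq_matI)
    fix r s assume "r < dim_row (1\<^sub>m (length xs) :: complex mat)" "s < dim_col (1\<^sub>m (length xs) :: complex mat)"
    then have rs: "r < length xs" "s < length xs" by simp_all
    show "compress S ?M $$ (r, s) = 1\<^sub>m (length xs) $$ (r, s)"
      unfolding compress_index[OF S_carrier M rs] col_mat_of_cols_nth[OF c rs(1)] col_mat_of_cols_nth[OF c rs(2)]
    proof (cases "s = r")
      case True
      then show "(S *\<^sub>v xs ! s) \<bullet>c xs ! r = 1\<^sub>m (length xs) $$ (r, s)"
        using ritz_systemD(3)[OF xs e[OF rs(1)]] rs by simp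
    next
      case False
      then show "(S *\<^sub>v xs ! s) \<bullet>c xs ! r = 1\<^sub>m (length xs) $$ (r, s)"
        using ritz_systemD(4)[OF xs e[OF rs(2)] e[OF rs(1)]] ne[OF rs] rs by simp
    qed
  qed (simp_all add: compress_def)
  show "compress H ?M = mat_diag (length xs) (\<lambda>r. complex_of_real (rho (xs ! r)))"
  proof (rule eq_matI)
    fix r s assume "r < dim_row (mat_diag (length xs) (\<lambda>r. complex_of_real (rho (xs ! r))))"
      "s < dim_col (mat_diag (length xs) (\<lambda>r. complex_of_real (rho (xs ! r))))"
    then have rs: "r < length xs" "s < length xs" by (simp_all add: mat_diag_def)
    show "compress H ?M $$ (r, s) = mat_diag (length xs) (\<lambda>r. complex_of_real (rho (xs ! r))) $$ (r, s)"
    proof (cases "r = s")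
      case True
      then show ?thesis
        unfolding compress_index[OF H_carrier M rs] col_mat_of_cols_nth[OF c rs(1)] col_mat_of_cols_nth[OF c rs(2)]
        using rho_eq[OF subsetD[OF c e[OF rs(1)]]] rs by (simp add: mat_diag_def)
    next
      case False
      then show ?thesis
        unfolding compress_index[OF H_carrier M rs] col_mat_of_cols_nth[OF c rs(1)] col_mat_of_cols_nth[OF c rs(2)]
        using ritz_systemD(5)[OF xs e[OF rs(2)] e[OF rs(1)]] ne[OF rs] rs by (simp add: mat_diag_def)
    qed
  qed (simp_all add: compress_def mat_diag_def)
qed

lemma orthonormal_imp_full_col_rank:
  assumes M: "M \<in> carrier_mat n k" and SM: "compress S M = 1\<^sub>m k"
  shows "full_col_rank n M"
proof (rule full_col_rankI[OF M])
  fix a :: "complex vec" assume a: "a \<in> carrier_vec k" "M *\<^sub>v a = 0\<^sub>v n"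
  have "a \<bullet>c a = (compress S M *\<^sub>v a) \<bullet>c a" unfolding SM using a by simp
  also have "\<dots> = (S *\<^sub>v 0\<^sub>v n) \<bullet>c 0\<^sub>v n"
    unfolding cprod_compress[OF S_carrier M a(1) a(1)] a(2) ..
  also have "\<dots> = 0" by (subst cprod_sum[of _ n]) auto
  finally show "a = 0\<^sub>v k" using a conjugate_square_eq_0_vec[OF a(1)] by simp
qed

lemma ritz_system_sorted:
  assumes xs: "ritz_system xs" and so: "sorted (map rho xs)" and l: "l \<in> {1..length xs}"
  shows "ritz_value H S (mat_of_cols n xs) l = rho (xs ! (l - 1))"
    and "ritz_vector H S (mat_of_cols n xs) (rho (xs ! (l - 1))) (xs ! (l - 1))"
proof -
  let ?M = "mat_of_cols n xs" and ?q = "length xs"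
  have M: "?M \<in> carrier_mat n ?q" by simp
  have c: "set xs \<subseteq> carrier_vec n" using xs by (auto simp: ritz_system_def)
  note comp = ritz_system_compress[OF xs]
  have "pair_eigenvalues (compress H ?M) (compress S ?M) = sort (map (\<lambda>r. rho (xs ! r)) [0..<?q])"
    by (rule pair_eigenvalues_diagonalized[of _ ?q _ "1\<^sub>m ?q"]) (simp_all add: comp)
  also have "map (\<lambda>r. rho (xs ! r)) [0..<?q] = map rho xs"
    by (rule nth_equalityI) auto
  also have "sort (map rho xs) = map rho xs" using so by (simp add: sorted_sort_id)
  finally have pe: "pair_eigenvalues (compress H ?M) (compress S ?M) = map rho xs" .
  obtain r where r: "l = Suc r" "r < ?q" using l by (cases l) auto
  show "ritz_value H S ?M l = rho (xs ! (l - 1))"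
    unfolding ritz_value_def pair_eig_def pe using r by simp
  have "?M *\<^sub>v unit_vec ?q r = xs ! r"
    unfolding mult_unit_vec_col[OF M r(2)] by (rule col_mat_of_cols_nth[OF c r(2)])
  moreover have "compress H ?M *\<^sub>v unit_vec ?q r = of_real (rho (xs ! r)) \<cdot>\<^sub>v (compress S ?M *\<^sub>v unit_vec ?q r)"
    unfolding comp mat_diag_mult_vec[OF unit_vec_carrier]
    using one_mult_mat_vec[OF unit_vec_carrier[of ?q r]] by (intro eq_vecI) (auto simp: unit_vec_def)
  moreover have "unit_vec ?q r \<noteq> (0\<^sub>v ?q :: complex vec)" using r by simp
  ultimately show "ritz_vector H S ?M (rho (xs ! (l - 1))) (xs ! (l - 1))"
    unfolding ritz_vector_def using r by (intro bexI[of _ "unit_vec ?q r"]) auto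
qed

lemma disjoint_support_orthogonal:
  assumes x: "x \<in> carrier_vec n" and y: "y \<in> carrier_vec n"
    and "\<And>l. l \<in> {1..n} \<Longrightarrow> coef x l = 0 \<or> coef y l = 0"
  shows "(S *\<^sub>v x) \<bullet>c y = 0" "(H *\<^sub>v x) \<bullet>c y = 0"
proof -
  have 0: "\<forall>l\<in>{1..n}. coef x l * cnj (coef y l) = 0" using assms(3) by simp
  show "(S *\<^sub>v x) \<bullet>c y = 0" unfolding S_form[OF x y] by (rule sum.neutral[OF 0])
  show "(H *\<^sub>v x) \<bullet>c y = 0" unfolding H_form[OF x y] using 0 by (intro sum.neutral) simp
qed

lemma rho_u: "l \<in> {1..n} \<Longrightarrow> rho (u l) = lam l"
  unfolding rho_def coef_H[OF u_carrier] by (simp add: coef_u)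

lemma u_inj: "inj_on u {1..n}"
proof (rule inj_onI)
  fix l k assume lk: "l \<in> {1..n}" "k \<in> {1..n}" "u l = u k"
  show "l = k" using u_orthonormal[OF lk(1,1)] u_orthonormal[OF lk(1,2)] lk(3) by (simp split: if_splits)
qed

text \<open>Vectors without common eigencoordinates are orthogonal for both forms, so exact
  eigenvectors can be used as padding.\<close>

lemma ritz_system_u_append:
  assumes L: "distinct L" "set L \<subseteq> {1..n}"
    and xs: "ritz_system xs" and supp: "\<And>x l. x \<in> set xs \<Longrightarrow> l \<in> set L \<Longrightarrow> coef x l = 0"
  shows "ritz_system (map u L @ xs)"
proof -
  have uc: "x \<in> carrier_vec n" if "x \<in> u ` set L" for x using that L u_carrier by auto
  have xc: "x \<in> carrier_vec n" if "x \<in> set xs" for x using that ritz_systemD(2)[OF xs] by blast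
  have ux: "(S *\<^sub>v x) \<bullet>c y = 0 \<and> (H *\<^sub>v x) \<bullet>c y = 0 \<and> (S *\<^sub>v y) \<bullet>c x = 0 \<and> (H *\<^sub>v y) \<bullet>c x = 0"
    if xy: "x \<in> u ` set L" "y \<in> set xs" for x y
  proof -
    obtain l where l: "l \<in> set L" "x = u l" using xy(1) by blast
    have l': "l \<in> {1..n}" using l L by auto
    have "coef x k = 0 \<or> coef y k = 0" if "k \<in> {1..n}" for k
      using coef_u[OF that l'] supp[OF xy(2) l(1)] l by (cases "k = l") auto
    then show ?thesis
      using disjoint_support_orthogonal[OF uc[OF xy(1)] xc[OF xy(2)]]
        disjoint_support_orthogonal[OF xc[OF xy(2)] uc[OF xy(1)]] by blast
  qed
  have uu: "(S *\<^sub>v x) \<bullet>c y = 0 \<and> (H *\<^sub>v x) \<bullet>c y = 0" if xy: "x \<in> u ` set L" "y \<in> u ` set L" "x \<noteq> y" for x y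
  proof -
    obtain l k where lk: "l \<in> set L" "k \<in> set L" "x = u l" "y = u k" using xy(1,2) by auto
    then have l: "l \<in> {1..n}" "k \<in> {1..n}" "l \<noteq> k" using L(2) xy(3) by auto
    have "coef x r = 0 \<or> coef y r = 0" if "r \<in> {1..n}" for r
      using coef_u[OF that l(1)] coef_u[OF that l(2)] l(3) lk by auto
    then show ?thesis
      using disjoint_support_orthogonal[OF uc[OF xy(1)] uc[OF xy(2)]] by blast
  qed
  have u1: "(S *\<^sub>v x) \<bullet>c x = 1" if "x \<in> u ` set L" for x using that L u_orthonormal by auto
  have disj: "u ` set L \<inter> set xs = {}"
  proof (rule ccontr)
    assume "u ` set L \<inter> set xs \<noteq> {}"
    then obtain x where "x \<in> u ` set L" "x \<in> set xs" by auto
    then show False using ux u1 by fastforce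
  qed
  show ?thesis
    unfolding ritz_system_def
  proof (intro conjI ballI impI)
    show "distinct (map u L @ xs)"
      using L(1) ritz_systemD(1)[OF xs] disj inj_on_subset[OF u_inj L(2)] by (simp add: distinct_map)
    show "set (map u L @ xs) \<subseteq> carrier_vec n" using uc xc by auto
    fix x assume "x \<in> set (map u L @ xs)"
    then have x: "x \<in> u ` set L \<or> x \<in> set xs" by auto
    then show "(S *\<^sub>v x) \<bullet>c x = 1" using u1 ritz_systemD(3)[OF xs] by blast
    fix y assume "y \<in> set (map u L @ xs)" and xy: "x \<noteq> y"
    then have y: "y \<in> u ` set L \<or> y \<in> set xs" by auto
    have "(S *\<^sub>v x) \<bullet>c y = 0 \<and> (H *\<^sub>v x) \<bullet>c y = 0"
    proof (cases "x \<in> u ` set L")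
      case True
      then show ?thesis using y ux[of x y] uu[of x y] xy by auto
    next
      case False
      then have "x \<in> set xs" using x by simp
      then show ?thesis using y ux[of y x] ritz_systemD(4,5)[OF xs] xy by blast
    qed
    then show "(S *\<^sub>v x) \<bullet>c y = 0" "(H *\<^sub>v x) \<bullet>c y = 0" by auto
  qed
qed

text \<open>Rayleigh-Ritz in a plane. The coefficients are returned in both directions:
  \<open>v\<close> and \<open>w\<close> in terms of \<open>x\<close> and \<open>y\<close> for the
  estimate of the smaller Ritz value, and conversely for the equality of spans and for comparing
  \<open>rho v\<close> with \<open>rho x\<close>.\<close>

lemma two_dimensional_ritz:
  assumes x: "x \<in> carrier_vec n" and y: "y \<in> carrier_vec n"
    and indep: "\<And>a b. a \<cdot>\<^sub>v x + b \<cdot>\<^sub>v y = 0\<^sub>v n \<Longrightarrow> a = 0 \<and> b = 0"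
  obtains v w a b c d a' b' c' d' where "ritz_system [v, w]" "rho v \<le> rho w"
    "v = a \<cdot>\<^sub>v x + b \<cdot>\<^sub>v y" "w = c \<cdot>\<^sub>v x + d \<cdot>\<^sub>v y" "x = a' \<cdot>\<^sub>v v + b' \<cdot>\<^sub>v w" "y = c' \<cdot>\<^sub>v v + d' \<cdot>\<^sub>v w"
proof -
  define M where "M = mat_of_cols n [x, y]"
  have M: "M \<in> carrier_mat n 2" unfolding M_def by (rule carrier_matI) simp_all
  have less2: "r < 2 \<longleftrightarrow> r = 0 \<or> r = 1" for r :: nat by auto
  have comb: "mat_of_cols n [p, q] *\<^sub>v g = (g $ 0) \<cdot>\<^sub>v p + (g $ 1) \<cdot>\<^sub>v q"
    if pq: "p \<in> carrier_vec n" "q \<in> carrier_vec n" "g \<in> carrier_vec 2" for p q g :: "complex vec"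
  proof (rule eq_vecI)
    fix r assume "r < dim_vec ((g $ 0) \<cdot>\<^sub>v p + (g $ 1) \<cdot>\<^sub>v q)"
    then have r: "r < n" using pq by simp
    have C: "mat_of_cols n [p, q] \<in> carrier_mat n 2" by (rule carrier_matI) simp_all
    show "(mat_of_cols n [p, q] *\<^sub>v g) $ r = ((g $ 0) \<cdot>\<^sub>v p + (g $ 1) \<cdot>\<^sub>v q) $ r"
      unfolding mult_mat_vec_index[OF C pq(3) r] using r pq
      by (simp add: numeral_2_eq_2 mat_of_cols_index mult.commute)
  qed (use pq in simp)
  have inj: "g = 0\<^sub>v 2" if g: "g \<in> carrier_vec 2" "M *\<^sub>v g = 0\<^sub>v n" for g
  proof -
    have "g $ 0 = 0 \<and> g $ 1 = 0" by (rule indep) (use comb[OF x y g(1)] g(2) in \<open>simp add: M_def\<close>)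
    then show ?thesis using g by (intro eq_vecI) (auto simp: less2)
  qed
  obtain X where X: "X \<in> carrier_mat 2 2" and XS: "compress (compress S M) X = 1\<^sub>m 2"
    and XH: "compress (compress H M) X = mat_diag 2 (\<lambda>r. complex_of_real (pair_eig (compress H M) (compress S M) (Suc r)))"
    and so: "sorted (pair_eigenvalues (compress H M) (compress S M))"
      "length (pair_eigenvalues (compress H M) (compress S M)) = 2"
    using pencil_diagonalization_sorted[OF hermitian_compress[OF H_hermitian M] pos_def_compress[OF S_pos_def M inj]] .
  define e where "e r = pair_eig (compress H M) (compress S M) (Suc r)" for r
  have e01: "e 0 \<le> e 1" using so unfolding e_def pair_eig_def by (auto intro!: sorted_nth_mono)
  define N where "N = M * X"
  have N: "N \<in> carrier_mat n 2" unfolding N_def by (rule mult_carrier_mat[OF M X])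
  have NS: "compress S N = 1\<^sub>m 2" unfolding N_def using XS compress_compress[OF S_carrier M X] by simp
  have NH: "compress H N = mat_diag 2 (\<lambda>r. complex_of_real (e r))"
    unfolding N_def e_def using XH compress_compress[OF H_carrier M X] by simp
  define v where "v = col N 0"
  define w where "w = col N 1"
  have vc: "v \<in> carrier_vec n" and wc: "w \<in> carrier_vec n" using N by (auto simp: v_def w_def)
  have Sf: "(S *\<^sub>v col N s) \<bullet>c col N r = (if r = s then 1 else 0)" if "r < 2" "s < 2" for r s
    using compress_index[OF S_carrier N that] that unfolding NS by simp
  have Hf: "(H *\<^sub>v col N s) \<bullet>c col N r = (if r = s then of_real (e s) else 0)" if "r < 2" "s < 2" for r s
    using compress_index[OF H_carrier N that] that unfolding NH by (simp add: mat_diag_def)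
  have colX: "col X r \<in> carrier_vec 2" for r by (rule carrier_vecI) (use X in simp)
  have v: "v = (X $$ (0, 0)) \<cdot>\<^sub>v x + (X $$ (1, 0)) \<cdot>\<^sub>v y"
    using comb[OF x y colX, of 0] X unfolding v_def N_def
    by (subst col_mult_mat_vec[OF M X]) (auto simp: M_def)
  have w: "w = (X $$ (0, 1)) \<cdot>\<^sub>v x + (X $$ (1, 1)) \<cdot>\<^sub>v y"
    using comb[OF x y colX, of 1] X unfolding w_def N_def
    by (subst col_mult_mat_vec[OF M X]) (auto simp: M_def)
  define Y where "Y = mat_adjoint X * compress S M"
  have SM: "compress S M \<in> carrier_mat 2 2" by (rule compress_carrier[OF S_carrier M])
  have Y: "Y \<in> carrier_mat 2 2" unfolding Y_def by (rule mult_carrier_mat[OF mat_adjoint_carrier[OF X] SM])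
  have "Y * X = 1\<^sub>m 2" using XS unfolding Y_def compress_def[of "compress S M" X] .
  then have "X * Y = 1\<^sub>m 2" by (rule mat_mult_left_right_inverse[OF Y X])
  then have MN: "M = N * Y"
    unfolding N_def using assoc_mult_mat[OF M X Y] right_mult_one_mat[OF M] by simp
  have Ncols: "N = mat_of_cols n [v, w]"
  proof (rule mat_col_eqI)
    fix r assume "r < dim_col (mat_of_cols n [v, w])"
    then consider "r = 0" | "r = 1" by force
    moreover have "col (mat_of_cols n [v, w]) 0 = v" "col (mat_of_cols n [v, w]) 1 = w"
      using vc wc by simp_all
    ultimately show "col N r = col (mat_of_cols n [v, w]) r"
      by cases (simp_all only: v_def[symmetric] w_def[symmetric])
  qed (use N in simp_all)
  have colY: "col Y r \<in> carrier_vec 2" for r by (rule carrier_vecI) (use Y in simp)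
  have Mcol: "col M 0 = x" "col M 1 = y" using x y by (simp_all add: M_def)
  have xv: "x = (Y $$ (0, 0)) \<cdot>\<^sub>v v + (Y $$ (1, 0)) \<cdot>\<^sub>v w"
  proof -
    have "x = N *\<^sub>v col Y 0" unfolding Mcol(1)[symmetric] MN by (rule col_mult_mat_vec[OF N Y]) simp
    also have "\<dots> = (Y $$ (0, 0)) \<cdot>\<^sub>v v + (Y $$ (1, 0)) \<cdot>\<^sub>v w"
      unfolding Ncols comb[OF vc wc colY] using Y by simp
    finally show ?thesis .
  qed
  have yv: "y = (Y $$ (0, 1)) \<cdot>\<^sub>v v + (Y $$ (1, 1)) \<cdot>\<^sub>v w"
  proof -
    have "y = N *\<^sub>v col Y 1" unfolding Mcol(2)[symmetric] MN by (rule col_mult_mat_vec[OF N Y]) simp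
    also have "\<dots> = (Y $$ (0, 1)) \<cdot>\<^sub>v v + (Y $$ (1, 1)) \<cdot>\<^sub>v w"
      unfolding Ncols comb[OF vc wc colY] using Y by simp
    finally show ?thesis .
  qed
  have sys: "ritz_system [v, w]"
    using Sf[of 0 0] Sf[of 0 1] Sf[of 1 0] Sf[of 1 1] Hf[of 0 1] Hf[of 1 0] vc wc
    by (auto simp: ritz_system_def v_def w_def)
  have "rho v = e 0" "rho w = e 1" using Hf[of 0 0] Hf[of 1 1] by (simp_all add: rho_def v_def w_def)
  then have "rho v \<le> rho w" using e01 by simp
  from that[OF sys this v w xv yv] show ?thesis .
qed

end

section \<open>The lower bound for one extremal step and its limit\<close>

lemma weighted_cauchy_schwarz2:
  fixes \<alpha> \<beta> s t m1 m2 :: real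
  assumes "0 < m1" "0 < m2"
  shows "(\<alpha> * s + \<beta> * t)\<^sup>2 \<le> (m2 * s\<^sup>2 + m1 * t\<^sup>2) * (\<alpha>\<^sup>2 / m2 + \<beta>\<^sup>2 / m1)"
proof -
  have "(m2 * s\<^sup>2 + m1 * t\<^sup>2) * (\<alpha>\<^sup>2 / m2 + \<beta>\<^sup>2 / m1) - (\<alpha> * s + \<beta> * t)\<^sup>2
      = (m2 * s * \<beta> - m1 * t * \<alpha>)\<^sup>2 / (m1 * m2)"
    using assms by (simp add: field_simps power2_eq_square)
  moreover have "0 \<le> (m2 * s * \<beta> - m1 * t * \<alpha>)\<^sup>2 / (m1 * m2)" using assms by simp
  ultimately show ?thesis by linarith
qed

text \<open>The coordinates of a x + b y are the c's times the values of one affine function at the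
  nodes \<open>b0\<close>, \<open>b1\<close>, \<open>b2\<close>. A value at \<open>b0\<close> of
  size A therefore prevents both other values from being small: Cauchy-Schwarz gives N \<ge>
  \<delta> g A^2 for the excess N of the Rayleigh quotient over \<open>p\<close>. Normalization
  gives A^2 \<ge> 1 - N / (q - p), and the two inequalities are solved for N.\<close>

lemma sharp_lower_bound:
  fixes p q w m1 m2 \<delta> b0 b1 b2 c0 c1 c2 :: real and a b :: complex
  assumes m: "0 < m1" "0 < m2" and pq: "p < q" "q \<le> w" and \<delta>: "0 < \<delta>"
    and c1: "(q - p) * c1\<^sup>2 = \<delta> * m2 / (m1 + m2)" and c2: "(w - p) * c2\<^sup>2 = \<delta> * m1 / (m1 + m2)"
    and c0: "c0\<^sup>2 \<le> 1"
    and one: "c0\<^sup>2 * (cmod (a + b * of_real b0))\<^sup>2 + c1\<^sup>2 * (cmod (a + b * of_real b1))\<^sup>2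
      + c2\<^sup>2 * (cmod (a + b * of_real b2))\<^sup>2 = 1"
    and M1: "0 < b1 - b0"
    and g: "g = (b2 - b1)\<^sup>2 / ((m1 + m2) * ((b2 - b0)\<^sup>2 / m2 + (b1 - b0)\<^sup>2 / m1))"
  shows "\<delta> * g / (1 + \<delta> * g / (q - p))
    \<le> (q - p) * c1\<^sup>2 * (cmod (a + b * of_real b1))\<^sup>2 + (w - p) * c2\<^sup>2 * (cmod (a + b * of_real b2))\<^sup>2"
proof -
  define A where "A = cmod (a + b * of_real b0)"
  define X where "X = cmod (a + b * of_real b1)"
  define Y where "Y = cmod (a + b * of_real b2)"
  define N where "N = (q - p) * c1\<^sup>2 * X\<^sup>2 + (w - p) * c2\<^sup>2 * Y\<^sup>2"
  define F where "F = (b2 - b0)\<^sup>2 / m2 + (b1 - b0)\<^sup>2 / m1"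
  have F: "0 < F" using m M1 unfolding F_def by (intro add_nonneg_pos) auto
  have g0: "0 \<le> g" using m F unfolding g F_def[symmetric] by simp
  have N_eq: "N = \<delta> / (m1 + m2) * (m2 * X\<^sup>2 + m1 * Y\<^sup>2)"
    unfolding N_def c1 c2 by (simp add: algebra_simps add_divide_distrib)
  \<comment> \<open>Three values of an affine function satisfy one linear relation, free of the
    unknown \<open>a\<close> and \<open>b\<close>.\<close>
  have "of_real (b2 - b0) * (a + b * of_real b1) - of_real (b1 - b0) * (a + b * of_real b2)
      = of_real (b2 - b1) * (a + b * of_real b0)"
    by (simp add: algebra_simps)
  then have "\<bar>b2 - b1\<bar> * A = cmod (of_real (b2 - b0) * (a + b * of_real b1) - of_real (b1 - b0) * (a + b * of_real b2))"
    unfolding A_def by (metis norm_mult norm_of_real)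
  also have "\<dots> \<le> cmod (of_real (b2 - b0) * (a + b * of_real b1)) + cmod (of_real (b1 - b0) * (a + b * of_real b2))"
    by (rule norm_triangle_ineq4)
  also have "\<dots> = \<bar>b2 - b0\<bar> * X + \<bar>b1 - b0\<bar> * Y"
    unfolding X_def Y_def by (simp only: norm_mult norm_of_real)
  finally have "(\<bar>b2 - b1\<bar> * A)\<^sup>2 \<le> (\<bar>b2 - b0\<bar> * X + \<bar>b1 - b0\<bar> * Y)\<^sup>2"
    by (intro power_mono) (auto simp: A_def)
  also have "\<dots> \<le> (m2 * X\<^sup>2 + m1 * Y\<^sup>2) * F"
    using weighted_cauchy_schwarz2[OF m, of "\<bar>b2 - b0\<bar>" X "\<bar>b1 - b0\<bar>" Y] by (simp add: F_def)
  finally have le: "(b2 - b1)\<^sup>2 * A\<^sup>2 \<le> (m2 * X\<^sup>2 + m1 * Y\<^sup>2) * F" by (simp add: power_mult_distrib)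
  have "g * A\<^sup>2 = (b2 - b1)\<^sup>2 * A\<^sup>2 / F / (m1 + m2)" unfolding g F_def[symmetric] by (simp add: mult.commute)
  also have "\<dots> \<le> (m2 * X\<^sup>2 + m1 * Y\<^sup>2) / (m1 + m2)"
    using le F m by (intro divide_right_mono) (auto simp: pos_divide_le_eq)
  finally have gA: "\<delta> * (g * A\<^sup>2) \<le> N" unfolding N_eq using mult_left_mono[of _ _ \<delta>] \<delta> by fastforce
  have "c0\<^sup>2 * A\<^sup>2 \<le> 1 * A\<^sup>2" using c0 by (intro mult_right_mono) auto
  moreover have "c1\<^sup>2 * X\<^sup>2 + c2\<^sup>2 * Y\<^sup>2 \<le> N / (q - p)"
  proof -
    have "(q - p) * (c2\<^sup>2 * Y\<^sup>2) \<le> (w - p) * (c2\<^sup>2 * Y\<^sup>2)" using pq by (intro mult_right_mono) auto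
    then have "(c1\<^sup>2 * X\<^sup>2 + c2\<^sup>2 * Y\<^sup>2) * (q - p) \<le> N" unfolding N_def by (simp add: algebra_simps)
    then show ?thesis using pq by (simp add: pos_le_divide_eq)
  qed
  ultimately have "1 - N / (q - p) \<le> A\<^sup>2" using one by (simp add: A_def X_def Y_def)
  then have "\<delta> * g * (1 - N / (q - p)) \<le> \<delta> * g * A\<^sup>2" using \<delta> g0 by (intro mult_left_mono) auto
  then have "\<delta> * g \<le> N * (1 + \<delta> * g / (q - p))" using gA by (simp add: algebra_simps)
  moreover have "0 < 1 + \<delta> * g / (q - p)" using \<delta> g0 pq by (intro add_pos_nonneg) auto
  ultimately have "\<delta> * g / (1 + \<delta> * g / (q - p)) \<le> N" by (simp add: pos_divide_le_eq)
  then show ?thesis by (simp add: N_def X_def Y_def)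
qed

text \<open>At \<open>\<theta> = p\<close> the nodes become 0, \<open>m1\<close> and
  \<open>m2\<close>, and \<open>g\<close> becomes the Kantorovich quotient ((m2 - m1) / (m1 +
  m2))^2. With B = (w - p) / (w - \<nu>) one has m1 = (1 - \<epsilon>) (1 - \<kappa>) B and m2 = (1
  + \<epsilon>) B, so this is the claimed factor; the other two corrections tend to 1.\<close>

lemma sharp_lower_bound_limit:
  fixes p q w \<nu> \<epsilon> \<kappa> :: real
  assumes \<nu>: "\<nu> < p" and pq: "p < q" "q \<le> w" and \<epsilon>: "0 \<le> \<epsilon>" "\<epsilon> < 1"
    and \<kappa>: "\<kappa> = ((p - \<nu>) / (q - \<nu>)) * ((w - q) / (w - p))"
    and m1: "m1 = (1 - \<epsilon>) * (q - p) / (q - \<nu>)" and m2: "m2 = (1 + \<epsilon>) * (w - p) / (w - \<nu>)"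
    and b0: "\<And>\<theta>. b0 \<theta> = (p - \<theta>) / (p - \<nu>)"
    and b1: "\<And>\<theta>. b1 \<theta> = (1 - \<epsilon>) * (q - \<theta>) / (q - \<nu>)" and b2: "\<And>\<theta>. b2 \<theta> = (1 + \<epsilon>) * (w - \<theta>) / (w - \<nu>)"
    and g: "\<And>\<theta>. g \<theta> = (b2 \<theta> - b1 \<theta>)\<^sup>2 / ((m1 + m2) * ((b2 \<theta> - b0 \<theta>)\<^sup>2 / m2 + (b1 \<theta> - b0 \<theta>)\<^sup>2 / m1))"
  shows "((\<lambda>\<theta>. g \<theta> / (1 + (\<theta> - p) * g \<theta> / (q - p)) * ((q - \<theta>) / (q - p)))
    \<longlongrightarrow> ((\<kappa> + \<epsilon> * (2 - \<kappa>)) / ((2 - \<kappa>) + \<epsilon> * \<kappa>))\<^sup>2) (at_right p)"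
proof -
  have m: "0 < m1" "0 < m2" using \<nu> pq \<epsilon> by (auto simp: m1 m2)
  have bt: "(b0 \<longlongrightarrow> 0) (at_right p)" "(b1 \<longlongrightarrow> m1) (at_right p)" "(b2 \<longlongrightarrow> m2) (at_right p)"
    unfolding b0 b1 b2 m1 m2 using \<nu> pq by (auto intro!: tendsto_eq_intros)
  define \<gamma> where "\<gamma> = (m2 - m1)\<^sup>2 / ((m1 + m2) * ((m2 - 0)\<^sup>2 / m2 + (m1 - 0)\<^sup>2 / m1))"
  have "(m2 - 0)\<^sup>2 / m2 + (m1 - 0)\<^sup>2 / m1 = m1 + m2" using m by (simp add: power2_eq_square)
  then have \<gamma>: "\<gamma> = ((m2 - m1) / (m1 + m2))\<^sup>2" and nz: "(m1 + m2) * ((m2 - 0)\<^sup>2 / m2 + (m1 - 0)\<^sup>2 / m1) \<noteq> 0"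
    using m by (simp_all add: \<gamma>_def power2_eq_square)
  have gt: "(g \<longlongrightarrow> \<gamma>) (at_right p)"
    unfolding g \<gamma>_def using m nz by (intro tendsto_intros bt) auto
  have "((\<lambda>\<theta>. g \<theta> / (1 + (\<theta> - p) * g \<theta> / (q - p)) * ((q - \<theta>) / (q - p)))
    \<longlongrightarrow> \<gamma> / (1 + (p - p) * \<gamma> / (q - p)) * ((q - p) / (q - p))) (at_right p)"
    using pq by (intro tendsto_intros gt) auto
  also have "\<gamma> / (1 + (p - p) * \<gamma> / (q - p)) * ((q - p) / (q - p)) = \<gamma>" using pq by simp
  also note \<gamma>
  also have "(m2 - m1) / (m1 + m2) = (\<kappa> + \<epsilon> * (2 - \<kappa>)) / ((2 - \<kappa>) + \<epsilon> * \<kappa>)"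
  proof -
    define B where "B = (w - p) / (w - \<nu>)"
    have B: "0 < B" using \<nu> pq by (simp add: B_def)
    have den: "(q - \<nu>) * (w - p) \<noteq> 0" using \<nu> pq by simp
    have "1 - \<kappa> = ((q - \<nu>) * (w - p) - (p - \<nu>) * (w - q)) / ((q - \<nu>) * (w - p))"
    proof -
      have "1 - X / D = (D - X) / D" if "D \<noteq> 0" for X D :: real
        using that by (simp add: diff_divide_distrib)
      then show ?thesis unfolding \<kappa> times_divide_times_eq using den by blast
    qed
    also have "(q - \<nu>) * (w - p) - (p - \<nu>) * (w - q) = (q - p) * (w - \<nu>)" by (simp add: algebra_simps)
    finally have "(1 - \<kappa>) * B = (q - p) / (q - \<nu>)" using \<nu> pq by (simp add: B_def)
    then have m1': "m1 = (1 - \<epsilon>) * (1 - \<kappa>) * B" by (simp add: m1 mult.assoc flip: times_divide_eq_right)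
    have m2': "m2 = (1 + \<epsilon>) * B" by (simp add: m2 B_def)
    have "m2 - m1 = (\<kappa> + \<epsilon> * (2 - \<kappa>)) * B" "m1 + m2 = ((2 - \<kappa>) + \<epsilon> * \<kappa>) * B"
      unfolding m1' m2' by (simp_all add: algebra_simps)
    then show ?thesis using B by simp
  qed
  finally show ?thesis .
qed

lemma spectrum_mat_diag:
  fixes f :: "nat \<Rightarrow> complex"
  shows "spectrum (mat_diag m f) = f ` {..<m}"
proof (intro equalityI subsetI)
  fix c assume "c \<in> spectrum (mat_diag m f)"
  then obtain v where v: "v \<in> carrier_vec m" "v \<noteq> 0\<^sub>v m" "mat_diag m f *\<^sub>v v = c \<cdot>\<^sub>v v"
    using carrier_matD[OF mat_diag_dim[of m f]] by (auto simp: spectrum_def eigenvalue_def eigenvector_def)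
  obtain r where r: "r < m" "v $ r \<noteq> 0" using v by (metis carrier_vecD eq_vecI index_zero_vec)
  have "(mat_diag m f *\<^sub>v v) $ r = c * v $ r" unfolding v(3) using r v by simp
  then have "f r = c" unfolding mat_diag_mult_vec[OF v(1)] using r by simp
  then show "c \<in> f ` {..<m}" using r by auto
next
  fix c assume "c \<in> f ` {..<m}"
  then obtain r where r: "r < m" "c = f r" by auto
  have "mat_diag m f *\<^sub>v unit_vec m r = c \<cdot>\<^sub>v unit_vec m r"
    unfolding mat_diag_mult_vec[OF unit_vec_carrier] using r by (intro eq_vecI) (auto simp: unit_vec_def)
  moreover have "unit_vec m r \<noteq> (0\<^sub>v m :: complex vec)" using r by simp
  ultimately show "c \<in> spectrum (mat_diag m f)"
    using carrier_matD[OF mat_diag_dim[of m f]]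
    by (auto simp: spectrum_def eigenvalue_def eigenvector_def intro!: exI[of _ "unit_vec m r"])
qed

section \<open>Preconditioners that are diagonal in the eigenbasis\<close>

context deflated_eigenbasis
begin

text \<open>Sends \<open>S *\<^sub>v u l\<close> to \<open>g l\<close> times \<open>u l\<close> for
  \<open>l \<ge> i\<close> and to 0 for \<open>l < i\<close>, so the effective preconditioner is the
  prescribed diagonal.\<close>

definition diag_prec :: "(nat \<Rightarrow> real) \<Rightarrow> complex mat" where
  "diag_prec g = V * mat_diag m (\<lambda>r. complex_of_real (g (i + r))) * mat_adjoint V"

lemma compress_S_V: "compress S V = 1\<^sub>m m"
proof (rule eq_matI)
  fix r s assume "r < dim_row (1\<^sub>m m :: complex mat)" "s < dim_col (1\<^sub>m m :: complex mat)"
  then have rs: "r < m" "s < m" by simp_all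
  show "compress S V $$ (r, s) = 1\<^sub>m m $$ (r, s)"
    unfolding compress_index[OF S_carrier V_carrier rs] col_V[OF rs(1)] col_V[OF rs(2)]
    using u_orthonormal[OF V_index[OF rs(2)] V_index[OF rs(1)]] rs by simp
qed (use carrier_matD[OF V_carrier] in \<open>simp_all add: compress_def\<close>)

lemma diag_prec_carrier: "diag_prec g \<in> carrier_mat n n"
  unfolding diag_prec_def
  by (rule mult_carrier_mat[OF mult_carrier_mat[OF V_carrier mat_diag_dim] mat_adjoint_carrier[OF V_carrier]])

lemma diag_prec_hermitian: "hermitian_mat n (diag_prec g)"
proof -
  let ?D = "mat_diag m (\<lambda>r. complex_of_real (g (i + r)))"
  have aV: "mat_adjoint V \<in> carrier_mat m n" by (rule mat_adjoint_carrier[OF V_carrier])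
  have aD: "mat_adjoint ?D = ?D" by (rule eq_matI) (auto simp: mat_diag_def)
  have "mat_adjoint (diag_prec g) = mat_adjoint (mat_adjoint V) * mat_adjoint (V * ?D)"
    unfolding diag_prec_def by (rule mat_adjoint_mult[OF mult_carrier_mat[OF V_carrier mat_diag_dim] aV])
  also have "mat_adjoint (V * ?D) = ?D * mat_adjoint V"
    unfolding mat_adjoint_mult[OF V_carrier mat_diag_dim] aD ..
  also have "mat_adjoint (mat_adjoint V) * (?D * mat_adjoint V) = diag_prec g"
    unfolding mat_adjoint_adjoint diag_prec_def by (rule assoc_mult_mat[OF V_carrier mat_diag_dim aV, symmetric])
  finally show ?thesis using diag_prec_carrier by (simp add: hermitian_mat_def)
qed

lemma effective_diag_prec: "effective_prec S V (diag_prec g) = mat_diag m (\<lambda>r. complex_of_real (g (i + r)))"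
proof -
  define D where "D = mat_diag m (\<lambda>r. complex_of_real (g (i + r)))"
  have D: "D \<in> carrier_mat m m" by (simp add: D_def)
  have aV: "mat_adjoint V \<in> carrier_mat m n" by (rule mat_adjoint_carrier[OF V_carrier])
  have aVS: "mat_adjoint V * S \<in> carrier_mat m n" by (rule mult_carrier_mat[OF aV S_carrier])
  have VD: "V * D \<in> carrier_mat n m" by (rule mult_carrier_mat[OF V_carrier D])
  have aVSV: "mat_adjoint V * S * V = 1\<^sub>m m" using compress_S_V by (simp add: compress_def)
  have "mat_adjoint V * S * (V * D * mat_adjoint V) = (mat_adjoint V * S) * (V * D) * mat_adjoint V"
    by (rule assoc_mult_mat[OF aVS VD aV, symmetric])
  also have "(mat_adjoint V * S) * (V * D) = (mat_adjoint V * S * V) * D"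
    by (rule assoc_mult_mat[OF aVS V_carrier D, symmetric])
  also have "\<dots> = D" unfolding aVSV by (rule left_mult_one_mat[OF D])
  finally have "effective_prec S V (diag_prec g) = D * mat_adjoint V * S * V"
    unfolding effective_prec_def diag_prec_def D_def[symmetric] by simp
  also have "D * mat_adjoint V * S = D * (mat_adjoint V * S)" by (rule assoc_mult_mat[OF D aV S_carrier])
  also have "D * (mat_adjoint V * S) * V = D * (mat_adjoint V * S * V)" by (rule assoc_mult_mat[OF D aVS V_carrier])
  also have "\<dots> = D" unfolding aVSV by (rule right_mult_one_mat[OF D])
  finally show ?thesis by (simp add: D_def)
qed

lemma coef_diag_prec:
  assumes w: "w \<in> carrier_vec n" and l: "l \<in> {1..n}"
  shows "coef (diag_prec g *\<^sub>v w) l = (if l < i then 0 else of_real (g l) * (w \<bullet>c u l))"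
proof -
  let ?D = "mat_diag m (\<lambda>r. complex_of_real (g (i + r)))"
  have aV: "mat_adjoint V \<in> carrier_mat m n" by (rule mat_adjoint_carrier[OF V_carrier])
  define b where "b = mat_adjoint V *\<^sub>v w"
  have b: "b \<in> carrier_vec m" unfolding b_def by (rule mult_mat_vec_carrier[OF aV w])
  have br: "b $ r = w \<bullet>c u (i + r)" if r: "r < m" for r
  proof -
    have "b $ r = row (mat_adjoint V) r \<bullet> w" unfolding b_def using r carrier_matD[OF V_carrier] by simp
    also have "row (mat_adjoint V) r = conjugate (col V r)"
      using r carrier_matD[OF V_carrier] by (intro eq_vecI) auto
    also have "conjugate (col V r) \<bullet> w = w \<bullet>c col V r"
      using r w carrier_matD[OF V_carrier] by (intro comm_scalar_prod[of _ n]) (auto intro: carrier_vecI)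
    finally show ?thesis by (simp add: col_V[OF r])
  qed
  have "diag_prec g *\<^sub>v w = (V * ?D) *\<^sub>v b"
    unfolding diag_prec_def b_def by (rule assoc_mult_mat_vec[OF mult_carrier_mat[OF V_carrier mat_diag_dim] aV w])
  also have "\<dots> = V *\<^sub>v (?D *\<^sub>v b)" by (rule assoc_mult_mat_vec[OF V_carrier mat_diag_dim b])
  finally have "coef (diag_prec g *\<^sub>v w) l = (if l < i then 0 else (?D *\<^sub>v b) $ (l - i))"
    using coef_V[OF mult_mat_vec_carrier[OF mat_diag_dim b] l] by simp
  moreover have "(?D *\<^sub>v b) $ (l - i) = of_real (g l) * (w \<bullet>c u l)" if "\<not> l < i"
  proof -
    have "l - i < m" "i + (l - i) = l" using that l by (auto simp: m_def)
    then show ?thesis unfolding mat_diag_mult_vec[OF b] using br[of "l - i"] by simp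
  qed
  ultimately show ?thesis by simp
qed

text \<open>Division by \<open>lam l - \<nu>\<close> leaves exactly the numbers \<open>g l\<close>
  as eigenvalues of the effective preconditioner times \<open>Lnu\<close>. The extremes 1 -
  \<epsilon> and 1 + \<epsilon> add up to 2, so the quality parameter is \<epsilon>.\<close>

lemma diag_prec_quality:
  assumes \<nu>: "\<nu> < lam i" and Lnu: "Lnu = mat_diag m (\<lambda>r. complex_of_real (lam (i + r) - \<nu>))"
    and g: "\<And>l. l \<in> {i..n} \<Longrightarrow> 1 - \<epsilon> \<le> g l \<and> g l \<le> 1 + \<epsilon>"
    and j: "j \<in> {i..n}" "g j = 1 - \<epsilon>" and j': "j' \<in> {i..n}" "g j' = 1 + \<epsilon>"
    and \<epsilon>: "0 \<le> \<epsilon>" "\<epsilon> < 1"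
  shows "effectively_pos_def S V (diag_prec (\<lambda>l. g l / (lam l - \<nu>)))"
    and "quality_param S V (diag_prec (\<lambda>l. g l / (lam l - \<nu>))) Lnu = \<epsilon>"
proof -
  have pos: "0 < lam (i + r) - \<nu>" if "r < m" for r
    using lam_mono[of i "i + r"] V_index[OF that] i_range \<nu> by auto
  have g': "1 - \<epsilon> \<le> g (i + r) \<and> g (i + r) \<le> 1 + \<epsilon>" if "r < m" for r
    using g[of "i + r"] V_index[OF that] by auto
  show "effectively_pos_def S V (diag_prec (\<lambda>l. g l / (lam l - \<nu>)))"
    unfolding effectively_pos_def_def effective_diag_prec carrier_matD(2)[OF V_carrier]
  proof (rule pos_def_mat_diag)
    fix r assume r: "r < m"
    have "0 < g (i + r)" using g'[OF r] \<epsilon> by linarith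
    then show "0 < g (i + r) / (lam (i + r) - \<nu>)" using pos[OF r] by simp
  qed
  have "effective_prec S V (diag_prec (\<lambda>l. g l / (lam l - \<nu>))) * Lnu = mat_diag m (\<lambda>r. complex_of_real (g (i + r)))"
    unfolding effective_diag_prec Lnu mat_diag_diag
  proof (rule eq_matI)
    fix r s assume "r < dim_row (mat_diag m (\<lambda>r. complex_of_real (g (i + r))))"
      "s < dim_col (mat_diag m (\<lambda>r. complex_of_real (g (i + r))))"
    then have rs: "r < m" "s < m" by (simp_all add: mat_diag_def)
    have "g (i + s) / (lam (i + s) - \<nu>) * (lam (i + s) - \<nu>) = g (i + s)" using pos[OF rs(2)] by simp
    then have "complex_of_real (g (i + s) / (lam (i + s) - \<nu>)) * complex_of_real (lam (i + s) - \<nu>) = of_real (g (i + s))"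
      by (simp only: of_real_mult[symmetric])
    then show "mat_diag m (\<lambda>r. complex_of_real (g (i + r) / (lam (i + r) - \<nu>)) * complex_of_real (lam (i + r) - \<nu>)) $$ (r, s)
        = mat_diag m (\<lambda>r. complex_of_real (g (i + r))) $$ (r, s)"
      using rs by (simp add: mat_diag_def del: of_real_divide of_real_diff)
  qed (simp_all add: mat_diag_def)
  then have sp: "Re ` spectrum (effective_prec S V (diag_prec (\<lambda>l. g l / (lam l - \<nu>))) * Lnu) = (\<lambda>r. g (i + r)) ` {..<m}"
    by (simp add: spectrum_mat_diag image_image)
  have mem: "g l \<in> (\<lambda>r. g (i + r)) ` {..<m}" if "l \<in> {i..n}" for l
    using that by (intro image_eqI[of _ _ "l - i"]) (auto simp: m_def)
  have "Max ((\<lambda>r. g (i + r)) ` {..<m}) = 1 + \<epsilon>"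
    by (rule Max_eqI) (use g' mem[OF j'(1)] j'(2) in auto)
  moreover have "Min ((\<lambda>r. g (i + r)) ` {..<m}) = 1 - \<epsilon>"
    by (rule Min_eqI) (use g' mem[OF j(1)] j(2) in auto)
  ultimately show "quality_param S V (diag_prec (\<lambda>l. g l / (lam l - \<nu>))) Lnu = \<epsilon>"
    unfolding quality_param_def Let_def sp by simp
qed

end

section \<open>The extremal step\<close>

lemma cprod_minus_left:
  fixes x y z :: "complex vec"
  assumes "x \<in> carrier_vec n" "y \<in> carrier_vec n" "z \<in> carrier_vec n"
  shows "(x - y) \<bullet>c z = x \<bullet>c z - y \<bullet>c z"
  using assms by (simp add: cprod_sum[of _ n] left_diff_distrib sum_subtractf)

lemma quadratic_form_comb:
  fixes v w :: "complex vec"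
  assumes M: "M \<in> carrier_mat n n" and v: "v \<in> carrier_vec n" and w: "w \<in> carrier_vec n"
    and "(M *\<^sub>v v) \<bullet>c w = 0" "(M *\<^sub>v w) \<bullet>c v = 0"
  shows "(M *\<^sub>v (a \<cdot>\<^sub>v v + b \<cdot>\<^sub>v w)) \<bullet>c (a \<cdot>\<^sub>v v + b \<cdot>\<^sub>v w)
    = of_real ((cmod a)\<^sup>2) * ((M *\<^sub>v v) \<bullet>c v) + of_real ((cmod b)\<^sup>2) * ((M *\<^sub>v w) \<bullet>c w)"
proof -
  have av: "a \<cdot>\<^sub>v v \<in> carrier_vec n" and bw: "b \<cdot>\<^sub>v w \<in> carrier_vec n" using v w by auto
  have Mv: "M *\<^sub>v v \<in> carrier_vec n" and Mw: "M *\<^sub>v w \<in> carrier_vec n"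
    using mult_mat_vec_carrier[OF M] v w by auto
  have "M *\<^sub>v (a \<cdot>\<^sub>v v + b \<cdot>\<^sub>v w) = a \<cdot>\<^sub>v (M *\<^sub>v v) + b \<cdot>\<^sub>v (M *\<^sub>v w)"
    unfolding mult_add_distrib_mat_vec[OF M av bw] mult_mat_vec[OF M v] mult_mat_vec[OF M w] ..
  then show ?thesis
    using assms Mv Mw
    by (simp add: cprod_add_left[of _ n] cprod_add_right[of _ n] cprod_smult_left[of _ n] cprod_smult_right[of _ n]
        complex_norm_square mult.assoc del: of_real_power)
qed

context deflated_eigenbasis
begin

lemma ritz_system_mset:
  assumes "ritz_system xs" "mset ys = mset xs"
  shows "ritz_system ys"
  using assms ritz_systemD(1)[OF assms(1)] mset_eq_imp_distinct_iff[OF assms(2)] mset_eq_setD[OF assms(2)]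
  by (intro ritz_system_subset[OF assms(1)]) simp_all

lemma sorted_rho_u:
  assumes "1 \<le> a" "b \<le> n + 1"
  shows "sorted (map rho (map u [a..<b]))"
  unfolding sorted_iff_nth_mono using assms by (auto simp: rho_u intro!: lam_mono)

lemma col_residual:
  assumes zs: "ritz_system zs" and r: "r < length zs"
  shows "col (residual H S (mat_of_cols n zs)) r
    = H *\<^sub>v (zs ! r) - complex_of_real (rho (zs ! r)) \<cdot>\<^sub>v (S *\<^sub>v (zs ! r))"
proof -
  let ?Z = "mat_of_cols n zs" and ?D = "mat_diag (length zs) (\<lambda>r. complex_of_real (rho (zs ! r)))"
  have Z: "?Z \<in> carrier_mat n (length zs)" by simp
  have c: "col ?Z r = zs ! r" by (rule col_mat_of_cols_nth[OF ritz_systemD(2)[OF zs] r])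
  have HZ: "H * ?Z \<in> carrier_mat n (length zs)" and SZ: "S * ?Z \<in> carrier_mat n (length zs)"
    by (rule mult_carrier_mat[OF H_carrier Z] mult_carrier_mat[OF S_carrier Z])+
  have SZD: "S * ?Z * ?D \<in> carrier_mat n (length zs)" by (rule mult_carrier_mat[OF SZ mat_diag_dim])
  have colD: "col ?D r = complex_of_real (rho (zs ! r)) \<cdot>\<^sub>v unit_vec (length zs) r"
    using r by (intro eq_vecI) (auto simp: mat_diag_def unit_vec_def)
  have "residual H S ?Z = H * ?Z - S * ?Z * ?D" unfolding residual_def ritz_system_compress[OF zs] ..
  then have "col (residual H S ?Z) r = col (H * ?Z) r - col (S * ?Z * ?D) r"
    using carrier_matD[OF HZ] carrier_matD[OF SZD] r by (intro eq_vecI) simp_all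
  also have "col (H * ?Z) r = H *\<^sub>v (zs ! r)" unfolding col_mult_mat_vec[OF H_carrier Z r] c ..
  also have "col (S * ?Z * ?D) r = complex_of_real (rho (zs ! r)) \<cdot>\<^sub>v (S *\<^sub>v (zs ! r))"
    unfolding col_mult_mat_vec[OF SZ mat_diag_dim r] colD mult_mat_vec[OF SZ unit_vec_carrier]
      mult_unit_vec_col[OF SZ r] col_mult_mat_vec[OF S_carrier Z r] c ..
  finally show ?thesis .
qed

text \<open>All columns of the iterate except number \<open>t\<close> are exact eigenvectors and
  have zero residual. The step thus reduces to Rayleigh-Ritz in the plane of the remaining column
  \<open>x\<close> and its preconditioned residual \<open>y\<close>. The hypothesis
  \<open>j + 2 + (k - t) \<le> n\<close> provides \<open>k - t\<close> eigenvectors with indices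
  strictly between \<open>j + 1\<close> and \<open>n\<close> for the columns after
  \<open>x\<close>.\<close>

lemma sharp_step:
  fixes \<nu> \<epsilon> \<theta> :: real
  assumes t: "t \<in> {1..k}" and j: "i - 1 + t \<le> j" "j + 2 + (k - t) \<le> n" and gap: "lam j < lam (j + 1)"
    and \<nu>: "\<nu> < lam i" and \<epsilon>: "0 \<le> \<epsilon>" "\<epsilon> < 1" and \<theta>: "lam j < \<theta>" "\<theta> < lam (j + 1)"
    and K: "K = diag_prec (\<lambda>l. (if l = j + 1 then 1 - \<epsilon> else if l = n then 1 + \<epsilon> else 1) / (lam l - \<nu>))"
    and m1: "m1 = (1 - \<epsilon>) * (lam (j + 1) - lam j) / (lam (j + 1) - \<nu>)"
    and m2: "m2 = (1 + \<epsilon>) * (lam n - lam j) / (lam n - \<nu>)"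
    and b0: "b0 = (lam j - \<theta>) / (lam j - \<nu>)"
    and b1: "b1 = (1 - \<epsilon>) * (lam (j + 1) - \<theta>) / (lam (j + 1) - \<nu>)"
    and b2: "b2 = (1 + \<epsilon>) * (lam n - \<theta>) / (lam n - \<nu>)"
    and g: "g = (b2 - b1)\<^sup>2 / ((m1 + m2) * ((b2 - b0)\<^sup>2 / m2 + (b1 - b0)\<^sup>2 / m1))"
  obtains Z Z' x where "bpsd_iterate n H S k Z" "full_col_rank n Z"
    "set (cols Z) \<subseteq> span_of n (set (cols V))" "bpsd_id_step n H S U k K Z Z'"
    "ritz_value H S Z t = \<theta>" "ritz_vector H S Z \<theta> x" "x \<in> span_of n {u j, u (j + 1), u n}"
    "(\<theta> - lam j) * g / (1 + (\<theta> - lam j) * g / (lam (j + 1) - lam j)) \<le> ritz_value H S Z' t - lam j"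
proof -
  define p where "p = lam j"
  define q where "q = lam (j + 1)"
  define w where "w = lam n"
  define \<delta> where "\<delta> = \<theta> - p"
  have jr: "j \<in> {1..n}" "j + 1 \<in> {1..n}" "n \<in> {1..n}" "i \<le> j" "j + 1 < n" using t j i_range by auto
  have pq: "p < q" "q \<le> w" using gap lam_mono[of "j + 1" n] jr by (auto simp: p_def q_def w_def)
  have \<nu>p: "\<nu> < p" using \<nu> lam_mono[of i j] jr i_range by (auto simp: p_def)
  have \<delta>: "0 < \<delta>" "\<delta> < q - p" using \<theta> by (auto simp: \<delta>_def p_def q_def)
  have m: "0 < m1" "0 < m2" unfolding m1 m2 p_def[symmetric] q_def[symmetric] w_def[symmetric] using \<nu>p pq \<epsilon> by auto
  \<comment> \<open>The energies of the two error components are in the ratio \<open>m2 : m1\<close>, which is the worst case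
    of Kantorovich's inequality for the eigenvalues \<open>m1\<close> and \<open>m2\<close> of the preconditioned operator.\<close>
  define s1 where "s1 = \<delta> * m2 / (m1 + m2) / (q - p)"
  define s2 where "s2 = \<delta> * m1 / (m1 + m2) / (w - p)"
  have s: "0 < s1" "0 < s2" using \<delta> m pq by (auto simp: s1_def s2_def)
  have s_sum: "s1 + s2 < 1"
  proof -
    have "s2 \<le> \<delta> * m1 / (m1 + m2) / (q - p)"
      unfolding s2_def using \<delta> m pq by (intro divide_left_mono) auto
    then have "s1 + s2 \<le> (\<delta> * m2 / (m1 + m2) + \<delta> * m1 / (m1 + m2)) / (q - p)"
      by (simp add: s1_def add_divide_distrib)
    also have "\<delta> * m2 / (m1 + m2) + \<delta> * m1 / (m1 + m2) = \<delta>"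
      using m by (simp add: add_divide_distrib[symmetric] distrib_left[symmetric] add.commute)
    also have "\<delta> / (q - p) < 1" using \<delta> by simp
    finally show ?thesis .
  qed
  define c0 where "c0 = sqrt (1 - s1 - s2)"
  define c1 where "c1 = sqrt s1"
  define c2 where "c2 = sqrt s2"
  have c_sq: "c0\<^sup>2 = 1 - s1 - s2" "c1\<^sup>2 = s1" "c2\<^sup>2 = s2" using s s_sum by (simp_all add: c0_def c1_def c2_def)
  have c_nz: "c0 \<noteq> 0" "c1 \<noteq> 0" using s s_sum by (auto simp: c0_def c1_def)
  have c1_eq: "(q - p) * c1\<^sup>2 = \<delta> * m2 / (m1 + m2)" and c2_eq: "(w - p) * c2\<^sup>2 = \<delta> * m1 / (m1 + m2)"
    using pq by (simp_all add: c_sq s1_def s2_def)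
  define cx where "cx l = (if l = j then c0 else if l = j + 1 then c1 else if l = n then c2 else 0)" for l
  \<comment> \<open>The factor by which residual and preconditioner together act on coordinate
    \<open>l\<close>: a x + b y has the coordinate \<open>cx l\<close> times (a + b \<beta>
    l).\<close>
  define \<beta> where "\<beta> l = (if l = j + 1 then 1 - \<epsilon> else if l = n then 1 + \<epsilon> else 1) / (lam l - \<nu>) * (lam l - \<theta>)" for l
  have \<beta>_eq: "\<beta> j = b0" "\<beta> (j + 1) = b1" "\<beta> n = b2"
    using jr by (auto simp: \<beta>_def b0 b1 b2)
  have b01: "b0 < 0" "0 < b1"
    using \<theta> \<nu>p pq \<epsilon> by (auto simp: b0 b1 p_def q_def divide_neg_pos)
  have sum3: "(\<Sum>l\<in>{1..n}. f l) = f j + f (j + 1) + f n" if "\<And>l. l \<notin> {j, j + 1, n} \<Longrightarrow> f l = 0" for f :: "nat \<Rightarrow> 'b :: comm_monoid_add"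
  proof -
    have "(\<Sum>l\<in>{1..n}. f l) = (\<Sum>l\<in>{j, j + 1, n}. f l)"
      using jr that by (intro sum.mono_neutral_right) auto
    then show ?thesis using jr by (simp add: add.assoc)
  qed

  define x where "x = of_real c0 \<cdot>\<^sub>v u j + (of_real c1 \<cdot>\<^sub>v u (j + 1) + of_real c2 \<cdot>\<^sub>v u n)"
  have uc: "u j \<in> carrier_vec n" "u (j + 1) \<in> carrier_vec n" "u n \<in> carrier_vec n" using u_carrier jr by auto
  have x: "x \<in> carrier_vec n" using uc by (simp add: x_def)
  have coef_x: "coef x l = of_real (cx l)" if l: "l \<in> {1..n}" for l
    unfolding x_def using uc jr
    by (simp add: coef_add[OF _ _ l] coef_smult[OF _ l] coef_u[OF l] cx_def)
  define rx where "rx = H *\<^sub>v x - complex_of_real \<theta> \<cdot>\<^sub>v (S *\<^sub>v x)"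
  have Hx: "H *\<^sub>v x \<in> carrier_vec n" and Sx: "S *\<^sub>v x \<in> carrier_vec n"
    using mult_mat_vec_carrier[OF H_carrier x] mult_mat_vec_carrier[OF S_carrier x] .
  have rx: "rx \<in> carrier_vec n" unfolding rx_def using Hx Sx by simp
  have rx_u: "rx \<bullet>c u l = of_real ((lam l - \<theta>) * cx l)" if l: "l \<in> {1..n}" for l
  proof -
    have "rx \<bullet>c u l = (H *\<^sub>v x) \<bullet>c u l - of_real \<theta> * ((S *\<^sub>v x) \<bullet>c u l)"
      unfolding rx_def using Hx Sx u_carrier[OF l]
      by (simp add: cprod_minus_left[of _ n] cprod_smult_left[of _ n])
    also have "\<dots> = of_real ((lam l - \<theta>) * cx l)"
      unfolding coef_H[OF x l] coef_def[symmetric] coef_x[OF l] by (simp add: algebra_simps)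
    finally show ?thesis .
  qed
  have Kc: "K \<in> carrier_mat n n" unfolding K by (rule diag_prec_carrier)
  define y where "y = K *\<^sub>v rx"
  have y: "y \<in> carrier_vec n" unfolding y_def by (rule mult_mat_vec_carrier[OF Kc rx])
  have coef_y: "coef y l = of_real (\<beta> l * cx l)" if l: "l \<in> {1..n}" for l
  proof (cases "l < i")
    case True
    then have "cx l = 0" using jr i_range by (auto simp: cx_def)
    then show ?thesis using True unfolding y_def K coef_diag_prec[OF rx l] by simp
  next
    case False
    then show ?thesis unfolding y_def K coef_diag_prec[OF rx l] rx_u[OF l] \<beta>_def
      by (simp only: of_real_mult[symmetric] mult.assoc if_False)
  qed
  have coef_comb: "coef (a \<cdot>\<^sub>v x + b \<cdot>\<^sub>v y) l = of_real (cx l) * (a + b * of_real (\<beta> l))" if l: "l \<in> {1..n}" for a b l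
    using x y by (simp add: coef_add[OF _ _ l] coef_smult[OF _ l] coef_x[OF l] coef_y[OF l] algebra_simps)
  have cx0: "cx l = 0" if "l \<notin> {j, j + 1, n}" for l using that by (auto simp: cx_def)
  have comb_S: "(S *\<^sub>v z) \<bullet>c z = of_real (c0\<^sup>2 * (cmod (a + b * of_real b0))\<^sup>2 + c1\<^sup>2 * (cmod (a + b * of_real b1))\<^sup>2
      + c2\<^sup>2 * (cmod (a + b * of_real b2))\<^sup>2)"
    and comb_rho: "rho z = p * (c0\<^sup>2 * (cmod (a + b * of_real b0))\<^sup>2) + q * (c1\<^sup>2 * (cmod (a + b * of_real b1))\<^sup>2)
      + w * (c2\<^sup>2 * (cmod (a + b * of_real b2))\<^sup>2)"
    if z: "z = a \<cdot>\<^sub>v x + b \<cdot>\<^sub>v y" for z a b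
  proof -
    have zc: "z \<in> carrier_vec n" unfolding z using x y by simp
    have sq: "coef z l * cnj (coef z l) = of_real ((cx l)\<^sup>2 * (cmod (a + b * of_real (\<beta> l)))\<^sup>2)" if l: "l \<in> {1..n}" for l
      unfolding complex_norm_square[symmetric] unfolding z coef_comb[OF l]
      by (simp add: norm_mult power_mult_distrib)
    have cxv: "cx j = c0" "cx (j + 1) = c1" "cx n = c2" using jr by (auto simp: cx_def)
    have "(S *\<^sub>v z) \<bullet>c z = (\<Sum>l\<in>{1..n}. of_real ((cx l)\<^sup>2 * (cmod (a + b * of_real (\<beta> l)))\<^sup>2))"
      unfolding S_form[OF zc zc] by (rule sum.cong[OF refl sq])
    also have "\<dots> = of_real (\<Sum>l\<in>{1..n}. (cx l)\<^sup>2 * (cmod (a + b * of_real (\<beta> l)))\<^sup>2)" by (rule of_real_sum[symmetric])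
    also have "(\<Sum>l\<in>{1..n}. (cx l)\<^sup>2 * (cmod (a + b * of_real (\<beta> l)))\<^sup>2)
        = (cx j)\<^sup>2 * (cmod (a + b * of_real (\<beta> j)))\<^sup>2 + (cx (j + 1))\<^sup>2 * (cmod (a + b * of_real (\<beta> (j + 1))))\<^sup>2
          + (cx n)\<^sup>2 * (cmod (a + b * of_real (\<beta> n)))\<^sup>2"
      by (rule sum3) (simp add: cx0)
    finally show "(S *\<^sub>v z) \<bullet>c z = of_real (c0\<^sup>2 * (cmod (a + b * of_real b0))\<^sup>2 + c1\<^sup>2 * (cmod (a + b * of_real b1))\<^sup>2
      + c2\<^sup>2 * (cmod (a + b * of_real b2))\<^sup>2)"
      unfolding cxv \<beta>_eq .
    have "(H *\<^sub>v z) \<bullet>c z = (\<Sum>l\<in>{1..n}. of_real (lam l * ((cx l)\<^sup>2 * (cmod (a + b * of_real (\<beta> l)))\<^sup>2)))"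
      unfolding H_form[OF zc zc] of_real_mult[of "lam _"] by (rule sum.cong[OF refl]) (simp only: sq)
    also have "\<dots> = of_real (\<Sum>l\<in>{1..n}. lam l * ((cx l)\<^sup>2 * (cmod (a + b * of_real (\<beta> l)))\<^sup>2))" by (rule of_real_sum[symmetric])
    also have "(\<Sum>l\<in>{1..n}. lam l * ((cx l)\<^sup>2 * (cmod (a + b * of_real (\<beta> l)))\<^sup>2))
        = lam j * ((cx j)\<^sup>2 * (cmod (a + b * of_real (\<beta> j)))\<^sup>2)
          + lam (j + 1) * ((cx (j + 1))\<^sup>2 * (cmod (a + b * of_real (\<beta> (j + 1))))\<^sup>2)
          + lam n * ((cx n)\<^sup>2 * (cmod (a + b * of_real (\<beta> n)))\<^sup>2)"
      by (rule sum3) (simp add: cx0)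
    finally show "rho z = p * (c0\<^sup>2 * (cmod (a + b * of_real b0))\<^sup>2) + q * (c1\<^sup>2 * (cmod (a + b * of_real b1))\<^sup>2)
      + w * (c2\<^sup>2 * (cmod (a + b * of_real b2))\<^sup>2)"
      unfolding cxv \<beta>_eq rho_def p_def q_def w_def by (simp only: Re_complex_of_real)
  qed
  have x_comb: "x = 1 \<cdot>\<^sub>v x + 0 \<cdot>\<^sub>v y" using x y by (intro eq_vecI) auto
  have Sxx: "(S *\<^sub>v x) \<bullet>c x = 1"
    unfolding comb_S[OF x_comb] by (simp add: c_sq)
  have rho_x: "rho x = \<theta>"
  proof -
    have "rho x = p * (1 - s1 - s2) + q * s1 + w * s2" unfolding comb_rho[OF x_comb] by (simp add: c_sq)
    also have "\<dots> = p + ((q - p) * s1 + (w - p) * s2)" by (simp add: algebra_simps)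
    also have "(q - p) * s1 + (w - p) * s2 = \<delta> * m2 / (m1 + m2) + \<delta> * m1 / (m1 + m2)"
      using c1_eq c2_eq by (simp add: c_sq)
    also have "\<dots> = \<delta>" using m by (simp add: add_divide_distrib[symmetric] distrib_left[symmetric] add.commute)
    finally show ?thesis by (simp add: \<delta>_def)
  qed
  \<comment> \<open>An affine function with zeros at the two distinct nodes
    \<open>b0 < 0 < b1\<close> is zero; the coordinates \<open>c0\<close> and \<open>c1\<close> do
    not vanish.\<close>
  have indep: "a = 0 \<and> b = 0" if 0: "a \<cdot>\<^sub>v x + b \<cdot>\<^sub>v y = 0\<^sub>v n" for a b
  proof -
    have "of_real c0 * (a + b * of_real b0) = 0"
      using coef_comb[OF jr(1), of a b] coef_zero[OF jr(1)] unfolding 0 \<beta>_eq by (simp add: cx_def)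
    moreover have "of_real c1 * (a + b * of_real b1) = 0"
      using coef_comb[OF jr(2), of a b] coef_zero[OF jr(2)] unfolding 0 \<beta>_eq by (simp add: cx_def)
    ultimately have e: "a + b * of_real b0 = 0" "a + b * of_real b1 = 0" using c_nz by auto
    have "b * of_real (b1 - b0) = (a + b * of_real b1) - (a + b * of_real b0)" by (simp add: algebra_simps)
    then have "b * of_real (b1 - b0) = 0" unfolding e by simp
    moreover have "complex_of_real (b1 - b0) \<noteq> 0" using b01 unfolding of_real_eq_0_iff by linarith
    ultimately have "b = 0" by (metis mult_eq_0_iff)
    then show ?thesis using e by simp
  qed
  obtain v w' a b c d a' b' c' d' where vw: "ritz_system [v, w']" and rho_le: "rho v \<le> rho w'"
    and v_eq: "v = a \<cdot>\<^sub>v x + b \<cdot>\<^sub>v y" and w_eq: "w' = c \<cdot>\<^sub>v x + d \<cdot>\<^sub>v y"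
    and x_eq: "x = a' \<cdot>\<^sub>v v + b' \<cdot>\<^sub>v w'" and y_eq: "y = c' \<cdot>\<^sub>v v + d' \<cdot>\<^sub>v w'"
    using two_dimensional_ritz[OF x y indep] .
  have vc: "v \<in> carrier_vec n" and wc: "w' \<in> carrier_vec n" using ritz_systemD(2)[OF vw] by auto
  have Sv: "(S *\<^sub>v v) \<bullet>c v = 1" using ritz_systemD(3)[OF vw] by simp
  have v_one: "c0\<^sup>2 * (cmod (a + b * of_real b0))\<^sup>2 + c1\<^sup>2 * (cmod (a + b * of_real b1))\<^sup>2
      + c2\<^sup>2 * (cmod (a + b * of_real b2))\<^sup>2 = 1"
    using comb_S[OF v_eq] unfolding Sv by (metis of_real_eq_1_iff)
  have lower: "\<delta> * g / (1 + \<delta> * g / (q - p)) \<le> rho v - p"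
  proof -
    have "\<delta> * g / (1 + \<delta> * g / (q - p))
      \<le> (q - p) * c1\<^sup>2 * (cmod (a + b * of_real b1))\<^sup>2 + (w - p) * c2\<^sup>2 * (cmod (a + b * of_real b2))\<^sup>2"
      by (rule sharp_lower_bound[OF m pq \<delta>(1) c1_eq c2_eq _ v_one _ g]) (use s b01 in \<open>auto simp: c_sq\<close>)
    also have "\<dots> = rho v - p * (c0\<^sup>2 * (cmod (a + b * of_real b0))\<^sup>2 + c1\<^sup>2 * (cmod (a + b * of_real b1))\<^sup>2
      + c2\<^sup>2 * (cmod (a + b * of_real b2))\<^sup>2)"
      unfolding comb_rho[OF v_eq] by (simp add: algebra_simps)
    finally show ?thesis unfolding v_one by simp
  qed
  have "0 \<le> (q - p) * c1\<^sup>2 * (cmod (a + b * of_real b1))\<^sup>2 + (w - p) * c2\<^sup>2 * (cmod (a + b * of_real b2))\<^sup>2"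
    using pq by (intro add_nonneg_nonneg mult_nonneg_nonneg) auto
  also have "\<dots> = rho v - p * (c0\<^sup>2 * (cmod (a + b * of_real b0))\<^sup>2 + c1\<^sup>2 * (cmod (a + b * of_real b1))\<^sup>2
      + c2\<^sup>2 * (cmod (a + b * of_real b2))\<^sup>2)"
    unfolding comb_rho[OF v_eq] by (simp add: algebra_simps)
  finally have p_rho: "p \<le> rho v" unfolding v_one by simp
  have vw_ne: "v \<noteq> w'" using ritz_systemD(1)[OF vw] by simp
  \<comment> \<open>The plane contains \<open>x\<close>, whose Rayleigh quotient
    \<open>\<theta>\<close> is a mean of the two Ritz values. Together with \<open>p_rho\<close>
    this fixes the position of \<open>v\<close> among the exact eigenvectors.\<close>
  have rho_v: "rho v \<le> \<theta>"
  proof -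
    have o: "(S *\<^sub>v v) \<bullet>c w' = 0" "(S *\<^sub>v w') \<bullet>c v = 0" "(H *\<^sub>v v) \<bullet>c w' = 0" "(H *\<^sub>v w') \<bullet>c v = 0"
      using ritz_systemD(4,5)[OF vw, of v w'] ritz_systemD(4,5)[OF vw, of w' v] vw_ne by auto
    have Sw: "(S *\<^sub>v w') \<bullet>c w' = 1" using ritz_systemD(3)[OF vw] by simp
    have "complex_of_real ((cmod a')\<^sup>2 + (cmod b')\<^sup>2) = (S *\<^sub>v x) \<bullet>c x"
      unfolding x_eq quadratic_form_comb[OF S_carrier vc wc o(1,2)] Sv Sw by simp
    then have ab: "(cmod a')\<^sup>2 + (cmod b')\<^sup>2 = 1" unfolding Sxx by (metis of_real_eq_1_iff)
    have "(H *\<^sub>v x) \<bullet>c x = of_real ((cmod a')\<^sup>2) * of_real (rho v) + of_real ((cmod b')\<^sup>2) * of_real (rho w')"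
      unfolding rho_eq[OF vc, symmetric] rho_eq[OF wc, symmetric]
      by (subst (1 2) x_eq) (rule quadratic_form_comb[OF H_carrier vc wc o(3,4)])
    then have "\<theta> = (cmod a')\<^sup>2 * rho v + (cmod b')\<^sup>2 * rho w'"
      unfolding rho_x[symmetric] rho_def[of x] by (simp del: of_real_power)
    moreover have "(cmod b')\<^sup>2 * rho v \<le> (cmod b')\<^sup>2 * rho w'" using rho_le by (intro mult_left_mono) auto
    ultimately have "((cmod a')\<^sup>2 + (cmod b')\<^sup>2) * rho v \<le> \<theta>" by (simp add: distrib_right)
    then show ?thesis unfolding ab by simp
  qed

  \<comment> \<open>Indices of the exact eigenvectors: \<open>L1\<close> for the
    \<open>t - 1\<close> columns before \<open>x\<close>, ending at i + t - 2 < j;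
    \<open>L01\<close> with the deflated ones added; \<open>L2\<close> for the columns after
    \<open>x\<close>.\<close>
  define L1 where "L1 = [i..<i + t - 1]"
  define L01 where "L01 = [1..<i + t - 1]"
  define L2 where "L2 = [j + 2..<j + 2 + (k - t)]"
  have L1: "set L1 \<subseteq> set L01" "length L1 = t - 1" and L01: "length L01 = i - 1 + (t - 1)"
    and L2: "length L2 = k - t"
    using t i_range by (auto simp: L1_def L01_def L2_def)
  have L_range: "l \<in> {1..n}" "l \<notin> {j, j + 1, n}" if "l \<in> set L01 \<union> set L2" for l
    using that t j i_range by (auto simp: L01_def L2_def)
  have L_disj: "set L01 \<inter> set L2 = {}" using t j i_range by (auto simp: L01_def L2_def)
  have rho_low: "rho (u l) \<le> p" if "l \<in> set L01" for l
    using L_range[of l] that rho_u[of l] lam_mono[of l j] t j i_range by (auto simp: L01_def p_def)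
  have rho_high: "q \<le> rho (u l)" if "l \<in> set L2" for l
  proof -
    have "j + 1 \<le> l" using that unfolding L2_def set_upt by simp
    then show ?thesis using L_range(1)[of l] that rho_u[of l] lam_mono[of "j + 1" l] by (simp add: q_def)
  qed
  have supp: "coef (a \<cdot>\<^sub>v x + b \<cdot>\<^sub>v y) l = 0" if "l \<in> set L01 \<union> set L2" for a b l
    using coef_comb[OF L_range(1)[OF that]] cx0[OF L_range(2)[OF that]] by simp

  define zs where "zs = map u L1 @ x # map u L2"
  have len_zs: "length zs = k" using L1 L2 t by (simp add: zs_def)
  have zs: "ritz_system zs"
  proof (rule ritz_system_mset)
    show "ritz_system (map u (L1 @ L2) @ [x])"
    proof (rule ritz_system_u_append)
      show "distinct (L1 @ L2)" using L1 L_disj by (auto simp: L1_def L2_def)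
      show "set (L1 @ L2) \<subseteq> {1..n}" using L1 L_range by auto
      show "ritz_system [x]" using x Sxx by (simp add: ritz_system_def)
      fix z l assume "z \<in> set [x]" "l \<in> set (L1 @ L2)"
      then show "coef z l = 0" using supp[of l 1 0] x_comb L1 by auto
    qed
  qed (simp add: zs_def)
  have zs_sorted: "sorted (map rho zs)"
  proof -
    have "sorted (map rho (map u L1))" unfolding L1_def using t j i_range by (intro sorted_rho_u) auto
    moreover have "sorted (map rho (map u L2))" unfolding L2_def using t j by (intro sorted_rho_u) auto
    moreover have "rho (u l) \<le> \<theta>" if "l \<in> set L1" for l using rho_low[of l] L1 that \<theta> by (auto simp: p_def)
    moreover have "\<theta> \<le> rho (u l)" if "l \<in> set L2" for l using rho_high[OF that] \<theta> by (simp add: q_def)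
    ultimately show ?thesis unfolding zs_def using rho_x
      by (auto simp: sorted_append) (meson order_trans)
  qed
  have zs_t: "zs ! (t - 1) = x" unfolding zs_def using L1 by (metis length_map nth_append_length)
  define Z where "Z = mat_of_cols n zs"
  have Zc: "Z \<in> carrier_mat n k" unfolding Z_def using mat_of_cols_carrier_length[of zs] len_zs by simp
  have SZ: "compress S Z = 1\<^sub>m k" and HZ: "compress H Z = mat_diag k (\<lambda>r. complex_of_real (rho (zs ! r)))"
    unfolding Z_def using ritz_system_compress[OF zs] by (simp_all add: len_zs)
  have cols_Z: "cols Z = zs" unfolding Z_def by (rule cols_mat_of_cols[OF ritz_systemD(2)[OF zs]])

  \<comment> \<open>Where the larger Ritz vector \<open>w'\<close> falls among the eigenvectors of
    \<open>L2\<close> is unknown, so this part is sorted; everything up to \<open>v\<close> is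
    already in order.\<close>
  define tail where "tail = sort_key rho (w' # map u L2)"
  have st: "set tail = insert w' (u ` set L2)" unfolding tail_def set_sort by simp
  define ws where "ws = map u L01 @ v # tail"
  have len_ws: "length ws = i - 1 + k + 1" using L01 L2 t by (simp add: ws_def tail_def)
  have ws: "ritz_system ws"
  proof (rule ritz_system_mset)
    show "ritz_system (map u (L01 @ L2) @ [v, w'])"
    proof (rule ritz_system_u_append[OF _ _ vw])
      show "distinct (L01 @ L2)" using L_disj by (auto simp: L01_def L2_def)
      show "set (L01 @ L2) \<subseteq> {1..n}" using L_range by auto
      fix z l assume "z \<in> set [v, w']" "l \<in> set (L01 @ L2)"
      then show "coef z l = 0" using supp[of l a b] supp[of l c d] v_eq w_eq by auto
    qed
  qed (simp add: ws_def tail_def)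
  have ws_sorted: "sorted (map rho ws)"
  proof -
    have "sorted (map rho (map u L01))" unfolding L01_def using t j i_range by (intro sorted_rho_u) auto
    moreover have "sorted (map rho tail)" unfolding tail_def by (rule sorted_sort_key)
    moreover have tv: "rho v \<le> rho z" if "z \<in> set tail" for z
      using that st rho_le rho_high rho_v \<theta> by (force simp: q_def)
    moreover have uv: "rho (u l) \<le> rho v" if "l \<in> set L01" for l using rho_low[OF that] p_rho by simp
    moreover have "rho (u l) \<le> rho z" if "l \<in> set L01" "z \<in> set tail" for l z
      by (rule order_trans[OF uv[OF that(1)] tv[OF that(2)]])
    ultimately show ?thesis unfolding ws_def by (simp add: sorted_append)
  qed
  define W where "W = mat_of_cols n ws"
  have Wc: "W \<in> carrier_mat n (length ws)" unfolding W_def by simp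
  have cols_W: "cols W = ws" unfolding W_def by (rule cols_mat_of_cols[OF ritz_systemD(2)[OF ws]])
  \<comment> \<open>\<open>ws\<close> has \<open>i - 1 + k + 1\<close> entries; the deflated vectors
    at the front and the single last entry are dropped.\<close>
  define zs' where "zs' = take k (drop (i - 1) ws)"
  have len_zs': "length zs' = k" using len_ws by (simp add: zs'_def)
  have zs'_nth: "zs' ! r = ws ! (i - 1 + r)" if "r < k" for r
    unfolding zs'_def using that len_ws by simp
  have zs': "ritz_system zs'"
    by (rule ritz_system_subset[OF ws])
      (use ritz_systemD(1)[OF ws] in \<open>auto simp: zs'_def dest!: in_set_takeD in_set_dropD\<close>)
  have zs'_sorted: "sorted (map rho zs')"
    using ws_sorted unfolding zs'_def by (simp add: take_map[symmetric] drop_map[symmetric] sorted_wrt_take sorted_wrt_drop)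
  define Z' where "Z' = mat_of_cols n zs'"
  have Z'c: "Z' \<in> carrier_mat n k" unfolding Z'_def using mat_of_cols_carrier_length[of zs'] len_zs' by simp
  have col_Z': "col Z' r = ws ! (i - 1 + r)" if "r < k" for r
    unfolding Z'_def zs'_nth[OF that, symmetric]
    by (rule col_mat_of_cols_nth[OF ritz_systemD(2)[OF zs']]) (simp add: len_zs' that)
  have ws_t: "ws ! (i - 1 + (t - 1)) = v" unfolding ws_def using L01 by (metis length_map nth_append_length)
  have ws_u: "ws ! r = u (Suc r)" if "r < i - 1" for r
  proof -
    have "r < length L01" using that L01 by simp
    then show ?thesis unfolding ws_def by (simp add: nth_append L01_def)
  qed
  have ritz_t: "ritz_value H S Z' t = rho v"
  proof -
    have "t - 1 < k" "t \<in> {1..length zs'}" using t len_zs' by auto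
    then show ?thesis
      using ritz_system_sorted(1)[OF zs' zs'_sorted, of t] zs'_nth[of "t - 1"] ws_t by (simp only: Z'_def)
  qed

  define P where "P = K * residual H S Z"
  have Rc: "residual H S Z \<in> carrier_mat n k"
    unfolding residual_def
    by (rule minus_carrier_mat[OF mult_carrier_mat[OF mult_carrier_mat[OF S_carrier Zc] compress_carrier[OF H_carrier Zc]]])
  have Pc: "P \<in> carrier_mat n k" unfolding P_def by (rule mult_carrier_mat[OF Kc Rc])
  have cols_P: "set (cols P) = (\<lambda>z. K *\<^sub>v (H *\<^sub>v z - complex_of_real (rho z) \<cdot>\<^sub>v (S *\<^sub>v z))) ` set zs"
  proof -
    have cP: "col P r = K *\<^sub>v (H *\<^sub>v (zs ! r) - complex_of_real (rho (zs ! r)) \<cdot>\<^sub>v (S *\<^sub>v (zs ! r)))" if "r < k" for r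
      unfolding P_def col_mult_mat_vec[OF Kc Rc that] unfolding Z_def
      by (subst col_residual[OF zs]) (simp_all add: len_zs that)
    have "set (cols P) = col P ` {..<k}" using Pc by (auto simp: cols_def)
    also have "\<dots> = (\<lambda>z. K *\<^sub>v (H *\<^sub>v z - complex_of_real (rho z) \<cdot>\<^sub>v (S *\<^sub>v z))) ` ((!) zs ` {..<k})"
      unfolding image_image by (rule image_cong) (simp_all add: cP)
    also have "(!) zs ` {..<k} = set zs" using nth_image[of k zs] len_zs by (simp add: lessThan_atLeast0)
    finally show ?thesis .
  qed
  have y_P: "y \<in> set (cols P)"
    unfolding cols_P by (rule image_eqI[of _ _ x]) (simp_all add: y_def rx_def rho_x zs_def)
  have P_sub: "z = y \<or> z = 0\<^sub>v n" if zP: "z \<in> set (cols P)" for z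
  proof -
    obtain z' where z': "z' \<in> set zs" "z = K *\<^sub>v (H *\<^sub>v z' - complex_of_real (rho z') \<cdot>\<^sub>v (S *\<^sub>v z'))"
      using zP unfolding cols_P by auto
    show ?thesis
    proof (cases "z' = x")
      case True
      then show ?thesis using z' by (simp add: y_def rx_def rho_x)
    next
      case False
      then obtain l where l: "l \<in> {1..n}" "z' = u l" using z'(1) L1 L_range by (auto simp: zs_def)
      have "H *\<^sub>v z' - complex_of_real (rho z') \<cdot>\<^sub>v (S *\<^sub>v z') = 0\<^sub>v n"
        unfolding l(2) u_eigen[OF l(1)] rho_u[OF l(1)]
        using mult_mat_vec_carrier[OF S_carrier u_carrier[OF l(1)]] by (intro eq_vecI) auto
      then show ?thesis unfolding z'(2) by (simp add: mult_mat_vec_zero[OF Kc])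
    qed
  qed
  have dU: "dim_col U = i - 1" using carrier_matD[OF U_carrier] by simp
  have cols_U: "set (cols U) = u ` {1..<i}"
  proof -
    have "cols U = map u [1..<i]"
      unfolding U_eq using i_range by (intro cols_mat_of_cols) (auto intro!: u_carrier)
    then show ?thesis by simp
  qed
  have set_ws: "set ws = u ` set L01 \<union> {v, w'} \<union> u ` set L2" by (auto simp: ws_def st)
  have set_zs: "set zs = u ` set L1 \<union> {x} \<union> u ` set L2" by (auto simp: zs_def)
  have span: "span_of n (set (cols W)) = span_of n (set (cols U) \<union> set (cols Z) \<union> set (cols P))"
  proof
    let ?X = "set (cols U) \<union> set (cols Z) \<union> set (cols P)"
    have Xc: "?X \<subseteq> carrier_vec n"
      using cols_dim[of U] cols_dim[of Z] cols_dim[of P] carrier_matD[OF U_carrier] carrier_matD[OF Zc] carrier_matD[OF Pc]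
      by auto
    have xX: "x \<in> span_of n ?X" by (rule span_of_mem[OF Xc]) (simp add: cols_Z set_zs)
    have yX: "y \<in> span_of n ?X" by (rule span_of_mem[OF Xc]) (simp add: y_P)
    show "span_of n (set (cols W)) \<subseteq> span_of n ?X"
    proof (rule span_of_mono[OF Xc], rule subsetI)
      fix z assume "z \<in> set (cols W)"
      then consider l where "l \<in> set L01" "z = u l" | "z = v" | "z = w'" | l where "l \<in> set L2" "z = u l"
        unfolding cols_W set_ws by auto
      then show "z \<in> span_of n ?X"
      proof cases
        case (1 l)
        then have "l \<in> {1..<i} \<or> l \<in> set L1" by (auto simp: L01_def L1_def)
        then show ?thesis using 1 by (intro span_of_mem[OF Xc]) (auto simp: cols_U cols_Z set_zs)
      next
        case 2
        then show ?thesis unfolding v_eq by (auto intro!: span_of_add[OF Xc] span_of_smult[OF Xc] xX yX)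
      next
        case 3
        then show ?thesis unfolding w_eq by (auto intro!: span_of_add[OF Xc] span_of_smult[OF Xc] xX yX)
      next
        case (4 l)
        then show ?thesis by (intro span_of_mem[OF Xc]) (auto simp: cols_Z set_zs)
      qed
    qed
    have Wsub: "set (cols W) \<subseteq> carrier_vec n" unfolding cols_W by (rule ritz_systemD(2)[OF ws])
    have vW: "v \<in> span_of n (set (cols W))" by (rule span_of_mem[OF Wsub]) (simp add: cols_W set_ws)
    have wW: "w' \<in> span_of n (set (cols W))" by (rule span_of_mem[OF Wsub]) (simp add: cols_W set_ws)
    have xW: "x \<in> span_of n (set (cols W))"
      by (subst x_eq) (intro span_of_add[OF Wsub] span_of_smult[OF Wsub] vW wW)
    have yW: "y \<in> span_of n (set (cols W))"
      by (subst y_eq) (intro span_of_add[OF Wsub] span_of_smult[OF Wsub] vW wW)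
    have "0 \<cdot>\<^sub>v v = 0\<^sub>v n" using vc by (intro eq_vecI) auto
    then have zW: "0\<^sub>v n \<in> span_of n (set (cols W))" using span_of_smult[OF Wsub vW, of 0] by simp
    show "span_of n ?X \<subseteq> span_of n (set (cols W))"
    proof (rule span_of_mono[OF Wsub], rule subsetI)
      fix z assume "z \<in> ?X"
      then consider l where "l \<in> {1..<i}" "z = u l" | "z \<in> set zs" | "z \<in> set (cols P)"
        unfolding cols_U cols_Z by auto
      then show "z \<in> span_of n (set (cols W))"
      proof cases
        case (1 l)
        then have "l \<in> set L01" using t by (auto simp: L01_def)
        then show ?thesis using 1 by (intro span_of_mem[OF Wsub]) (auto simp: cols_W set_ws)
      next
        case 2
        show ?thesis
        proof (cases "z = x")
          case True
          then show ?thesis using xW by simp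
        next
          case False
          then have "z \<in> set ws" using 2 L1 unfolding set_zs set_ws by blast
          then show ?thesis by (intro span_of_mem[OF Wsub]) (simp add: cols_W)
        qed
      next
        case 3
        then show ?thesis using P_sub yW zW by auto
      qed
    qed
  qed
  have SW: "compress S W = 1\<^sub>m (length ws)" unfolding W_def by (rule ritz_system_compress[OF ws])
  have ritz_W: "ritz_vector H S W (ritz_value H S W l) (ws ! (l - 1))" if "l \<in> {1..length ws}" for l
    unfolding W_def using ritz_system_sorted[OF ws ws_sorted that] by simp
  have step: "bpsd_id_step n H S U k K Z Z'"
    unfolding bpsd_id_step_def Let_def P_def[symmetric] dU
  proof (intro exI[of _ W] conjI ballI)
    show "full_col_rank n W" by (rule orthonormal_imp_full_col_rank[OF Wc SW])
    show "span_of n (set (cols W)) = span_of n (set (cols U) \<union> set (cols Z) \<union> set (cols P))" by (rule span)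
    show "ritz_vector H S W (ritz_value H S W l) (col U (l - 1))" if "l \<in> {1..i - 1}" for l
    proof -
      have l: "l - 1 < i - 1" "l \<in> {1..length ws}" using that len_ws by auto
      have "col U (l - 1) = ws ! (l - 1)" unfolding col_U[OF l(1)] ws_u[OF l(1)] ..
      then show ?thesis using ritz_W[OF l(2)] by simp
    qed
    show "Z' \<in> carrier_mat n k" by fact
    show "ritz_vector H S W (ritz_value H S W (i - 1 + l)) (col Z' (l - 1))" if "l \<in> {1..k}" for l
    proof -
      have l: "l - 1 < k" "i - 1 + l \<in> {1..length ws}" "i - 1 + (l - 1) = i - 1 + l - 1" using that len_ws by auto
      show ?thesis unfolding col_Z'[OF l(1)] l(3) by (rule ritz_W[OF l(2)])
    qed
    show "compress S Z' = 1\<^sub>m k" unfolding Z'_def using ritz_system_compress(1)[OF zs'] by (simp add: len_zs')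
    show "mat_adjoint U * S * Z' = 0\<^sub>m (i - 1) k"
    proof (rule eq_matI)
      fix r s assume "r < dim_row (0\<^sub>m (i - 1) k :: complex mat)" "s < dim_col (0\<^sub>m (i - 1) k :: complex mat)"
      then have rs: "r < i - 1" "s < k" by simp_all
      have "r < length ws" "i - 1 + s < length ws" "i - 1 + s \<noteq> r" using rs len_ws by auto
      then have "(S *\<^sub>v ws ! (i - 1 + s)) \<bullet>c (ws ! r) = 0"
        using ritz_systemD(4)[OF ws nth_mem nth_mem] nth_eq_iff_index_eq[OF ritz_systemD(1)[OF ws]] by blast
      then show "(mat_adjoint U * S * Z') $$ (r, s) = 0\<^sub>m (i - 1) k $$ (r, s)"
        unfolding adjoint_form_index[OF S_carrier U_carrier Z'c rs] col_U[OF rs(1)] col_Z'[OF rs(2)] ws_u[OF rs(1)]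
        using rs by simp
    qed (use Z'c dU in simp_all)
  qed
  show ?thesis
  proof (rule that[of Z Z' x])
    show "bpsd_iterate n H S k Z"
      unfolding bpsd_iterate_def HZ using Zc SZ by (auto simp: diagonal_mat_def mat_diag_def)
    show "full_col_rank n Z" by (rule orthonormal_imp_full_col_rank[OF Zc SZ])
    show "set (cols Z) \<subseteq> span_of n (set (cols V))"
    proof
      fix z assume "z \<in> set (cols Z)"
      then consider l where "l \<in> set L1 \<union> set L2" "z = u l" | "z = x" unfolding cols_Z set_zs by auto
      then show "z \<in> span_of n (set (cols V))"
      proof cases
        case (1 l)
        then have l: "l \<in> {1..n}" "i \<le> l" using L1 L_range jr by (auto simp: L1_def L2_def)
        have "coef (u l) l' = 0" if "l' \<in> {1..<i}" for l' using that l i_range by (subst coef_u) auto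
        then show ?thesis unfolding span_V_iff 1(2) using u_carrier[OF l(1)] by simp
      next
        case 2
        have "coef x l' = 0" if l': "l' \<in> {1..<i}" for l'
        proof -
          have "l' \<in> {1..n}" "l' \<notin> {j, j + 1, n}" using l' jr i_range by auto
          then show ?thesis using coef_x cx0 by simp
        qed
        then show ?thesis unfolding span_V_iff 2 using x by simp
      qed
    qed
    show "bpsd_id_step n H S U k K Z Z'" by (rule step)
    show "ritz_value H S Z t = \<theta>" "ritz_vector H S Z \<theta> x"
      using ritz_system_sorted[OF zs zs_sorted, of t] t len_zs unfolding Z_def zs_t rho_x by simp_all
    have X3: "{u j, u (j + 1), u n} \<subseteq> carrier_vec n" using uc by auto
    show "x \<in> span_of n {u j, u (j + 1), u n}"
      unfolding x_def by (intro span_of_add[OF X3] span_of_smult[OF X3] span_of_mem[OF X3]) auto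
    show "(\<theta> - lam j) * g / (1 + (\<theta> - lam j) * g / (lam (j + 1) - lam j)) \<le> ritz_value H S Z' t - lam j"
      using lower unfolding ritz_t \<delta>_def p_def q_def .
  qed
qed

end

text \<open>The strict bound below \<open>lam (j + 1)\<close> accompanies the inequality because
  beyond \<open>lam (j + 1)\<close> the left ratio would be negative and the estimate empty.
  Sharpness means that the quotient of new and old ratio tends to the factor along a family of
  admissible steps.\<close>

theorem theorem3p2:
  fixes n i k :: nat and H S U V Lnu :: "complex mat" and u :: "nat \<Rightarrow> complex vec"
    and lam :: "nat \<Rightarrow> real" and \<nu> :: real and \<kappa> :: "nat \<Rightarrow> real" and \<phi> :: "real \<Rightarrow> real \<Rightarrow> real"
  assumes H: "hermitian_mat n H"
    and S: "pos_def_mat n S"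
    and i: "i \<in> {1..n}"
    and lam_eq: "lam = pair_eig H S"
    and u_carrier: "\<And>l. l \<in> {1..n} \<Longrightarrow> u l \<in> carrier_vec n"
    and u_orthonormal: "\<And>l m. l \<in> {1..n} \<Longrightarrow> m \<in> {1..n} \<Longrightarrow>
          (S *\<^sub>v u l) \<bullet>c u m = (if l = m then 1 else 0)"
    and u_eigen: "\<And>l. l \<in> {1..n} \<Longrightarrow> H *\<^sub>v u l = complex_of_real (lam l) \<cdot>\<^sub>v (S *\<^sub>v u l)"
    and U_eq: "U = mat_of_cols n (map u [1..<i])"
    and V_eq: "V = mat_of_cols n (map u [i..<Suc n])"
    and \<nu>: "\<nu> < lam i"
    and Lnu_eq: "Lnu = mat_diag (n - i + 1) (\<lambda>r. complex_of_real (lam (i + r) - \<nu>))"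
    and \<kappa>_eq: "\<And>j. \<kappa> j = ((lam j - \<nu>) / (lam (j + 1) - \<nu>)) *
                          ((lam n - lam (j + 1)) / (lam n - lam j))"
    and \<phi>_eq: "\<And>x \<epsilon>. \<phi> x \<epsilon> = ((x + \<epsilon> * (2 - x)) / ((2 - x) + \<epsilon> * x))\<^sup>2"
  shows
    "(\<forall>K Z Z' t j.
        hermitian_mat n K \<longrightarrow> effectively_pos_def S V K \<longrightarrow>
        bpsd_iterate n H S k Z \<longrightarrow> full_col_rank n Z \<longrightarrow>
        set (cols Z) \<subseteq> span_of n (set (cols V)) \<longrightarrow>
        bpsd_id_step n H S U k K Z Z' \<longrightarrow>
        t \<in> {1..k} \<longrightarrow> i - 1 + t \<le> j \<longrightarrow> j + 1 \<le> n \<longrightarrow>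
        ritz_value H S Z t \<in> {lam j <..< lam (j + 1)} \<longrightarrow>
        ritz_value H S Z' t < lam (j + 1) \<and>
        (ritz_value H S Z' t - lam j) / (lam (j + 1) - ritz_value H S Z' t)
          \<le> \<phi> (\<kappa> j) (quality_param S V K Lnu) *
             ((ritz_value H S Z t - lam j) / (lam (j + 1) - ritz_value H S Z t)))
     \<and>
     (\<forall>t j \<epsilon>.
        t \<in> {1..k} \<longrightarrow> i - 1 + t \<le> j \<longrightarrow> j + 2 + (k - t) \<le> n \<longrightarrow> lam j < lam (j + 1) \<longrightarrow>
        \<epsilon> \<in> {0..<1} \<longrightarrow>
        (\<exists>K Z Z' :: real \<Rightarrow> complex mat.
           (\<forall>\<^sub>F \<theta> in at_right (lam j).
              hermitian_mat n (K \<theta>) \<and> effectively_pos_def S V (K \<theta>) \<and>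
              quality_param S V (K \<theta>) Lnu = \<epsilon> \<and>
              bpsd_iterate n H S k (Z \<theta>) \<and> full_col_rank n (Z \<theta>) \<and>
              set (cols (Z \<theta>)) \<subseteq> span_of n (set (cols V)) \<and>
              bpsd_id_step n H S U k (K \<theta>) (Z \<theta>) (Z' \<theta>) \<and>
              ritz_value H S (Z \<theta>) t = \<theta> \<and>
              (\<exists>z. ritz_vector H S (Z \<theta>) \<theta> z \<and> z \<in> span_of n {u j, u (j + 1), u n})) \<and>
           ((\<lambda>\<theta>. ((ritz_value H S (Z' \<theta>) t - lam j) / (lam (j + 1) - ritz_value H S (Z' \<theta>) t)) /
                   ((\<theta> - lam j) / (lam (j + 1) - \<theta>)))
              \<longlongrightarrow> \<phi> (\<kappa> j) \<epsilon>) (at_right (lam j))))"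
proof -
  have E: "pencil_eigenbasis n H S u lam"
    using H S u_carrier u_orthonormal u_eigen by unfold_locales auto
  have lam_mono: "lam l \<le> lam l'" if "1 \<le> l" "l \<le> l'" "l' \<le> n" for l l'
  proof -
    have "sorted (pair_eigenvalues H S)" "length (pair_eigenvalues H S) = n"
      unfolding pencil_eigenbasis.pair_eigenvalues_eq[OF E] by simp_all
    then show ?thesis unfolding lam_eq pair_eig_def using that by (intro sorted_nth_mono) auto
  qed
  interpret deflated_eigenbasis n H S u lam i U V
    using E i lam_mono U_eq V_eq by (auto simp: deflated_eigenbasis_def deflated_eigenbasis_axioms_def)
  have Lnu': "Lnu = mat_diag m (\<lambda>r. complex_of_real (lam (i + r) - \<nu>))"
    using Lnu_eq by (simp add: m_def)
  have upper: "ritz_value H S Z' t < lam (j + 1) \<and>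
        (ritz_value H S Z' t - lam j) / (lam (j + 1) - ritz_value H S Z' t)
          \<le> \<phi> (\<kappa> j) (quality_param S V K Lnu) *
             ((ritz_value H S Z t - lam j) / (lam (j + 1) - ritz_value H S Z t))"
    if "hermitian_mat n K" "effectively_pos_def S V K" "bpsd_iterate n H S k Z" "full_col_rank n Z"
      "set (cols Z) \<subseteq> span_of n (set (cols V))" "bpsd_id_step n H S U k K Z Z'"
      "t \<in> {1..k}" "i - 1 + t \<le> j" "j + 1 \<le> n" "ritz_value H S Z t \<in> {lam j <..< lam (j + 1)}"
    for K Z Z' t j
    using ritz_step_estimate_bpsd[OF that \<nu> Lnu_eq \<kappa>_eq refl] unfolding \<phi>_eq by (rule conjI)
  show ?thesis
  proof (rule conjI, goal_cases)
    case 1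
    show ?case by (intro allI impI) (rule upper)
  next
    case 2
    show ?case
    proof (intro allI impI, goal_cases)
      case (1 t j \<epsilon>)
      then have t: "t \<in> {1..k}" and j: "i - 1 + t \<le> j" "j + 2 + (k - t) \<le> n"
        and gap: "lam j < lam (j + 1)" and \<epsilon>: "0 \<le> \<epsilon>" "\<epsilon> < 1" by auto
      have jr: "i \<le> j" "j + 1 < n" using t j i by auto
      \<comment> \<open>One preconditioner serves all \<open>\<theta>\<close>. As
        \<open>j + 1 < n\<close>, the smallest and the largest factor sit at different
        indices.\<close>
      define K where "K = diag_prec (\<lambda>l. (if l = j + 1 then 1 - \<epsilon> else if l = n then 1 + \<epsilon> else 1) / (lam l - \<nu>))"
      have K: "hermitian_mat n K" unfolding K_def by (rule diag_prec_hermitian)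
      have K': "effectively_pos_def S V K" "quality_param S V K Lnu = \<epsilon>"
        unfolding K_def
        by (rule diag_prec_quality[OF \<nu> Lnu', where j = "j + 1" and j' = n]; use jr \<epsilon> in auto)+
      define m1 where "m1 = (1 - \<epsilon>) * (lam (j + 1) - lam j) / (lam (j + 1) - \<nu>)"
      define m2 where "m2 = (1 + \<epsilon>) * (lam n - lam j) / (lam n - \<nu>)"
      define b0 where "b0 \<theta> = (lam j - \<theta>) / (lam j - \<nu>)" for \<theta>
      define b1 where "b1 \<theta> = (1 - \<epsilon>) * (lam (j + 1) - \<theta>) / (lam (j + 1) - \<nu>)" for \<theta>
      define b2 where "b2 \<theta> = (1 + \<epsilon>) * (lam n - \<theta>) / (lam n - \<nu>)" for \<theta>
      define g where "g \<theta> = (b2 \<theta> - b1 \<theta>)\<^sup>2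
        / ((m1 + m2) * ((b2 \<theta> - b0 \<theta>)\<^sup>2 / m2 + (b1 \<theta> - b0 \<theta>)\<^sup>2 / m1))" for \<theta>
      have \<nu>j: "\<nu> < lam j" "lam (j + 1) \<le> lam n" using \<nu> lam_mono[of i j] lam_mono[of "j + 1" n] jr i by auto
      have m12: "0 < m1" "0 < m2" using \<nu>j gap \<epsilon> by (auto simp: m1_def m2_def)
      have g0: "0 \<le> g \<theta>" for \<theta> using m12 by (simp add: g_def)
      define Q where "Q \<theta> Z Z' x \<longleftrightarrow> bpsd_iterate n H S k Z \<and> full_col_rank n Z \<and>
        set (cols Z) \<subseteq> span_of n (set (cols V)) \<and> bpsd_id_step n H S U k K Z Z' \<and>
        ritz_value H S Z t = \<theta> \<and> ritz_vector H S Z \<theta> x \<and> x \<in> span_of n {u j, u (j + 1), u n} \<and>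
        (\<theta> - lam j) * g \<theta> / (1 + (\<theta> - lam j) * g \<theta> / (lam (j + 1) - lam j)) \<le> ritz_value H S Z' t - lam j"
        for \<theta> Z Z' x
      have "\<exists>Z Z' x. Q \<theta> Z Z' x" if "lam j < \<theta>" "\<theta> < lam (j + 1)" for \<theta>
        by (rule sharp_step[OF t j gap \<nu> \<epsilon> that K_def m1_def m2_def b0_def b1_def b2_def g_def])
          (unfold Q_def, blast)
      then have "\<forall>\<theta>. \<exists>Z Z' x. lam j < \<theta> \<and> \<theta> < lam (j + 1) \<longrightarrow> Q \<theta> Z Z' x" by blast
      then obtain Z Z' x where Q: "\<And>\<theta>. lam j < \<theta> \<Longrightarrow> \<theta> < lam (j + 1) \<Longrightarrow> Q \<theta> (Z \<theta>) (Z' \<theta>) (x \<theta>)"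
        by metis
      define \<rho> where "\<rho> \<theta> = ((ritz_value H S (Z' \<theta>) t - lam j) / (lam (j + 1) - ritz_value H S (Z' \<theta>) t)) /
                   ((\<theta> - lam j) / (lam (j + 1) - \<theta>))" for \<theta>
      \<comment> \<open>The upper bound is the first conjunct applied to the constructed steps. For
        the lower one, the quotient of ratios is (r - lam j) / (\<theta> - lam j) times (lam (j + 1)
        - \<theta>) / (lam (j + 1) - r), and \<open>r \<ge> lam j\<close> bounds the last
        denominator.\<close>
      have bounds: "g \<theta> / (1 + (\<theta> - lam j) * g \<theta> / (lam (j + 1) - lam j)) * ((lam (j + 1) - \<theta>) / (lam (j + 1) - lam j)) \<le> \<rho> \<theta>"
          "\<rho> \<theta> \<le> \<phi> (\<kappa> j) \<epsilon>" if \<theta>: "lam j < \<theta>" "\<theta> < lam (j + 1)" for \<theta>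
      proof -
        note q = Q[OF \<theta>, unfolded Q_def]
        define r where "r = ritz_value H S (Z' \<theta>) t"
        define D where "D = 1 + (\<theta> - lam j) * g \<theta> / (lam (j + 1) - lam j)"
        have D: "0 < D" unfolding D_def using \<theta> g0[of \<theta>] gap by (intro add_pos_nonneg) auto
        have up: "r < lam (j + 1) \<and> (r - lam j) / (lam (j + 1) - r)
            \<le> \<phi> (\<kappa> j) \<epsilon> * ((\<theta> - lam j) / (lam (j + 1) - \<theta>))"
          using upper[OF K K'(1), of "Z \<theta>" "Z' \<theta>" t j] q t j jr \<theta> unfolding K'(2) r_def by auto
        moreover have "0 < (\<theta> - lam j) / (lam (j + 1) - \<theta>)" using \<theta> by simp
        ultimately show "\<rho> \<theta> \<le> \<phi> (\<kappa> j) \<epsilon>"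
          unfolding \<rho>_def r_def[symmetric] by (simp only: pos_divide_le_eq)
        have low: "(\<theta> - lam j) * g \<theta> / D \<le> r - lam j" using q by (simp add: r_def D_def)
        moreover have "0 \<le> (\<theta> - lam j) * g \<theta> / D" using \<theta> g0[of \<theta>] D by simp
        ultimately have r_ge: "lam j \<le> r" by linarith
        have "g \<theta> / D * ((lam (j + 1) - \<theta>) / (lam (j + 1) - lam j))
            \<le> (r - lam j) / (\<theta> - lam j) * ((lam (j + 1) - \<theta>) / (lam (j + 1) - r))"
        proof (rule mult_mono)
          show "g \<theta> / D \<le> (r - lam j) / (\<theta> - lam j)"
            using low \<theta> by (simp add: pos_le_divide_eq mult.commute)
          show "(lam (j + 1) - \<theta>) / (lam (j + 1) - lam j) \<le> (lam (j + 1) - \<theta>) / (lam (j + 1) - r)"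
            using up r_ge \<theta> gap by (intro divide_left_mono) auto
        qed (use r_ge \<theta> gap in auto)
        also have "\<dots> = \<rho> \<theta>" unfolding \<rho>_def r_def[symmetric] by simp
        finally show "g \<theta> / (1 + (\<theta> - lam j) * g \<theta> / (lam (j + 1) - lam j)) * ((lam (j + 1) - \<theta>) / (lam (j + 1) - lam j)) \<le> \<rho> \<theta>"
          unfolding D_def .
      qed
      have near: "\<forall>\<^sub>F \<theta> in at_right (lam j). lam j < \<theta> \<and> \<theta> < lam (j + 1)"
        unfolding eventually_at_right_field using gap by blast
      have lim: "(\<rho> \<longlongrightarrow> \<phi> (\<kappa> j) \<epsilon>) (at_right (lam j))"
      proof (rule tendsto_sandwich)
        show "\<forall>\<^sub>F \<theta> in at_right (lam j). g \<theta> / (1 + (\<theta> - lam j) * g \<theta> / (lam (j + 1) - lam j))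
            * ((lam (j + 1) - \<theta>) / (lam (j + 1) - lam j)) \<le> \<rho> \<theta>"
          using near by (rule eventually_mono) (use bounds(1) in blast)
        show "\<forall>\<^sub>F \<theta> in at_right (lam j). \<rho> \<theta> \<le> \<phi> (\<kappa> j) \<epsilon>"
          using near by (rule eventually_mono) (use bounds(2) in blast)
        show "((\<lambda>\<theta>. g \<theta> / (1 + (\<theta> - lam j) * g \<theta> / (lam (j + 1) - lam j))
            * ((lam (j + 1) - \<theta>) / (lam (j + 1) - lam j))) \<longlongrightarrow> \<phi> (\<kappa> j) \<epsilon>) (at_right (lam j))"
          unfolding \<phi>_eq
          by (rule sharp_lower_bound_limit[OF \<nu>j(1) gap \<nu>j(2) \<epsilon> \<kappa>_eq m1_def m2_def b0_def b1_def b2_def g_def])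
      qed simp
      show ?case
      proof (rule exI[of _ "\<lambda>_. K"], rule exI[of _ Z], rule exI[of _ Z'], rule conjI, goal_cases)
        case 1
        show ?case using near by (rule eventually_mono) (use Q[unfolded Q_def] K K' in blast)
      next
        case 2
        show ?case using lim unfolding \<rho>_def .
      qed
    qed
  qed
qed

end
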